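(* Let $a,b,c\in\mathbb R$, let $K$ be a non-zero real constant, and consider the metric $$g^{a,b,c}=-\frac{K}{4\rho^2}\left(\frac{b\rho+2c}{a\rho^2+b\rho+c}\,d\rho^2+\frac{2(b\rho+2c)\,|d\zeta|^2}{(1+\frac a2|\zeta|^2)^2}+\frac{a\rho^2+b\rho+c}{b\rho+2c}\left(-\frac{dt}{K}+\frac{b\,\mathrm{Im}(\zeta\,d\bar\zeta)}{1+\frac a2|\zeta|^2}\right)^2\right)$$ in coordinates $(\rho,\zeta,t)\in\mathbb R\times\mathbb C\times\mathbb R$ with $\rho>0$, $a\rho^2+b\rho+c>0$, $b\rho+2c\ne0$, $1+\frac a2|\zeta|^2>0$, where $K$ is such that the metric is positive definite. Then $g^{a,b,c}$ is locally symmetric when $bc(b^2-4ac)=0$ and of cohomogeneity exactly $1$ otherwise. In the cohomogeneity $1$ case, there is a transitive locally isometric action on the constant-$\rho$ hypersurfaces of the Lie algebra $\mathfrak o(2)\ltimes\mathfrak{heis}_3(\mathbb R)$ if $a=0$, of $\mathfrak u(2)$ if $a>0$, and of $\mathfrak u(1,1)$ if $a<0$.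
   Context: A locally isometric action of a Lie algebra means a Lie algebra of Killing fields isomorphic to it; it is transitive on a hypersurface if the Killing fields are tangent to the hypersurface and span its tangent space at every point. Cohomogeneity exactly $1$ means that the (local) isometries have orbits of codimension exactly one. $\mathfrak{heis}_3(\mathbb R)$ is the three-dimensional Heisenberg algebra. *)

theory Defs
  imports "HOL-Analysis.Analysis"
begin

section \<open>Smooth maps on open subsets of Euclidean spaces\<close>

primrec Ck_on :: "nat \<Rightarrow> 'a::euclidean_space set \<Rightarrow> ('a \<Rightarrow> 'b::real_normed_vector) \<Rightarrow> bool" where
  "Ck_on 0 U f \<longleftrightarrow> continuous_on U f"
| "Ck_on (Suc k) U f \<longleftrightarrow>
     (\<forall>p\<in>U. f differentiable (at p)) \<and>
     (\<forall>v. Ck_on k U (\<lambda>p. frechet_derivative f (at p) v))"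

text \<open>Only used for open \<open>U\<close>.\<close>

definition smooth_on :: "'a::euclidean_space set \<Rightarrow> ('a \<Rightarrow> 'b::real_normed_vector) \<Rightarrow> bool" where
  "smooth_on U f \<longleftrightarrow> (\<forall>k. Ck_on k U f)"


section \<open>Riemannian geometry on open subsets of Euclidean spaces\<close>

text \<open>
  A manifold covered by a single chart is given by an open set \<open>M :: 'a set\<close> together with a metric
  \<open>g\<close>, where \<open>g p u v\<close> is the inner product at \<open>p\<close> of the tangent vectors \<open>u, v\<close>. Every tangent
  space is identified with \<open>'a\<close>, and a vector field is a map \<open>'a \<Rightarrow> 'a\<close>, of which only the values
  on \<open>M\<close> matter.
\<close>

type_synonym 'a metric = "'a \<Rightarrow> 'a \<Rightarrow> 'a \<Rightarrow> real"

definition pos_def_at :: "'a::real_vector metric \<Rightarrow> 'a \<Rightarrow> bool" where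
  "pos_def_at g p \<longleftrightarrow> (\<forall>v. v \<noteq> 0 \<longrightarrow> g p v v > 0)"

text \<open>\<open>dmetric g p w u v\<close> is the derivative in direction \<open>w\<close> of \<open>g(u, v)\<close> for constant \<open>u, v\<close>.\<close>

definition dmetric :: "'a::euclidean_space metric \<Rightarrow> 'a \<Rightarrow> 'a \<Rightarrow> 'a \<Rightarrow> 'a \<Rightarrow> real" where
  "dmetric g p w u v = frechet_derivative (\<lambda>q. g q u v) (at p) w"

text \<open>
  The Christoffel symbols, as a bilinear map on tangent vectors: the Koszul formula for constant
  vector fields. The vector is unique because \<open>g p\<close> is nondegenerate.
\<close>

definition christoffel :: "'a::euclidean_space metric \<Rightarrow> 'a \<Rightarrow> 'a \<Rightarrow> 'a \<Rightarrow> 'a" where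
  "christoffel g p u v =
     (THE z. \<forall>w. 2 * g p z w = dmetric g p u v w + dmetric g p v u w - dmetric g p w u v)"

definition levi_civita ::
    "'a::euclidean_space metric \<Rightarrow> ('a \<Rightarrow> 'a) \<Rightarrow> ('a \<Rightarrow> 'a) \<Rightarrow> ('a \<Rightarrow> 'a)" where
  "levi_civita g X Y p = frechet_derivative Y (at p) (X p) + christoffel g p (X p) (Y p)"

text \<open>
  The curvature tensor \<open>R(u,v)w = \<nabla>\<^sub>u \<nabla>\<^sub>v w - \<nabla>\<^sub>v \<nabla>\<^sub>u w - \<nabla>\<^bsub>[u,v]\<^esub> w\<close> at \<open>p\<close>. By tensoriality the
  tangent vectors may be extended to constant vector fields, whose brackets vanish.
\<close>

definition riemann :: "'a::euclidean_space metric \<Rightarrow> 'a \<Rightarrow> 'a \<Rightarrow> 'a \<Rightarrow> 'a \<Rightarrow> 'a" where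
  "riemann g p u v w =
     levi_civita g (\<lambda>_. u) (levi_civita g (\<lambda>_. v) (\<lambda>_. w)) p
     - levi_civita g (\<lambda>_. v) (levi_civita g (\<lambda>_. u) (\<lambda>_. w)) p"

text \<open>\<open>(\<nabla>\<^sub>x R)(u,v)w\<close> at \<open>p\<close>, again computed with constant extensions of \<open>x, u, v, w\<close>.\<close>

definition nabla_riemann :: "'a::euclidean_space metric \<Rightarrow> 'a \<Rightarrow> 'a \<Rightarrow> 'a \<Rightarrow> 'a \<Rightarrow> 'a \<Rightarrow> 'a" where
  "nabla_riemann g p x u v w =
     levi_civita g (\<lambda>_. x) (\<lambda>q. riemann g q u v w) p
     - riemann g p (levi_civita g (\<lambda>_. x) (\<lambda>_. u) p) v w
     - riemann g p u (levi_civita g (\<lambda>_. x) (\<lambda>_. v) p) w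
     - riemann g p u v (levi_civita g (\<lambda>_. x) (\<lambda>_. w) p)"

definition locally_symmetric :: "'a::euclidean_space set \<Rightarrow> 'a metric \<Rightarrow> bool" where
  "locally_symmetric M g \<longleftrightarrow> (\<forall>p\<in>M. \<forall>x u v w. nabla_riemann g p x u v w = 0)"


section \<open>Local isometries and cohomogeneity one\<close>

text \<open>A local isometry is an isometry from an open subset of \<open>M\<close> onto an open subset of \<open>M\<close>.\<close>

definition local_isometry ::
    "'a::euclidean_space set \<Rightarrow> 'a metric \<Rightarrow> 'a set \<Rightarrow> ('a \<Rightarrow> 'a) \<Rightarrow> bool" where
  "local_isometry M g U \<phi> \<longleftrightarrow>
     open U \<and> U \<subseteq> M \<and> open (\<phi> ` U) \<and> \<phi> ` U \<subseteq> M \<and>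
     inj_on \<phi> U \<and> smooth_on U \<phi> \<and> smooth_on (\<phi> ` U) (the_inv_into U \<phi>) \<and>
     (\<forall>p\<in>U. \<forall>u v. g (\<phi> p) (frechet_derivative \<phi> (at p) u) (frechet_derivative \<phi> (at p) v) = g p u v)"

definition isometry_orbit :: "'a::euclidean_space set \<Rightarrow> 'a metric \<Rightarrow> 'a \<Rightarrow> 'a set" where
  "isometry_orbit M g p = {\<phi> p |\<phi> U. local_isometry M g U \<phi> \<and> p \<in> U}"

text \<open>Embedded smooth submanifolds of codimension exactly one.\<close>

definition smooth_hypersurface :: "'a::euclidean_space set \<Rightarrow> bool" where
  "smooth_hypersurface S \<longleftrightarrow>
     (\<forall>q\<in>S. \<exists>N (h :: 'a \<Rightarrow> real). open N \<and> q \<in> N \<and> smooth_on N h \<and>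
        (\<forall>x\<in>N. frechet_derivative h (at x) \<noteq> (\<lambda>_. 0)) \<and>
        S \<inter> N = {x \<in> N. h x = 0})"

definition cohomogeneity_one :: "'a::euclidean_space set \<Rightarrow> 'a metric \<Rightarrow> bool" where
  "cohomogeneity_one M g \<longleftrightarrow> (\<forall>p\<in>M. smooth_hypersurface (isometry_orbit M g p))"


section \<open>Lie algebras of Killing fields\<close>

definition lie_bracket_vf :: "('a::euclidean_space \<Rightarrow> 'a) \<Rightarrow> ('a \<Rightarrow> 'a) \<Rightarrow> ('a \<Rightarrow> 'a)" where
  "lie_bracket_vf X Y p = frechet_derivative Y (at p) (X p) - frechet_derivative X (at p) (Y p)"

text \<open>The last clause is \<open>(L\<^sub>X g)(u, v) = 0\<close>, written out for constant \<open>u, v\<close>.\<close>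

definition killing_field :: "'a::euclidean_space set \<Rightarrow> 'a metric \<Rightarrow> ('a \<Rightarrow> 'a) \<Rightarrow> bool" where
  "killing_field M g X \<longleftrightarrow> smooth_on M X \<and>
     (\<forall>p\<in>M. \<forall>u v. dmetric g p (X p) u v
        + g p (frechet_derivative X (at p) u) v + g p u (frechet_derivative X (at p) v) = 0)"

text \<open>
  \<open>\<Phi>\<close> is an isomorphism from the Lie algebra with carrier \<open>L\<close> and bracket \<open>br\<close> onto a Lie algebra
  of Killing fields on \<open>M\<close>; vector fields are identified if they agree on \<open>M\<close>.
\<close>

definition isometric_lie_action ::
    "'a::euclidean_space set \<Rightarrow> 'a metric \<Rightarrow> 'l::real_vector set \<Rightarrow> ('l \<Rightarrow> 'l \<Rightarrow> 'l) \<Rightarrow> ('l \<Rightarrow> 'a \<Rightarrow> 'a) \<Rightarrow> bool"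
  where
  "isometric_lie_action M g L br \<Phi> \<longleftrightarrow>
     (\<forall>x\<in>L. killing_field M g (\<Phi> x)) \<and>
     (\<forall>x\<in>L. \<forall>y\<in>L. \<forall>p\<in>M. \<Phi> (x + y) p = \<Phi> x p + \<Phi> y p) \<and>
     (\<forall>r. \<forall>x\<in>L. \<forall>p\<in>M. \<Phi> (r *\<^sub>R x) p = r *\<^sub>R \<Phi> x p) \<and>
     (\<forall>x\<in>L. \<forall>y\<in>L. \<forall>p\<in>M. \<Phi> (br x y) p = lie_bracket_vf (\<Phi> x) (\<Phi> y) p) \<and>
     (\<forall>x\<in>L. (\<forall>p\<in>M. \<Phi> x p = 0) \<longrightarrow> x = 0)"

text \<open>
  The action is tangent to the level sets of \<open>f\<close> in \<open>M\<close> and transitive on each of them; the tangent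
  space at \<open>p\<close> of the level set through \<open>p\<close> is the kernel of the differential of \<open>f\<close>.
\<close>

definition transitive_action_on_levels ::
    "'a::euclidean_space set \<Rightarrow> 'a metric \<Rightarrow> ('a \<Rightarrow> real) \<Rightarrow> 'l::real_vector set \<Rightarrow> ('l \<Rightarrow> 'l \<Rightarrow> 'l) \<Rightarrow> bool"
  where
  "transitive_action_on_levels M g f L br \<longleftrightarrow>
     (\<exists>\<Phi>. isometric_lie_action M g L br \<Phi> \<and>
        (\<forall>p\<in>M. span {\<Phi> x p |x. x \<in> L} = {v. frechet_derivative f (at p) v = 0}))"


section \<open>The Lie algebras $\mathfrak{u}(2)$, $\mathfrak{u}(1,1)$ and $\mathfrak{o}(2)\ltimes\mathfrak{heis}_3(\mathbb{R})$\<close>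

definition commutator :: "('k::ring_1)^'n^'n \<Rightarrow> 'k^'n^'n \<Rightarrow> 'k^'n^'n" where
  "commutator A B = A ** B - B ** A"

definition conj_transpose :: "complex^'n^'m \<Rightarrow> complex^'m^'n" where
  "conj_transpose A = (\<chi> i j. cnj (A $ j $ i))"

definition u2 :: "(complex^2^2) set" where
  "u2 = {A. conj_transpose A + A = 0}"

definition J11 :: "complex^2^2" where
  "J11 = (\<chi> i j. if i = j then (if i = 1 then 1 else - 1) else 0)"

definition u11 :: "(complex^2^2) set" where
  "u11 = {A. conj_transpose A ** J11 + J11 ** A = 0}"

text \<open>The Heisenberg algebra is \<open>\<real>\<^sup>2 \<oplus> \<real>\<close> with bracket given by the standard area form on \<open>\<real>\<^sup>2\<close>.\<close>

definition heis_bracket :: "(real^2) \<times> real \<Rightarrow> (real^2) \<times> real \<Rightarrow> (real^2) \<times> real" where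
  "heis_bracket x y = (0, fst x $ 1 * fst y $ 2 - fst x $ 2 * fst y $ 1)"

definition o2 :: "(real^2^2) set" where
  "o2 = {A. transpose A + A = 0}"

text \<open>
  \<open>o2\<close> acts on the Heisenberg algebra by derivations: the standard representation on \<open>\<real>\<^sup>2\<close>, and
  trivially on the centre (the trace of \<open>A\<close> vanishes).
\<close>

definition o2_deriv :: "real^2^2 \<Rightarrow> (real^2) \<times> real \<Rightarrow> (real^2) \<times> real" where
  "o2_deriv A x = (A *v fst x, 0)"

definition o2_heis :: "((real^2^2) \<times> ((real^2) \<times> real)) set" where
  "o2_heis = o2 \<times> UNIV"

definition o2_heis_bracket ::
    "(real^2^2) \<times> ((real^2) \<times> real) \<Rightarrow> (real^2^2) \<times> ((real^2) \<times> real) \<Rightarrow> (real^2^2) \<times> ((real^2) \<times> real)" where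
  "o2_heis_bracket X Y =
     (commutator (fst X) (fst Y),
      o2_deriv (fst X) (snd Y) - o2_deriv (fst Y) (snd X) + heis_bracket (snd X) (snd Y))"


section \<open>The metrics $g^{a,b,c}$\<close>

text \<open>
  Points and tangent vectors are triples \<open>(\<rho>, \<zeta>, t)\<close>. The form \<open>abc_form\<close> is
  \<open>- dt/K + b Im(\<zeta> d\<zeta>\<^sup>*) / (1 + a/2 |\<zeta>|\<^sup>2)\<close>, and \<open>\<bullet>\<close> on the complex numbers is the
  polarisation of \<open>|d\<zeta>|\<^sup>2\<close>.
\<close>

type_synonym point = "real \<times> complex \<times> real"

definition abc_form :: "real \<Rightarrow> real \<Rightarrow> real \<Rightarrow> point \<Rightarrow> point \<Rightarrow> real" where
  "abc_form a b K = (\<lambda>(\<rho>, \<zeta>, t) (d\<rho>, d\<zeta>, dt).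
     - dt / K + b * Im (\<zeta> * cnj d\<zeta>) / (1 + a / 2 * (cmod \<zeta>)\<^sup>2))"

definition abc_metric :: "real \<Rightarrow> real \<Rightarrow> real \<Rightarrow> real \<Rightarrow> point metric" where
  "abc_metric a b c K = (\<lambda>(\<rho>, \<zeta>, t) (d\<rho>, d\<zeta>, dt) (d\<rho>', d\<zeta>', dt').
     - K / (4 * \<rho>\<^sup>2) *
       ((b * \<rho> + 2 * c) / (a * \<rho>\<^sup>2 + b * \<rho> + c) * (d\<rho> * d\<rho>')
        + 2 * (b * \<rho> + 2 * c) * (d\<zeta> \<bullet> d\<zeta>') / (1 + a / 2 * (cmod \<zeta>)\<^sup>2)\<^sup>2
        + (a * \<rho>\<^sup>2 + b * \<rho> + c) / (b * \<rho> + 2 * c)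
          * (abc_form a b K (\<rho>, \<zeta>, t) (d\<rho>, d\<zeta>, dt) * abc_form a b K (\<rho>, \<zeta>, t) (d\<rho>', d\<zeta>', dt'))))"

text \<open>
  The sign of \<open>b * \<rho> + 2 * c\<close> may change along \<open>\<rho> > 0\<close>, and then no \<open>K\<close> makes the metric positive
  definite wherever it is defined. The manifold is therefore the part of the coordinate domain on
  which the metric with the given \<open>K\<close> is positive definite.
\<close>

definition abc_manifold :: "real \<Rightarrow> real \<Rightarrow> real \<Rightarrow> real \<Rightarrow> point set" where
  "abc_manifold a b c K = {(\<rho>, \<zeta>, t).
     \<rho> > 0 \<and> a * \<rho>\<^sup>2 + b * \<rho> + c > 0 \<and> b * \<rho> + 2 * c \<noteq> 0 \<and> 1 + a / 2 * (cmod \<zeta>)\<^sup>2 > 0 \<and>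
     pos_def_at (abc_metric a b c K) (\<rho>, \<zeta>, t)}"

end

theory Submission
  imports Defs
begin

text \<open>
  The Christoffel symbols and the curvature are natural under local isometries. Moebius
  transformations in \<open>\<zeta>\<close>, compensated by a shift of \<open>t\<close>, act transitively on the level sets of \<open>\<rho>\<close>,
  so the curvature only has to be computed at \<open>\<zeta> = 0\<close>. There it is
  \<open>A (g(v,w) u - g(u,w) v) + B (\<omega>(v,w) Ju - \<omega>(u,w) Jv - 2 \<omega>(u,v) Jw)\<close> for an orthogonal almost complex
  structure \<open>J\<close> with \<open>\<omega>(u,v) = g(Ju,v)\<close>, where
  \<open>B = b (b\<^sup>2 - 4ac) \<rho>\<^sup>3 / (K (b\<rho> + 2c)\<^sup>3)\<close> and \<open>A = 2/K - B\<close>. If \<open>b (b\<^sup>2 - 4ac) = 0\<close> then \<open>B = 0\<close>; if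
  \<open>c = 0\<close> then \<open>B\<close> is constant and \<open>J\<close> is parallel; in both cases \<open>\<nabla>R = 0\<close>. Otherwise the sectional
  curvature of a \<open>J\<close>-invariant plane recovers \<open>\<bar>B\<bar>\<close>, a strictly monotone function of \<open>\<rho>\<close>, so the orbits
  are exactly the level sets. Differentiating the Moebius action gives the Killing fields.
\<close>

subsection \<open>Smooth maps\<close>

text \<open>\<open>christoffel\<close> is a definite description, so nothing can be computed before
  a candidate is known to satisfy the Koszul formula; hence the explicit \<open>\<Gamma>\<close>
  carried as a locale parameter. In d\<rho>, d\<zeta>, \<eta> the metric is diagonal. The
  derivatives of its profile functions are recorded as first-order equations whose remainders are
  multiples of \<open>A\<close> and \<open>B\<close>, so that matching the curvature becomes
  polynomial algebra. That \<open>A + B\<close> is the constant 2/K expresses that the metric is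
  Einstein, with Ricci tensor 6/K times the metric. Geometrically \<eta> is a connection form over a
  surface of constant curvature 2a, and d\<eta> is a multiple of its area form. A Moebius isometry
  of the surface preserves d\<eta> but changes \<eta> by an exact form, in essence the differential
  of the argument of the denominator; this is where the shift of t and the branch of the logarithm
  come from. An isometry is not known to respect J. Comparing one plane with its image therefore
  yields only an inequality between the values of |B|; the inverse of the differential yields the
  reverse one.\<close>

lemma has_derivative_frechet:
  "f differentiable (at p) \<Longrightarrow> (f has_derivative frechet_derivative f (at p)) (at p)"
  by (simp add: frechet_derivative_works)

lemma frechet_derivative_eqI:
  "(f has_derivative f') (at p) \<Longrightarrow> frechet_derivative f (at p) = f'"
  by (metis frechet_derivative_at)

text \<open>On an open set the derivative at a point depends only on the values nearby, so equality
  on \<open>U\<close> passes to all derivatives. This allows computed derivatives, known only on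
  \<open>U\<close>, to replace \<open>frechet_derivative\<close>.\<close>

lemma Ck_on_cong:
  assumes "open U" "\<And>p. p \<in> U \<Longrightarrow> f p = g p"
  shows "Ck_on k U f \<longleftrightarrow> Ck_on k U g"
  using assms(2)
proof (induction k arbitrary: f g)
  case 0
  then show ?case by (simp cong: continuous_on_cong)
next
  case (Suc k)
  have imp: "g differentiable (at p) \<and> frechet_derivative f (at p) = frechet_derivative g (at p)"
    if eq: "\<And>p. p \<in> U \<Longrightarrow> f p = g p" and p: "p \<in> U" and d: "f differentiable (at p)" for f g :: "'a \<Rightarrow> 'b" and p
  proof -
    have "(g has_derivative frechet_derivative f (at p)) (at p)"
      by (rule has_derivative_transform_within_open[OF has_derivative_frechet[OF d] assms(1) p eq])
    then show ?thesis
      by (metis differentiableI frechet_derivative_eqI)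
  qed
  have *: "Ck_on (Suc k) U g"
    if eq: "\<And>p. p \<in> U \<Longrightarrow> f p = g p" and f: "Ck_on (Suc k) U f" for f g :: "'a \<Rightarrow> 'b"
  proof -
    have fd: "\<And>p. p \<in> U \<Longrightarrow> f differentiable (at p)"
      using f by simp
    have "Ck_on k U (\<lambda>p. frechet_derivative g (at p) v)" for v
    proof -
      have "Ck_on k U (\<lambda>p. frechet_derivative f (at p) v) = Ck_on k U (\<lambda>p. frechet_derivative g (at p) v)"
        by (rule Suc.IH) (use imp[OF eq _ fd] in auto)
      then show ?thesis using f by simp
    qed
    then show ?thesis using imp[OF eq _ fd] by simp
  qed
  show ?case
  proof
    show "Ck_on (Suc k) U f \<Longrightarrow> Ck_on (Suc k) U g"
      by (rule *) (use Suc.prems in auto)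
    show "Ck_on (Suc k) U g \<Longrightarrow> Ck_on (Suc k) U f"
      by (rule *) (use Suc.prems in auto)
  qed
qed

lemma Ck_on_SucI:
  assumes "open U" "\<And>p. p \<in> U \<Longrightarrow> (f has_derivative f' p) (at p)"
    and "\<And>v. Ck_on k U (\<lambda>p. f' p v)"
  shows "Ck_on (Suc k) U f"
proof -
  have "Ck_on k U (\<lambda>p. frechet_derivative f (at p) v)" for v
    using assms(3)[of v] Ck_on_cong[OF assms(1), of "\<lambda>p. f' p v" "\<lambda>p. frechet_derivative f (at p) v" k]
    by (simp add: frechet_derivative_eqI[OF assms(2)])
  then show ?thesis
    using assms(2) by (auto simp: differentiable_def)
qed

lemma Ck_on_SucD:
  assumes "Ck_on (Suc k) U f"
  shows "p \<in> U \<Longrightarrow> (f has_derivative frechet_derivative f (at p)) (at p)"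
    and "Ck_on k U (\<lambda>p. frechet_derivative f (at p) v)"
  using assms by (auto intro: has_derivative_frechet)

lemma Ck_on_Suc_imp: "Ck_on (Suc k) U f \<Longrightarrow> Ck_on k U f"
proof (induction k arbitrary: f)
  case 0
  then show ?case
    by (auto intro!: continuous_at_imp_continuous_on differentiable_imp_continuous_within)
next
  case (Suc k)
  have "Ck_on k U (\<lambda>p. frechet_derivative f (at p) v)" for v
    by (rule Suc.IH) (rule Ck_on_SucD(2)[OF Suc.prems])
  then show ?case
    using Suc.prems by simp
qed

lemma Ck_on_const: "open U \<Longrightarrow> Ck_on k U (\<lambda>_. c)"
proof (induction k arbitrary: c)
  case (Suc k)
  then show ?case by (intro Ck_on_SucI[where f' = "\<lambda>_ _. 0"]) auto
qed simp

lemma Ck_on_add: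
  assumes "open U" "Ck_on k U f" "Ck_on k U g"
  shows "Ck_on k U (\<lambda>x. f x + g x)"
  using assms(2,3)
proof (induction k arbitrary: f g)
  case 0
  then show ?case by (auto intro: continuous_on_add)
next
  case (Suc k)
  show ?case
    by (rule Ck_on_SucI[OF assms(1) has_derivative_add])
       (use Suc.prems in \<open>auto intro!: Suc.IH has_derivative_frechet\<close>)
qed

lemma Ck_on_bounded_linear:
  assumes "bounded_linear L" "open U" "Ck_on k U f"
  shows "Ck_on k U (\<lambda>x. L (f x))"
  using assms(3)
proof (induction k arbitrary: f)
  case 0
  then show ?case by (auto intro: bounded_linear.continuous_on[OF assms(1)])
next
  case (Suc k)
  show ?case
    by (rule Ck_on_SucI[OF assms(2) bounded_linear.has_derivative[OF assms(1)]])
       (use Suc.prems in \<open>auto intro!: Suc.IH has_derivative_frechet\<close>)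
qed

text \<open>The product rule pairs a derivative of one factor with the other factor itself, which is
  why the induction step also lowers the regularity of \<open>f\<close> and \<open>g\<close> by
  one.\<close>

lemma Ck_on_bounded_bilinear:
  assumes "bounded_bilinear B" "open U" "Ck_on k U f" "Ck_on k U g"
  shows "Ck_on k U (\<lambda>x. B (f x) (g x))"
  using assms(3,4)
proof (induction k arbitrary: f g)
  case 0
  then show ?case by (auto intro: bounded_bilinear.continuous_on[OF assms(1)])
next
  case (Suc k)
  show ?case
  proof (rule Ck_on_SucI[OF assms(2) bounded_bilinear.FDERIV[OF assms(1)]])
    fix v
    show "Ck_on k U (\<lambda>p. B (f p) (frechet_derivative g (at p) v) + B (frechet_derivative f (at p) v) (g p))"
      using Suc.prems Ck_on_Suc_imp[OF Suc.prems(1)] Ck_on_Suc_imp[OF Suc.prems(2)]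
      by (intro Ck_on_add assms(2) Suc.IH) auto
  qed (use Suc.prems in \<open>auto intro!: has_derivative_frechet\<close>)
qed

lemma Ck_on_inverse:
  fixes f :: "'a::euclidean_space \<Rightarrow> 'b::real_normed_field"
  assumes "open U" "Ck_on k U f" "\<And>x. x \<in> U \<Longrightarrow> f x \<noteq> 0"
  shows "Ck_on k U (\<lambda>x. inverse (f x))"
  using assms(2)
proof (induction k)
  case 0
  then show ?case using assms(3) by (auto intro: continuous_on_inverse)
next
  case (Suc k)
  note bil = Ck_on_bounded_bilinear[OF bounded_bilinear_mult assms(1)]
  have c: "Ck_on k U (\<lambda>x. inverse (f x))"
    by (rule Suc.IH) (rule Ck_on_Suc_imp[OF Suc.prems])
  show ?case
  proof (rule Ck_on_SucI[OF assms(1)])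
    show "((\<lambda>x. inverse (f x)) has_derivative
        (\<lambda>v. - (inverse (f p) * frechet_derivative f (at p) v * inverse (f p)))) (at p)" if "p \<in> U" for p
      by (rule Deriv.has_derivative_inverse) (use that assms(3) Ck_on_SucD(1)[OF Suc.prems] in auto)
    show "Ck_on k U (\<lambda>p. - (inverse (f p) * frechet_derivative f (at p) v * inverse (f p)))" for v
      by (intro Ck_on_bounded_linear[OF bounded_linear_minus[OF bounded_linear_ident] assms(1)]
           bil c Ck_on_SucD(2)[OF Suc.prems])
  qed
qed

text \<open>One differentiation turns Ln into an inverse, which is already covered; a case
  distinction on \<open>k\<close> replaces an induction.\<close>

lemma Ck_on_Ln:
  fixes f :: "'a::euclidean_space \<Rightarrow> complex"
  assumes "open U" "Ck_on k U f" "\<And>x. x \<in> U \<Longrightarrow> f x \<notin> \<real>\<^sub>\<le>\<^sub>0"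
  shows "Ck_on k U (\<lambda>x. Ln (f x))"
proof (cases k)
  case 0
  then show ?thesis using assms by (auto intro!: continuous_intros)
next
  case (Suc l)
  note f = assms(2)[unfolded Suc]
  show ?thesis unfolding Suc
  proof (rule Ck_on_SucI[OF assms(1)])
    show "((\<lambda>x. Ln (f x)) has_derivative
        (\<lambda>v. inverse (f p) * frechet_derivative f (at p) v)) (at p)" if "p \<in> U" for p
      using has_derivative_compose[OF Ck_on_SucD(1)[OF f that], of Ln "\<lambda>v. inverse (f p) * v"]
        has_field_derivative_Ln[OF assms(3)[OF that]]
      by (simp add: has_field_derivative_def)
    show "Ck_on l U (\<lambda>p. inverse (f p) * frechet_derivative f (at p) v)" for v
      by (intro Ck_on_bounded_bilinear[OF bounded_bilinear_mult assms(1)] Ck_on_inverse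
          Ck_on_SucD(2)[OF f] Ck_on_Suc_imp[OF f] assms) 
         (use assms(3) in force)
  qed
qed

lemma smooth_on_const: "open U \<Longrightarrow> smooth_on U (\<lambda>_. c)"
  by (simp add: smooth_on_def Ck_on_const)

lemma smooth_on_add:
  "open U \<Longrightarrow> smooth_on U f \<Longrightarrow> smooth_on U g \<Longrightarrow> smooth_on U (\<lambda>x. f x + g x)"
  by (simp add: smooth_on_def Ck_on_add)

lemma smooth_on_bounded_linear:
  "bounded_linear L \<Longrightarrow> open U \<Longrightarrow> smooth_on U f \<Longrightarrow> smooth_on U (\<lambda>x. L (f x))"
  by (simp add: smooth_on_def Ck_on_bounded_linear)

lemma smooth_on_mult:
  fixes f g :: "'a::euclidean_space \<Rightarrow> 'b::real_normed_algebra"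
  shows "open U \<Longrightarrow> smooth_on U f \<Longrightarrow> smooth_on U g \<Longrightarrow> smooth_on U (\<lambda>x. f x * g x)"
  by (simp add: smooth_on_def Ck_on_bounded_bilinear[OF bounded_bilinear_mult])

lemma smooth_on_inverse:
  fixes f :: "'a::euclidean_space \<Rightarrow> 'b::real_normed_field"
  shows "open U \<Longrightarrow> smooth_on U f \<Longrightarrow> (\<And>x. x \<in> U \<Longrightarrow> f x \<noteq> 0) \<Longrightarrow> smooth_on U (\<lambda>x. inverse (f x))"
  by (simp add: smooth_on_def Ck_on_inverse)

lemma smooth_on_Ln:
  fixes f :: "'a::euclidean_space \<Rightarrow> complex"
  shows "open U \<Longrightarrow> smooth_on U f \<Longrightarrow> (\<And>x. x \<in> U \<Longrightarrow> f x \<notin> \<real>\<^sub>\<le>\<^sub>0) \<Longrightarrow> smooth_on U (\<lambda>x. Ln (f x))"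
  by (simp add: smooth_on_def Ck_on_Ln)

lemma smooth_on_ident: "open U \<Longrightarrow> smooth_on U (\<lambda>x. x)"
  unfolding smooth_on_def
proof
  fix k assume "open U"
  then show "Ck_on k U (\<lambda>x. x)"
  proof (cases k)
    case 0
    then show ?thesis by (simp add: continuous_on_id)
  next
    case (Suc l)
    show ?thesis
      unfolding Suc by (rule Ck_on_SucI[where f' = "\<lambda>_ v. v"]) (simp_all add: \<open>open U\<close> Ck_on_const)
  qed
qed

lemma smooth_on_Pair:
  fixes f :: "'a::euclidean_space \<Rightarrow> 'b::real_normed_vector" and g :: "'a \<Rightarrow> 'c::real_normed_vector"
  assumes "open U" "smooth_on U f" "smooth_on U g"
  shows "smooth_on U (\<lambda>x. (f x, g x))"
proof -
  have 1: "bounded_linear (\<lambda>y::'b. (y, 0::'c))" and 2: "bounded_linear (\<lambda>y::'c. (0::'b, y))"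
    by (auto intro!: bounded_linear_Pair bounded_linear_ident bounded_linear_zero)
  show ?thesis
    using smooth_on_add[OF assms(1) smooth_on_bounded_linear[OF 1 assms(1,2)]
        smooth_on_bounded_linear[OF 2 assms(1,3)]] by simp
qed

lemma smooth_on_cong:
  "open U \<Longrightarrow> (\<And>p. p \<in> U \<Longrightarrow> f p = g p) \<Longrightarrow> smooth_on U f \<longleftrightarrow> smooth_on U g"
  by (simp add: smooth_on_def Ck_on_cong[of U f g])

lemma smooth_onD:
  assumes "smooth_on U f"
  shows "p \<in> U \<Longrightarrow> f differentiable (at p)"
    and "smooth_on U (\<lambda>p. frechet_derivative f (at p) v)"
proof -
  have S: "Ck_on k U f" for k
    using assms by (simp add: smooth_on_def)
  show "p \<in> U \<Longrightarrow> f differentiable (at p)"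
    using S[of 1] by simp
  show "smooth_on U (\<lambda>p. frechet_derivative f (at p) v)"
    using Ck_on_SucD(2)[OF S] by (simp add: smooth_on_def)
qed

text \<open>The second difference quotient over the parallelogram spanned by \<open>s u\<close> and \<open>s v\<close> tends to the
  mixed derivative and is symmetric in \<open>u\<close> and \<open>v\<close>.\<close>

lemma second_difference:
  fixes f :: "'a::euclidean_space \<Rightarrow> real"
  assumes U: "open U" "p \<in> U" and f: "Ck_on 2 U f" and e: "e > 0"
  shows "\<exists>\<delta>>0. \<forall>s. 0 < s \<and> s < \<delta> \<longrightarrow>
    \<bar>(f (p + s *\<^sub>R u + s *\<^sub>R v) - f (p + s *\<^sub>R u) - f (p + s *\<^sub>R v) + f p)
      - s\<^sup>2 * frechet_derivative (\<lambda>q. frechet_derivative f (at q) u) (at p) v\<bar> \<le> e * s\<^sup>2"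
proof -
  define fu where "fu = (\<lambda>q. frechet_derivative f (at q) u)"
  define fuv where "fuv = (\<lambda>q. frechet_derivative fu (at q) v)"
  have f2: "Ck_on (Suc (Suc 0)) U f"
    using f by (simp add: numeral_2_eq_2)
  have d1: "(f has_derivative frechet_derivative f (at q)) (at q)" if "q \<in> U" for q
    using Ck_on_SucD(1)[OF f2 that] .
  have f1: "Ck_on (Suc 0) U fu"
    using Ck_on_SucD(2)[OF f2] unfolding fu_def .
  have d2: "(fu has_derivative frechet_derivative fu (at q)) (at q)" if "q \<in> U" for q
    using Ck_on_SucD(1)[OF f1 that] .
  have "continuous_on U fuv"
    using Ck_on_SucD(2)[OF f1, of v] unfolding fuv_def by simp
  then have "isCont fuv p"
    using U continuous_on_eq_continuous_at by blast
  then obtain r1 where r1: "r1 > 0" "\<And>q. dist q p < r1 \<Longrightarrow> dist (fuv q) (fuv p) < e"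
    using e unfolding continuous_at_eps_delta by blast
  obtain r2 where r2: "r2 > 0" "ball p r2 \<subseteq> U"
    using U open_contains_ball by blast
  define r where "r = min r1 r2"
  have r: "r > 0" "\<And>q. dist q p < r \<Longrightarrow> q \<in> U" "\<And>q. dist q p < r \<Longrightarrow> dist (fuv q) (fuv p) < e"
    using r1 r2 by (auto simp: r_def dist_commute subset_iff)
  \<comment> \<open>With this bound the whole parallelogram stays in the ball of radius
    \<open>r\<close>; the summand 1 keeps the denominator positive when \<open>u\<close> and
    \<open>v\<close> both vanish.\<close>
  define \<delta> where "\<delta> = r / (norm u + norm v + 1)"
  have pos: "norm u + norm v + 1 > 0" by (smt (verit) norm_ge_zero)
  have \<delta>: "\<delta> > 0" unfolding \<delta>_def using r(1) pos by simp
  show ?thesis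
  proof (intro exI[of _ \<delta>] conjI allI impI)
    fix s :: real assume s: "0 < s \<and> s < \<delta>"
    have near: "dist (p + x *\<^sub>R u + y *\<^sub>R v) p < r" if "0 \<le> x" "x \<le> s" "0 \<le> y" "y \<le> s" for x y
    proof -
      have "norm (x *\<^sub>R u + y *\<^sub>R v) \<le> x * norm u + y * norm v"
        using norm_triangle_ineq[of "x *\<^sub>R u" "y *\<^sub>R v"] that by simp
      also have "\<dots> \<le> s * norm u + s * norm v"
        using that by (intro add_mono mult_right_mono) auto
      also have "\<dots> < s * (norm u + norm v + 1)"
        using s by (simp add: algebra_simps)
      also have "\<dots> < r"
        using s pos by (simp add: \<delta>_def pos_less_divide_eq)
      finally show ?thesis by (simp add: dist_norm add.assoc)
    qed
    \<comment> \<open>The second difference is the increment of \<open>A\<close> from 0 to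
      \<open>s\<close>. The mean value theorem is applied to it in the direction \<open>u\<close>,
      and then to the resulting difference of \<open>fu\<close> in the direction
      \<open>v\<close>.\<close>
    define A where "A = (\<lambda>x. f (p + x *\<^sub>R u + s *\<^sub>R v) - f (p + x *\<^sub>R u))"
    have "\<exists>x>0. x < s \<and> A s - A 0 = (s - 0) * (fu (p + x *\<^sub>R u + s *\<^sub>R v) - fu (p + x *\<^sub>R u))"
    proof (rule MVT2)
      fix x assume x: "0 \<le> x" "x \<le> s"
      have "p + x *\<^sub>R u + s *\<^sub>R v \<in> U" "p + x *\<^sub>R u \<in> U"
        using near[of x s] near[of x 0] x s r(2) by auto
      note dd = d1[OF this(1)] d1[OF this(2)]
      have "(A has_derivative (\<lambda>h. frechet_derivative f (at (p + x *\<^sub>R u + s *\<^sub>R v)) (h *\<^sub>R u)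
          - frechet_derivative f (at (p + x *\<^sub>R u)) (h *\<^sub>R u))) (at x)"
        unfolding A_def
        by (intro has_derivative_diff
              has_derivative_compose[where g = f and f = "\<lambda>x. p + x *\<^sub>R u + s *\<^sub>R v", OF _ dd(1)]
              has_derivative_compose[where g = f and f = "\<lambda>x. p + x *\<^sub>R u", OF _ dd(2)])
           (auto intro!: derivative_eq_intros)
      then show "(A has_real_derivative fu (p + x *\<^sub>R u + s *\<^sub>R v) - fu (p + x *\<^sub>R u)) (at x)"
        by (rule has_derivative_imp_has_field_derivative)
           (simp add: fu_def linear_scale[OF has_derivative_linear[OF dd(1)]]
              linear_scale[OF has_derivative_linear[OF dd(2)]] right_diff_distrib)
    qed (use s in auto)
    then obtain x where x: "0 < x" "x < s"
      "A s - A 0 = s * (fu (p + x *\<^sub>R u + s *\<^sub>R v) - fu (p + x *\<^sub>R u))"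
      by auto
    have "\<exists>y>0. y < s \<and> fu (p + x *\<^sub>R u + s *\<^sub>R v) - fu (p + x *\<^sub>R u + 0 *\<^sub>R v)
        = (s - 0) * fuv (p + x *\<^sub>R u + y *\<^sub>R v)"
    proof (rule MVT2)
      fix y assume y: "0 \<le> y" "y \<le> s"
      have "p + x *\<^sub>R u + y *\<^sub>R v \<in> U"
        using near[of x y] x y s r(2) by auto
      note dd = d2[OF this]
      have "((\<lambda>y. fu (p + x *\<^sub>R u + y *\<^sub>R v)) has_derivative
          (\<lambda>h. frechet_derivative fu (at (p + x *\<^sub>R u + y *\<^sub>R v)) (h *\<^sub>R v))) (at y)"
        by (intro has_derivative_compose[where g = fu and f = "\<lambda>y. p + x *\<^sub>R u + y *\<^sub>R v", OF _ dd])
           (auto intro!: derivative_eq_intros)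
      then show "((\<lambda>y. fu (p + x *\<^sub>R u + y *\<^sub>R v)) has_real_derivative fuv (p + x *\<^sub>R u + y *\<^sub>R v)) (at y)"
        by (rule has_derivative_imp_has_field_derivative)
           (simp add: fuv_def linear_scale[OF has_derivative_linear[OF dd]])
    qed (use s in auto)
    then obtain y where y: "0 < y" "y < s"
      "fu (p + x *\<^sub>R u + s *\<^sub>R v) - fu (p + x *\<^sub>R u) = s * fuv (p + x *\<^sub>R u + y *\<^sub>R v)"
      by auto
    have "A s - A 0 = s\<^sup>2 * fuv (p + x *\<^sub>R u + y *\<^sub>R v)"
      using x(3) y(3) by (simp add: power2_eq_square)
    moreover have "\<bar>fuv (p + x *\<^sub>R u + y *\<^sub>R v) - fuv p\<bar> \<le> e"
      using r(3)[OF near[of x y]] x y by (simp add: dist_real_def)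
    ultimately have "\<bar>A s - A 0 - s\<^sup>2 * fuv p\<bar> \<le> s\<^sup>2 * e"
      by (simp add: abs_mult mult_left_mono flip: right_diff_distrib)
    then have "\<bar>A s - A 0 - s\<^sup>2 * fuv p\<bar> \<le> e * s\<^sup>2"
      by (simp add: mult.commute)
    moreover have "A s - A 0 = f (p + s *\<^sub>R u + s *\<^sub>R v) - f (p + s *\<^sub>R u) - f (p + s *\<^sub>R v) + f p"
      by (simp add: A_def)
    ultimately show "\<bar>(f (p + s *\<^sub>R u + s *\<^sub>R v) - f (p + s *\<^sub>R u) - f (p + s *\<^sub>R v) + f p)
      - s\<^sup>2 * frechet_derivative (\<lambda>q. frechet_derivative f (at q) u) (at p) v\<bar> \<le> e * s\<^sup>2"
      by (simp add: fuv_def fu_def)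
  qed (fact \<delta>)
qed

lemma second_derivative_symmetric_real:
  fixes f :: "'a::euclidean_space \<Rightarrow> real"
  assumes U: "open U" "p \<in> U" and f: "Ck_on 2 U f"
  shows "frechet_derivative (\<lambda>q. frechet_derivative f (at q) u) (at p) v
       = frechet_derivative (\<lambda>q. frechet_derivative f (at q) v) (at p) u" (is "?a = ?b")
proof (rule ccontr)
  assume ne: "?a \<noteq> ?b"
  \<comment> \<open>A third of the gap: the two error bounds together reach only two thirds of
    it.\<close>
  define e where "e = \<bar>?a - ?b\<bar> / 3"
  have e: "e > 0" using ne by (simp add: e_def)
  obtain d1 where d1: "d1 > 0" "\<And>s. 0 < s \<Longrightarrow> s < d1 \<Longrightarrow>
    \<bar>(f (p + s *\<^sub>R u + s *\<^sub>R v) - f (p + s *\<^sub>R u) - f (p + s *\<^sub>R v) + f p) - s\<^sup>2 * ?a\<bar> \<le> e * s\<^sup>2"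
    using second_difference[OF assms e, of u v] by blast
  obtain d2 where d2: "d2 > 0" "\<And>s. 0 < s \<Longrightarrow> s < d2 \<Longrightarrow>
    \<bar>(f (p + s *\<^sub>R v + s *\<^sub>R u) - f (p + s *\<^sub>R v) - f (p + s *\<^sub>R u) + f p) - s\<^sup>2 * ?b\<bar> \<le> e * s\<^sup>2"
    using second_difference[OF assms e, of v u] by blast
  define s where "s = min d1 d2 / 2"
  have s: "0 < s" "s < d1" "s < d2"
    using d1(1) d2(1) by (auto simp: s_def)
  have "\<bar>s\<^sup>2 * (?a - ?b)\<bar> \<le> 2 * e * s\<^sup>2"
    using d1(2)[OF s(1,2)] d2(2)[OF s(1,3)]
    by (simp add: right_diff_distrib add.commute add.left_commute)
  then have "s\<^sup>2 * (3 * e) \<le> s\<^sup>2 * (2 * e)"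
    by (simp add: abs_mult e_def mult.commute)
  then show False
    using e s by simp
qed

lemma second_derivative_symmetric:
  fixes f :: "'a::euclidean_space \<Rightarrow> 'b::euclidean_space"
  assumes U: "open U" "p \<in> U" and f: "smooth_on U f"
  shows "frechet_derivative (\<lambda>q. frechet_derivative f (at q) u) (at p) v
       = frechet_derivative (\<lambda>q. frechet_derivative f (at q) v) (at p) u"
proof (rule euclidean_eqI)
  fix i :: 'b
  have comp: "frechet_derivative (\<lambda>q. frechet_derivative (\<lambda>x. f x \<bullet> i) (at q) u) (at p) v
      = frechet_derivative (\<lambda>q. frechet_derivative f (at q) u) (at p) v \<bullet> i" for u v
  proof -
    have d: "((\<lambda>x. f x \<bullet> i) has_derivative (\<lambda>h. frechet_derivative f (at q) h \<bullet> i)) (at q)" if "q \<in> U" for q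
      using has_derivative_frechet[OF smooth_onD(1)[OF f that]] by (rule has_derivative_inner_left)
    have "((\<lambda>q. frechet_derivative f (at q) u \<bullet> i) has_derivative
       (\<lambda>h. frechet_derivative (\<lambda>q. frechet_derivative f (at q) u) (at p) h \<bullet> i)) (at p)"
      using has_derivative_frechet[OF smooth_onD(1)[OF smooth_onD(2)[OF f] U(2)]]
      by (rule has_derivative_inner_left)
    then have "((\<lambda>q. frechet_derivative (\<lambda>x. f x \<bullet> i) (at q) u) has_derivative
       (\<lambda>h. frechet_derivative (\<lambda>q. frechet_derivative f (at q) u) (at p) h \<bullet> i)) (at p)"
      by (rule has_derivative_transform_within_open[OF _ U]) (simp add: frechet_derivative_eqI[OF d])
    then show ?thesis by (simp add: frechet_derivative_eqI)
  qed
  have "smooth_on U (\<lambda>x. f x \<bullet> i)"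
    by (rule smooth_on_bounded_linear[OF bounded_linear_inner_left U(1) f])
  then show "frechet_derivative (\<lambda>q. frechet_derivative f (at q) u) (at p) v \<bullet> i =
        frechet_derivative (\<lambda>q. frechet_derivative f (at q) v) (at p) u \<bullet> i"
    using second_derivative_symmetric_real[OF U, of "\<lambda>x. f x \<bullet> i" u v]
    unfolding comp smooth_on_def by blast
qed

subsection \<open>Naturality of the curvature tensor\<close>

text \<open>Leibniz rule for a bilinear map depending on the base point. Differentiability in the
  base point is given only for fixed arguments, so \<open>B\<close> is expanded over the basis into
  a finite sum of products of scalar functions with fixed fields.\<close>

lemma bilinear_field_has_derivative:
  fixes B :: "'a::euclidean_space \<Rightarrow> 'b::euclidean_space \<Rightarrow> 'c::euclidean_space \<Rightarrow> 'd::real_normed_vector"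
    and \<psi> :: "'e::real_normed_vector \<Rightarrow> 'a"
  assumes M: "open M" "\<psi> x \<in> M" and bil: "\<And>q. q \<in> M \<Longrightarrow> bilinear (B q)"
    and dB: "\<And>u v. (\<lambda>q. B q u v) differentiable (at (\<psi> x))"
    and d\<psi>: "(\<psi> has_derivative \<psi>') (at x)"
    and dY: "(Y has_derivative Y') (at x)" and dZ: "(Z has_derivative Z') (at x)"
  shows "((\<lambda>x. B (\<psi> x) (Y x) (Z x)) has_derivative
    (\<lambda>h. frechet_derivative (\<lambda>q. B q (Y x) (Z x)) (at (\<psi> x)) (\<psi>' h)
       + B (\<psi> x) (Y' h) (Z x) + B (\<psi> x) (Y x) (Z' h))) (at x)"
proof -
  have expand: "B q u v = (\<Sum>(i,j)\<in>Basis\<times>Basis. ((u \<bullet> i) * (v \<bullet> j)) *\<^sub>R B q i j)" if "q \<in> M" for q u v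
  proof -
    have "B q u v = B q (\<Sum>i\<in>Basis. (u \<bullet> i) *\<^sub>R i) (\<Sum>j\<in>Basis. (v \<bullet> j) *\<^sub>R j)"
      by (simp add: euclidean_representation)
    also have "\<dots> = (\<Sum>(i,j)\<in>Basis\<times>Basis. B q ((u \<bullet> i) *\<^sub>R i) ((v \<bullet> j) *\<^sub>R j))"
      by (rule bilinear_sum[OF bil[OF that]])
    finally show ?thesis
      by (simp add: bilinear_lmul[OF bil[OF that]] bilinear_rmul[OF bil[OF that]] mult.commute)
  qed
  define D where "D = (\<lambda>i j. frechet_derivative (\<lambda>q. B q i j) (at (\<psi> x)))"
  have D: "((\<lambda>q. B q i j) has_derivative D i j) (at (\<psi> x))" for i j
    unfolding D_def by (rule has_derivative_frechet[OF dB])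
  have fixed: "frechet_derivative (\<lambda>q. B q u v) (at (\<psi> x)) h
      = (\<Sum>(i,j)\<in>Basis\<times>Basis. ((u \<bullet> i) * (v \<bullet> j)) *\<^sub>R D i j h)" for u v h
  proof -
    have "((\<lambda>q. \<Sum>(i,j)\<in>Basis\<times>Basis. ((u \<bullet> i) * (v \<bullet> j)) *\<^sub>R B q i j) has_derivative
       (\<lambda>h. \<Sum>(i,j)\<in>Basis\<times>Basis. ((u \<bullet> i) * (v \<bullet> j)) *\<^sub>R D i j h)) (at (\<psi> x))"
      unfolding case_prod_beta
      by (intro has_derivative_sum has_derivative_scaleR_right D)
    then have "((\<lambda>q. B q u v) has_derivative
       (\<lambda>h. \<Sum>(i,j)\<in>Basis\<times>Basis. ((u \<bullet> i) * (v \<bullet> j)) *\<^sub>R D i j h)) (at (\<psi> x))"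
      by (rule has_derivative_transform_within_open[OF _ M]) (simp add: expand)
    then show ?thesis by (simp add: frechet_derivative_eqI)
  qed
  have Bx: "((\<lambda>x. B (\<psi> x) i j) has_derivative (\<lambda>h. D i j (\<psi>' h))) (at x)" for i j
    by (rule has_derivative_compose[OF d\<psi> D])
  have "((\<lambda>x. \<Sum>(i,j)\<in>Basis\<times>Basis. ((Y x \<bullet> i) * (Z x \<bullet> j)) *\<^sub>R B (\<psi> x) i j) has_derivative
     (\<lambda>h. \<Sum>(i,j)\<in>Basis\<times>Basis. ((Y x \<bullet> i) * (Z x \<bullet> j)) *\<^sub>R D i j (\<psi>' h)
        + ((Y x \<bullet> i) * (Z' h \<bullet> j) + (Y' h \<bullet> i) * (Z x \<bullet> j)) *\<^sub>R B (\<psi> x) i j)) (at x)"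
    unfolding case_prod_beta
    by (intro has_derivative_sum has_derivative_scaleR has_derivative_mult Bx
        has_derivative_inner_left[OF dY] has_derivative_inner_left[OF dZ])
  moreover have "(\<Sum>(i,j)\<in>Basis\<times>Basis. ((Y x \<bullet> i) * (Z x \<bullet> j)) *\<^sub>R D i j (\<psi>' h)
        + ((Y x \<bullet> i) * (Z' h \<bullet> j) + (Y' h \<bullet> i) * (Z x \<bullet> j)) *\<^sub>R B (\<psi> x) i j)
     = frechet_derivative (\<lambda>q. B q (Y x) (Z x)) (at (\<psi> x)) (\<psi>' h)
       + B (\<psi> x) (Y' h) (Z x) + B (\<psi> x) (Y x) (Z' h)" for h
    unfolding fixed expand[OF M(2), of "Y' h" "Z x"] expand[OF M(2), of "Y x" "Z' h"]
    by (simp add: case_prod_beta scaleR_add_left sum.distrib add_ac)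
  ultimately have deriv: "((\<lambda>x. \<Sum>(i,j)\<in>Basis\<times>Basis. ((Y x \<bullet> i) * (Z x \<bullet> j)) *\<^sub>R B (\<psi> x) i j) has_derivative
     (\<lambda>h. frechet_derivative (\<lambda>q. B q (Y x) (Z x)) (at (\<psi> x)) (\<psi>' h)
       + B (\<psi> x) (Y' h) (Z x) + B (\<psi> x) (Y x) (Z' h))) (at x)"
    by simp
  \<comment> \<open>The expansion over the basis holds only where \<open>B\<close> is bilinear,
    hence only near \<open>x\<close>.\<close>
  have "\<forall>\<^sub>F y in at x. \<psi> y \<in> M"
    using has_derivative_continuous[OF d\<psi>] M
    unfolding continuous_within by (rule topological_tendstoD)
  then have ev: "\<forall>\<^sub>F y in at x. (\<Sum>(i,j)\<in>Basis\<times>Basis. ((Y y \<bullet> i) * (Z y \<bullet> j)) *\<^sub>R B (\<psi> y) i j) = B (\<psi> y) (Y y) (Z y)"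
    by eventually_elim (simp add: expand)
  show ?thesis
    by (rule has_derivative_transform_eventually[OF deriv ev _ UNIV_I]) (rule expand[OF M(2), symmetric])
qed

text \<open>\<open>\<Gamma>\<close> is a candidate for the Christoffel symbols. The Koszul formula
  identifies it with \<open>christoffel\<close>, positive definiteness supplying uniqueness.
  Regularity is demanded for constant arguments only, which is the form in which it can be checked
  in coordinates.\<close>

locale riemannian_chart =
  fixes M :: "'a::euclidean_space set" and g :: "'a metric" and \<Gamma> :: "'a \<Rightarrow> 'a \<Rightarrow> 'a \<Rightarrow> 'a"
  assumes open_M: "open M"
    and bilinear_g: "p \<in> M \<Longrightarrow> bilinear (g p)"
    and g_commute: "g p u v = g p v u"
    and g_pos: "p \<in> M \<Longrightarrow> u \<noteq> 0 \<Longrightarrow> g p u u > 0"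
    and g_differentiable: "p \<in> M \<Longrightarrow> (\<lambda>q. g q u v) differentiable (at p)"
    and bilinear_\<Gamma>: "p \<in> M \<Longrightarrow> bilinear (\<Gamma> p)"
    and \<Gamma>_commute: "\<Gamma> p u v = \<Gamma> p v u"
    and \<Gamma>_differentiable: "p \<in> M \<Longrightarrow> (\<lambda>q. \<Gamma> q u v) differentiable (at p)"
    and koszul: "p \<in> M \<Longrightarrow> 2 * g p (\<Gamma> p u v) w = dmetric g p u v w + dmetric g p v u w - dmetric g p w u v"
begin

abbreviation d\<Gamma> :: "'a \<Rightarrow> 'a \<Rightarrow> 'a \<Rightarrow> 'a \<Rightarrow> 'a" where
  "d\<Gamma> p x u v \<equiv> frechet_derivative (\<lambda>q. \<Gamma> q u v) (at p) x"

lemma g_eqI: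
  assumes "p \<in> M" "\<And>w. g p z w = g p z' w"
  shows "z = z'"
proof (rule ccontr)
  assume "z \<noteq> z'"
  then have "g p (z - z') (z - z') > 0" using g_pos assms(1) by simp
  then show False using assms(2)[of "z - z'"] bilinear_lsub[OF bilinear_g[OF assms(1)]] by simp
qed

lemma christoffel_eq: "p \<in> M \<Longrightarrow> christoffel g p u v = \<Gamma> p u v"
  unfolding christoffel_def
  by (rule the_equality) (auto simp flip: koszul intro: g_eqI)

lemma levi_civita_const: "p \<in> M \<Longrightarrow> levi_civita g (\<lambda>_. u) (\<lambda>_. v) p = \<Gamma> p u v"
  by (simp add: levi_civita_def christoffel_eq)

lemma \<Gamma>_has_derivative: "p \<in> M \<Longrightarrow> ((\<lambda>q. \<Gamma> q u v) has_derivative (\<lambda>x. d\<Gamma> p x u v)) (at p)"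
  by (rule has_derivative_frechet[OF \<Gamma>_differentiable])

lemma riemann_eq:
  assumes "p \<in> M"
  shows "riemann g p u v w = d\<Gamma> p u v w - d\<Gamma> p v u w + \<Gamma> p u (\<Gamma> p v w) - \<Gamma> p v (\<Gamma> p u w)"
proof -
  have "levi_civita g (\<lambda>_. u) (levi_civita g (\<lambda>_. v) (\<lambda>_. w)) p = d\<Gamma> p u v w + \<Gamma> p u (\<Gamma> p v w)" for u v
  proof -
    have "(levi_civita g (\<lambda>_. v) (\<lambda>_. w) has_derivative (\<lambda>x. d\<Gamma> p x v w)) (at p)"
      by (rule has_derivative_transform_within_open[OF \<Gamma>_has_derivative[OF assms] open_M assms])
         (simp add: levi_civita_const)
    then show ?thesis
      by (simp add: levi_civita_def[of g "\<lambda>_. u"] frechet_derivative_eqI levi_civita_const christoffel_eq assms)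
  qed
  then show ?thesis by (simp add: riemann_def)
qed

lemma metric_compatible:
  assumes "p \<in> M"
  shows "dmetric g p x u v = g p (\<Gamma> p x u) v + g p u (\<Gamma> p x v)"
proof -
  have "dmetric g p x u v = dmetric g p x v u" for x u v
    unfolding dmetric_def by (subst g_commute) simp
  then show ?thesis
    using koszul[OF assms, of x u v] koszul[OF assms, of x v u] g_commute[of p u "\<Gamma> p x v"]
    by (simp add: field_simps)
qed

lemma g_has_derivative:
  assumes "\<psi> x \<in> M" "(\<psi> has_derivative \<psi>') (at x)" "(Y has_derivative Y') (at x)" "(Z has_derivative Z') (at x)"
  shows "((\<lambda>x. g (\<psi> x) (Y x) (Z x)) has_derivative
    (\<lambda>h. dmetric g (\<psi> x) (\<psi>' h) (Y x) (Z x) + g (\<psi> x) (Y' h) (Z x) + g (\<psi> x) (Y x) (Z' h))) (at x)"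
  unfolding dmetric_def
  by (rule bilinear_field_has_derivative[OF open_M]) (use assms bilinear_g g_differentiable in auto)

lemma \<Gamma>_has_derivative':
  assumes "\<psi> x \<in> M" "(\<psi> has_derivative \<psi>') (at x)" "(Y has_derivative Y') (at x)" "(Z has_derivative Z') (at x)"
  shows "((\<lambda>x. \<Gamma> (\<psi> x) (Y x) (Z x)) has_derivative
    (\<lambda>h. d\<Gamma> (\<psi> x) (\<psi>' h) (Y x) (Z x) + \<Gamma> (\<psi> x) (Y' h) (Z x) + \<Gamma> (\<psi> x) (Y x) (Z' h))) (at x)"
  by (rule bilinear_field_has_derivative[OF open_M]) (use assms bilinear_\<Gamma> \<Gamma>_differentiable in auto)

text \<open>A tensor built from parallel tensors with constant coefficients is parallel. The
  assumption \<open>parallel\<close> is the vanishing of the covariant derivative of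
  \<open>J\<close>, written for constant fields. Nothing forces \<open>J\<close> to be a complex
  structure, so it may also be taken to be zero.\<close>

lemma nabla_riemann_eq_0:
  fixes J :: "'a \<Rightarrow> 'a \<Rightarrow> 'a"
  assumes R: "\<And>q u v w. q \<in> M \<Longrightarrow> riemann g q u v w = A *\<^sub>R (g q v w *\<^sub>R u - g q u w *\<^sub>R v)
      + B *\<^sub>R (g q (J q v) w *\<^sub>R J q u - g q (J q u) w *\<^sub>R J q v - (2 * g q (J q u) v) *\<^sub>R J q w)"
    and J: "\<And>q. q \<in> M \<Longrightarrow> linear (J q)"
    and parallel: "\<And>q u. q \<in> M \<Longrightarrow> ((\<lambda>q. J q u) has_derivative (\<lambda>x. J q (\<Gamma> q x u) - \<Gamma> q x (J q u))) (at q)"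
    and p: "p \<in> M"
  shows "nabla_riemann g p x u v w = 0"
proof -
  define RR where "RR q u v w = A *\<^sub>R (g q v w *\<^sub>R u - g q u w *\<^sub>R v)
      + B *\<^sub>R (g q (J q v) w *\<^sub>R J q u - g q (J q u) w *\<^sub>R J q v - (2 * g q (J q u) v) *\<^sub>R J q w)" for q u v w
  have Jd: "((\<lambda>q. J q u) has_derivative (\<lambda>x. J p (\<Gamma> p x u) - \<Gamma> p x (J p u))) (at p)" for u
    by (rule parallel[OF p])
  have "frechet_derivative (\<lambda>q. g q u v) (at p) = (\<lambda>x. g p (\<Gamma> p x u) v + g p u (\<Gamma> p x v))" for u v
    using metric_compatible[OF p, of _ u v] by (auto simp: dmetric_def)
  then have gd: "((\<lambda>q. g q u v) has_derivative (\<lambda>x. g p (\<Gamma> p x u) v + g p u (\<Gamma> p x v))) (at p)" for u v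
    using has_derivative_frechet[OF g_differentiable[OF p, of u v]] by simp
  have Om: "((\<lambda>q. g q (J q u) v) has_derivative (\<lambda>x. g p (J p (\<Gamma> p x u)) v + g p (J p u) (\<Gamma> p x v))) (at p)" for u v
    using g_has_derivative[OF _ has_derivative_ident Jd has_derivative_const, of u v] p
    by (simp add: metric_compatible bilinear_lsub[OF bilinear_g] bilinear_rzero[OF bilinear_g] algebra_simps)
  have "((\<lambda>q. RR q u v w) has_derivative
      (\<lambda>x. RR p (\<Gamma> p x u) v w + RR p u (\<Gamma> p x v) w + RR p u v (\<Gamma> p x w) - \<Gamma> p x (RR p u v w))) (at p)"
    unfolding RR_def
    by (rule has_derivative_eq_rhs, (rule gd Om Jd derivative_intros)+)
       (simp add: fun_eq_iff algebra_simps bilinear_rsub[OF bilinear_\<Gamma>[OF p]] bilinear_radd[OF bilinear_\<Gamma>[OF p]]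
          bilinear_rmul[OF bilinear_\<Gamma>[OF p]])
  then have "((\<lambda>q. riemann g q u v w) has_derivative
      (\<lambda>x. RR p (\<Gamma> p x u) v w + RR p u (\<Gamma> p x v) w + RR p u v (\<Gamma> p x w) - \<Gamma> p x (RR p u v w))) (at p)"
    by (rule has_derivative_transform_within_open[OF _ open_M p]) (simp add: RR_def R)
  moreover have "riemann g p = RR p"
    by (intro ext) (simp add: RR_def R p)
  ultimately show ?thesis
    unfolding nabla_riemann_def levi_civita_const[OF p]
    by (simp add: levi_civita_def christoffel_eq[OF p] frechet_derivative_eqI)
qed

section \<open>Transformation of Christoffel symbols and curvature under a local isometry\<close>

context
  fixes U \<phi>
  assumes isometry: "local_isometry M g U \<phi>"
begin

abbreviation D\<phi> :: "'a \<Rightarrow> 'a \<Rightarrow> 'a" where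
  "D\<phi> p u \<equiv> frechet_derivative \<phi> (at p) u"

abbreviation DD\<phi> :: "'a \<Rightarrow> 'a \<Rightarrow> 'a \<Rightarrow> 'a" where
  "DD\<phi> p x u \<equiv> frechet_derivative (\<lambda>q. D\<phi> q u) (at p) x"

lemma domain: "open U" "p \<in> U \<Longrightarrow> p \<in> M" "p \<in> U \<Longrightarrow> \<phi> p \<in> M" "smooth_on U \<phi>"
  and isometric: "p \<in> U \<Longrightarrow> g (\<phi> p) (D\<phi> p u) (D\<phi> p v) = g p u v"
  using isometry by (auto simp: local_isometry_def)

lemma \<phi>_has_derivative: "p \<in> U \<Longrightarrow> (\<phi> has_derivative D\<phi> p) (at p)"
  by (intro has_derivative_frechet smooth_onD(1)[OF domain(4)])

lemma D\<phi>_has_derivative: "p \<in> U \<Longrightarrow> ((\<lambda>q. D\<phi> q u) has_derivative (\<lambda>x. DD\<phi> p x u)) (at p)"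
  by (intro has_derivative_frechet smooth_onD(1)[OF smooth_onD(2)[OF domain(4)]])

lemma DD\<phi>_differentiable: "p \<in> U \<Longrightarrow> (\<lambda>q. DD\<phi> q x u) differentiable (at p)"
  by (intro smooth_onD(1)[OF smooth_onD(2)[OF smooth_onD(2)[OF domain(4)]]])

lemma linear_D\<phi>: "p \<in> U \<Longrightarrow> linear (D\<phi> p)"
  by (rule has_derivative_linear[OF \<phi>_has_derivative])

lemma DD\<phi>_commute: "p \<in> U \<Longrightarrow> DD\<phi> p x u = DD\<phi> p u x"
  by (rule second_derivative_symmetric[OF domain(1) _ domain(4)])

lemma D\<phi>_eq_0: "p \<in> U \<Longrightarrow> D\<phi> p u = 0 \<Longrightarrow> u = 0"
  using isometric[of p u u] g_pos[OF domain(2), of p u] bilinear_lzero[OF bilinear_g[OF domain(3)], of p 0] by force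

lemma D\<phi>_surj: "p \<in> U \<Longrightarrow> \<exists>u. D\<phi> p u = y"
  using linear_injective_imp_surjective[OF linear_D\<phi>] D\<phi>_eq_0 linear_injective_0[OF linear_D\<phi>]
  by (metis surjD)

lemma pullback_dmetric:
  assumes p: "p \<in> U"
  shows "dmetric g p x u v = dmetric g (\<phi> p) (D\<phi> p x) (D\<phi> p u) (D\<phi> p v)
      + g (\<phi> p) (DD\<phi> p x u) (D\<phi> p v) + g (\<phi> p) (D\<phi> p u) (DD\<phi> p x v)"
proof -
  have "((\<lambda>q. g (\<phi> q) (D\<phi> q u) (D\<phi> q v)) has_derivative
     (\<lambda>x. dmetric g (\<phi> p) (D\<phi> p x) (D\<phi> p u) (D\<phi> p v)
      + g (\<phi> p) (DD\<phi> p x u) (D\<phi> p v) + g (\<phi> p) (D\<phi> p u) (DD\<phi> p x v))) (at p)"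
    by (rule g_has_derivative[OF domain(3)[OF p] \<phi>_has_derivative[OF p] D\<phi>_has_derivative[OF p] D\<phi>_has_derivative[OF p]])
  then have "((\<lambda>q. g q u v) has_derivative
     (\<lambda>x. dmetric g (\<phi> p) (D\<phi> p x) (D\<phi> p u) (D\<phi> p v)
      + g (\<phi> p) (DD\<phi> p x u) (D\<phi> p v) + g (\<phi> p) (D\<phi> p u) (DD\<phi> p x v))) (at p)"
    by (rule has_derivative_transform_within_open[OF _ domain(1) p isometric])
  then show ?thesis by (simp add: dmetric_def frechet_derivative_eqI)
qed

text \<open>The Koszul formulas at \<open>p\<close> and at the image are compared through
  \<open>pullback_dmetric\<close>. Of the six second-derivative terms four cancel by symmetry of
  \<open>DD\<phi>\<close>, the other two give the inhomogeneous term. Since \<open>D\<phi>\<close>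
  is onto, testing against its values suffices.\<close>

lemma \<Gamma>_natural:
  assumes p: "p \<in> U"
  shows "D\<phi> p (\<Gamma> p u v) = \<Gamma> (\<phi> p) (D\<phi> p u) (D\<phi> p v) + DD\<phi> p u v"
proof (rule g_eqI[OF domain(3)[OF p]])
  fix y
  obtain w where w: "y = D\<phi> p w" using D\<phi>_surj[OF p] by metis
  have "2 * g (\<phi> p) (D\<phi> p (\<Gamma> p u v)) (D\<phi> p w) = dmetric g p u v w + dmetric g p v u w - dmetric g p w u v"
    by (simp add: isometric[OF p] koszul[OF domain(2)[OF p]])
  also have "\<dots> = 2 * g (\<phi> p) (\<Gamma> (\<phi> p) (D\<phi> p u) (D\<phi> p v)) (D\<phi> p w) + 2 * g (\<phi> p) (DD\<phi> p u v) (D\<phi> p w)"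
    unfolding pullback_dmetric[OF p] koszul[OF domain(3)[OF p]]
    using g_commute[of "\<phi> p" "D\<phi> p v" "DD\<phi> p w u"]
    by (simp add: DD\<phi>_commute[OF p, of v u] DD\<phi>_commute[OF p, of u w] DD\<phi>_commute[OF p, of v w])
  finally show "g (\<phi> p) (D\<phi> p (\<Gamma> p u v)) y = g (\<phi> p) (\<Gamma> (\<phi> p) (D\<phi> p u) (D\<phi> p v) + DD\<phi> p u v) y"
    by (simp add: w bilinear_ladd[OF bilinear_g[OF domain(3)[OF p]]])
qed

text \<open>Differentiating \<open>\<Gamma>_natural\<close> brings in third derivatives of the
  isometry. They are symmetric in the first two slots and drop out on antisymmetrising, as do the
  terms with second derivatives.\<close>

lemma riemann_natural:
  assumes p: "p \<in> U"
  shows "D\<phi> p (riemann g p x u v) = riemann g (\<phi> p) (D\<phi> p x) (D\<phi> p u) (D\<phi> p v)"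
proof -
  define T where "T x u v = frechet_derivative (\<lambda>q. DD\<phi> q u v) (at p) x" for x u v
  have T: "T x u v = T u x v" for x u v
    unfolding T_def by (rule second_derivative_symmetric[OF domain(1) p smooth_onD(2)[OF domain(4)]])
  \<comment> \<open>The linear map \<open>D\<phi> q\<close> is made bilinear by a dummy real factor,
    later set to 1, so that the Leibniz rule for bilinear fields applies to it.\<close>
  have bil: "bilinear (\<lambda>y (z::real). z *\<^sub>R D\<phi> q y)" if "q \<in> U" for q
    using linear_D\<phi>[OF that]
    by (auto simp: bilinear_def linear_iff algebra_simps)
  have FY: "((\<lambda>q. D\<phi> q (Y q)) has_derivative (\<lambda>x. DD\<phi> p x (Y p) + D\<phi> p (Y' x))) (at p)"
    if "(Y has_derivative Y') (at p)" for Y Y'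
  proof -
    have dd: "(\<lambda>q. z *\<^sub>R D\<phi> q y) differentiable (at p)" for z y
      using D\<phi>_has_derivative[OF p, of y] by (auto intro!: derivative_intros simp: differentiable_def)
    show ?thesis
      using bilinear_field_has_derivative[OF domain(1) _ bil dd has_derivative_ident that has_derivative_const[of 1]] p
      by simp
  qed
  have key: "D\<phi> p (d\<Gamma> p x u v) = d\<Gamma> (\<phi> p) (D\<phi> p x) (D\<phi> p u) (D\<phi> p v) + \<Gamma> (\<phi> p) (DD\<phi> p x u) (D\<phi> p v)
      + \<Gamma> (\<phi> p) (D\<phi> p u) (DD\<phi> p x v) + T x u v - DD\<phi> p x (\<Gamma> p u v)" for x u v
  proof -
    have "((\<lambda>q. D\<phi> q (\<Gamma> q u v)) has_derivative (\<lambda>x. DD\<phi> p x (\<Gamma> p u v) + D\<phi> p (d\<Gamma> p x u v))) (at p)"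
      by (rule FY[OF \<Gamma>_has_derivative[OF domain(2)[OF p]]])
    moreover have "((\<lambda>q. \<Gamma> (\<phi> q) (D\<phi> q u) (D\<phi> q v) + DD\<phi> q u v) has_derivative
      (\<lambda>x. (d\<Gamma> (\<phi> p) (D\<phi> p x) (D\<phi> p u) (D\<phi> p v) + \<Gamma> (\<phi> p) (DD\<phi> p x u) (D\<phi> p v)
      + \<Gamma> (\<phi> p) (D\<phi> p u) (DD\<phi> p x v)) + T x u v)) (at p)"
      unfolding T_def
      by (intro has_derivative_add \<Gamma>_has_derivative' domain(3) p \<phi>_has_derivative D\<phi>_has_derivative
          has_derivative_frechet[OF DD\<phi>_differentiable])
    then have "((\<lambda>q. D\<phi> q (\<Gamma> q u v)) has_derivative
      (\<lambda>x. (d\<Gamma> (\<phi> p) (D\<phi> p x) (D\<phi> p u) (D\<phi> p v) + \<Gamma> (\<phi> p) (DD\<phi> p x u) (D\<phi> p v)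
      + \<Gamma> (\<phi> p) (D\<phi> p u) (DD\<phi> p x v)) + T x u v)) (at p)"
      by (rule has_derivative_transform_within_open[OF _ domain(1) p]) (simp add: \<Gamma>_natural)
    ultimately have "(\<lambda>x. DD\<phi> p x (\<Gamma> p u v) + D\<phi> p (d\<Gamma> p x u v)) =
      (\<lambda>x. (d\<Gamma> (\<phi> p) (D\<phi> p x) (D\<phi> p u) (D\<phi> p v) + \<Gamma> (\<phi> p) (DD\<phi> p x u) (D\<phi> p v)
      + \<Gamma> (\<phi> p) (D\<phi> p u) (DD\<phi> p x v)) + T x u v)"
      by (rule has_derivative_unique)
    from fun_cong[OF this, of x] show ?thesis by (simp add: algebra_simps)
  qed
  have \<Gamma>\<Gamma>: "D\<phi> p (\<Gamma> p x (\<Gamma> p u v)) = \<Gamma> (\<phi> p) (D\<phi> p x) (\<Gamma> (\<phi> p) (D\<phi> p u) (D\<phi> p v))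
      + \<Gamma> (\<phi> p) (D\<phi> p x) (DD\<phi> p u v) + DD\<phi> p x (\<Gamma> p u v)" for x u v
    by (simp add: \<Gamma>_natural[OF p] bilinear_radd[OF bilinear_\<Gamma>[OF domain(3)[OF p]]])
  show ?thesis
    unfolding riemann_eq[OF domain(2)[OF p]] riemann_eq[OF domain(3)[OF p]]
      linear_diff[OF linear_D\<phi>[OF p]] linear_add[OF linear_D\<phi>[OF p]] key \<Gamma>\<Gamma>
    by (simp add: T[of x u v] DD\<phi>_commute[OF p, of x u] \<Gamma>_commute)
qed

end

end

subsection \<open>The metrics in terms of their profile functions\<close>

locale abc =
  fixes a b c K :: real
  assumes K: "K \<noteq> 0"
begin

abbreviation M :: "point set" where "M \<equiv> abc_manifold a b c K"
abbreviation g :: "point metric" where "g \<equiv> abc_metric a b c K"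
abbreviation \<eta> :: "point \<Rightarrow> point \<Rightarrow> real" where "\<eta> \<equiv> abc_form a b K"

definition D :: "real \<Rightarrow> real" where "D r = b * r + 2 * c"
definition Q :: "real \<Rightarrow> real" where "Q r = a * r\<^sup>2 + b * r + c"
definition m :: "complex \<Rightarrow> real" where "m z = 1 / (1 + a / 2 * (z \<bullet> z))"

text \<open>The metric is \<open>F d\<rho>\<^sup>2 + G m\<^sup>2 |d\<zeta>|\<^sup>2 + H \<eta>\<^sup>2\<close>.\<close>

definition F :: "real \<Rightarrow> real" where "F r = - K * D r / (4 * r\<^sup>2 * Q r)"
definition G :: "real \<Rightarrow> real" where "G r = - K * D r / (2 * r\<^sup>2)"
definition H :: "real \<Rightarrow> real" where "H r = - K * Q r / (4 * r\<^sup>2 * D r)"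

text \<open>\<open>\<alpha>\<close>, \<open>\<beta>\<close>, \<open>\<gamma>\<close> are half the logarithmic derivatives of \<open>F\<close>, \<open>G\<close>, \<open>H\<close>, and
  \<open>\<mu> = \<beta> G / F\<close>, \<open>\<nu> = \<gamma> H / F\<close>, \<open>h = b H / G\<close>.\<close>

definition \<alpha> :: "real \<Rightarrow> real" where "\<alpha> r = (b / D r - 2 / r - (2 * a * r + b) / Q r) / 2"
definition \<beta> :: "real \<Rightarrow> real" where "\<beta> r = (b / D r - 2 / r) / 2"
definition \<gamma> :: "real \<Rightarrow> real" where "\<gamma> r = ((2 * a * r + b) / Q r - 2 / r - b / D r) / 2"
definition \<mu> :: "real \<Rightarrow> real" where "\<mu> r = 2 * Q r * \<beta> r"
definition \<nu> :: "real \<Rightarrow> real" where "\<nu> r = \<gamma> r * (Q r / D r)\<^sup>2"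
definition h :: "real \<Rightarrow> real" where "h r = b * Q r / (2 * (D r)\<^sup>2)"

definition B :: "real \<Rightarrow> real" where "B r = b * (b\<^sup>2 - 4 * a * c) * r ^ 3 / (K * D r ^ 3)"
definition A :: "real \<Rightarrow> real" where "A r = 2 / K - B r"

lemma form_eq: "\<eta> (r, z, t) (r', z', t') = - t' / K + b * Im (z * cnj z') * m z"
  by (simp add: abc_form_def m_def dot_square_norm)

lemma metric_eq:
  "g (r, z, t) u v = F r * (fst u * fst v) + G r * (m z)\<^sup>2 * (fst (snd u) \<bullet> fst (snd v))
     + H r * (\<eta> (r, z, t) u * \<eta> (r, z, t) v)"
proof -
  have "- K / (4 * s) * (X / Y * x + 2 * X * y / N + Y / X * e)
      = - K * X / (4 * s * Y) * x + - K * X / (2 * s) * (1 / N) * y + - K * Y / (4 * s * X) * e" for s X Y N x y e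
    by (simp add: ring_distribs)
  from this[where s = "r\<^sup>2" and X = "D r" and Y = "Q r" and N = "(1 + a / 2 * (z \<bullet> z))\<^sup>2"] show ?thesis
    unfolding F_def G_def H_def m_def power_divide power_one
    by (cases u; cases v) (simp add: abc_metric_def D_def Q_def dot_square_norm)
qed

definition pt_ok :: "real \<Rightarrow> bool" where "pt_ok r \<longleftrightarrow> r > 0 \<and> Q r > 0 \<and> K * D r < 0"

lemma pt_okD:
  assumes "pt_ok r"
  shows "r > 0" "Q r > 0" "K * D r < 0" "D r \<noteq> 0" "F r > 0" "G r > 0" "H r > 0"
proof -
  show *: "r > 0" "Q r > 0" "K * D r < 0" "D r \<noteq> 0"
    using assms by (auto simp: pt_ok_def)
  show "F r > 0" "G r > 0"
    using * by (auto simp: F_def G_def intro!: divide_neg_pos)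
  have "K / D r < 0"
    using * by (simp add: divide_less_0_iff mult_less_0_iff)
  then have "- (K / D r) * (Q r / (4 * r\<^sup>2)) > 0"
    using * by (intro mult_pos_pos) auto
  then show "H r > 0" by (simp add: H_def mult_ac)
qed

text \<open>The value on the coordinate vector of \<rho> forces \<open>K * D r < 0\<close>, and this
  sign makes all three coefficients \<open>F\<close>, \<open>G\<close>, \<open>H\<close> positive.
  Membership thus splits into a condition on \<rho> and one on \<zeta>; in particular every \<rho>
  that occurs also occurs with \<zeta> = 0.\<close>

lemma mem_M: "(r, z, t) \<in> M \<longleftrightarrow> pt_ok r \<and> 1 + a / 2 * (z \<bullet> z) > 0"
proof
  assume "(r, z, t) \<in> M"
  then have *: "r > 0" "Q r > 0" "D r \<noteq> 0" "1 + a / 2 * (z \<bullet> z) > 0" "pos_def_at g (r, z, t)"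
    by (auto simp: abc_manifold_def Q_def D_def dot_square_norm)
  have "g (r, z, t) (1, 0, 0) (1, 0, 0) > 0"
    using *(5) by (simp add: pos_def_at_def zero_prod_def)
  then have "F r > 0"
    by (simp add: metric_eq form_eq)
  then have "K * D r < 0"
    using * by (simp add: F_def zero_less_divide_iff divide_less_0_iff zero_less_mult_iff mult_less_0_iff)
  then show "pt_ok r \<and> 1 + a / 2 * (z \<bullet> z) > 0"
    using * by (simp add: pt_ok_def)
next
  assume *: "pt_ok r \<and> 1 + a / 2 * (z \<bullet> z) > 0"
  note p = pt_okD[OF conjunct1[OF *]]
  have m: "m z > 0" using * by (simp add: m_def)
  have "g (r, z, t) v v > 0" if "v \<noteq> 0" for v
  proof -
    obtain r' z' t' where v: "v = (r', z', t')" by (cases v)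
    consider "r' \<noteq> 0" | "z' \<noteq> 0" | "r' = 0" "z' = 0" "t' \<noteq> 0"
      using \<open>v \<noteq> 0\<close> v by (auto simp: zero_prod_def)
    moreover have nn: "F r * (r' * r') \<ge> 0" "G r * (m z)\<^sup>2 * (z' \<bullet> z') \<ge> 0"
        "H r * (\<eta> (r, z, t) v * \<eta> (r, z, t) v) \<ge> 0"
      using p by (auto intro!: mult_nonneg_nonneg)
    moreover have "F r * (r' * r') > 0" if "r' \<noteq> 0"
      using p that by (metis mult_pos_pos not_square_less_zero mult_eq_0_iff linorder_neqE_linordered_idom)
    moreover have "G r * (m z)\<^sup>2 * (z' \<bullet> z') > 0" if "z' \<noteq> 0"
      using p that m by simp
    moreover have "H r * (\<eta> (r, z, t) v * \<eta> (r, z, t) v) > 0" if "z' = 0" "t' \<noteq> 0"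
      using p that K by (simp add: v form_eq zero_less_mult_iff zero_less_divide_iff)
        (metis linorder_neqE_linordered_idom)
    ultimately show ?thesis
      unfolding metric_eq v fst_conv snd_conv by (smt (verit))
  qed
  then show "(r, z, t) \<in> M"
    using * p by (auto simp: abc_manifold_def pos_def_at_def Q_def D_def dot_square_norm)
qed

lemma open_M: "open M"
proof -
  have M: "M = {p. fst p > 0 \<and> Q (fst p) > 0 \<and> K * D (fst p) < 0
      \<and> 1 + a / 2 * (fst (snd p) \<bullet> fst (snd p)) > 0}"
    by (auto simp: mem_M pt_ok_def)
  show ?thesis
    unfolding M Q_def D_def
    by (intro open_Collect_conj open_Collect_less continuous_intros)
qed

text \<open>The first three clear the quotients in the definitions of \<open>\<mu>\<close>,
  \<open>\<nu>\<close>, \<open>h\<close> for the Koszul formula. The next six are the curvature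
  components at \<zeta> = 0 that involve no derivative of a profile function; the term
  \<open>2 * a\<close> is the curvature of the surface with metric
  \<open>m\<^sup>2 |d\<zeta>|\<^sup>2\<close>. The last one makes \<open>J\<close>
  orthogonal.\<close>

lemma pt_ok_relations:
  assumes "pt_ok r"
  shows "F r * \<mu> r = \<beta> r * G r" "F r * \<nu> r = \<gamma> r * H r" "G r * h r = b * H r"
    and "\<nu> r * b - \<mu> r * h r = B r * G r * (Q r / D r)"
    and "b * (\<gamma> r - \<beta> r) = B r * G r * (D r / Q r)"
    and "b * h r - \<gamma> r * \<mu> r = A r * G r"
    and "h r * (\<gamma> r - \<beta> r) = B r * F r * (Q r / D r)"
    and "(h r)\<^sup>2 - \<beta> r * \<nu> r = A r * H r"
    and "2 * a - \<beta> r * \<mu> r - 3 * h r * b = (A r + 3 * B r) * G r"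
    and "H r = F r * (Q r / D r)\<^sup>2"
proof -
  note p = pt_okD[OF assms]
  note nz = p(1)[THEN less_imp_neq, symmetric] p(2)[THEN less_imp_neq, symmetric] p(4) K
  show "F r * \<mu> r = \<beta> r * G r" "F r * \<nu> r = \<gamma> r * H r" "G r * h r = b * H r" "H r = F r * (Q r / D r)\<^sup>2"
    using nz by (simp_all add: F_def G_def H_def \<mu>_def \<nu>_def h_def field_simps power2_eq_square)
  note defs = F_def G_def H_def \<mu>_def \<nu>_def h_def A_def B_def \<beta>_def \<gamma>_def
  show "\<nu> r * b - \<mu> r * h r = B r * G r * (Q r / D r)"
    and "b * (\<gamma> r - \<beta> r) = B r * G r * (D r / Q r)"
    and "b * h r - \<gamma> r * \<mu> r = A r * G r"
    and "h r * (\<gamma> r - \<beta> r) = B r * F r * (Q r / D r)"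
    and "(h r)\<^sup>2 - \<beta> r * \<nu> r = A r * H r"
    and "2 * a - \<beta> r * \<mu> r - 3 * h r * b = (A r + 3 * B r) * G r"
    using nz unfolding defs
    by (simp_all add: divide_simps) (simp_all add: D_def Q_def, algebra+)
qed

text \<open>Each derivative is written with the products of Christoffel symbols that it meets in the
  curvature split off, so that the remainder is already the entry predicted by \<open>A\<close> and
  \<open>B\<close>.\<close>

lemma profile_derivatives:
  assumes "pt_ok r"
  shows "(F has_real_derivative 2 * \<alpha> r * F r) (at r)"
    and "(G has_real_derivative 2 * \<beta> r * G r) (at r)"
    and "(H has_real_derivative 2 * \<gamma> r * H r) (at r)"
    and "\<exists>\<alpha>'. (\<alpha> has_real_derivative \<alpha>') (at r)"
    and "(\<beta> has_real_derivative \<alpha> r * \<beta> r - (\<beta> r)\<^sup>2 - A r * F r) (at r)"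
    and "(\<gamma> has_real_derivative \<alpha> r * \<gamma> r - (\<gamma> r)\<^sup>2 - (A r + 3 * B r) * F r) (at r)"
    and "(\<mu> has_real_derivative \<mu> r * (\<beta> r - \<alpha> r) - A r * G r) (at r)"
    and "(\<nu> has_real_derivative \<nu> r * (\<gamma> r - \<alpha> r) - (A r + 3 * B r) * H r) (at r)"
    and "(h has_real_derivative 2 * B r * F r * (Q r / D r)) (at r)"
proof -
  note p = pt_okD[OF assms]
  note nz = p(1)[THEN less_imp_neq, symmetric] p(2)[THEN less_imp_neq, symmetric] p(4) K
  have dD: "(D has_real_derivative b) (at r)"
    unfolding D_def by (auto intro!: derivative_eq_intros)
  have dQ: "(Q has_real_derivative 2 * a * r + b) (at r)"
    unfolding Q_def by (auto intro!: derivative_eq_intros)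
  note defs = F_def G_def H_def \<mu>_def \<nu>_def h_def A_def B_def \<alpha>_def \<beta>_def \<gamma>_def
  \<comment> \<open>Only existence matters: \<open>\<alpha>\<close> multiplies
    \<open>fst u * fst v\<close> alone, so its derivative cancels when the curvature is
    antisymmetrised.\<close>
  show "\<exists>\<alpha>'. (\<alpha> has_real_derivative \<alpha>') (at r)"
    unfolding \<alpha>_def by (rule exI, (rule derivative_eq_intros dD dQ nz refl | simp)+)
  have dF: "(F has_real_derivative ((- K * b) * (4 * r\<^sup>2 * Q r) - (- K * D r) * (8 * r * Q r + 4 * r\<^sup>2 * (2 * a * r + b))) / (4 * r\<^sup>2 * Q r)\<^sup>2) (at r)"
    unfolding F_def power2_eq_square[of "4 * r\<^sup>2 * Q r"]
    by (rule DERIV_divide) (use nz in \<open>auto intro!: derivative_eq_intros dD dQ\<close>)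
  also have "((- K * b) * (4 * r\<^sup>2 * Q r) - (- K * D r) * (8 * r * Q r + 4 * r\<^sup>2 * (2 * a * r + b))) / (4 * r\<^sup>2 * Q r)\<^sup>2 = 2 * \<alpha> r * F r"
    unfolding F_def \<alpha>_def using nz by (simp add: divide_simps) algebra
  finally show "(F has_real_derivative 2 * \<alpha> r * F r) (at r)" .
  have "(G has_real_derivative ((- K * b) * (2 * r\<^sup>2) - (- K * D r) * (4 * r)) / (2 * r\<^sup>2)\<^sup>2) (at r)"
    unfolding G_def power2_eq_square[of "2 * r\<^sup>2"]
    by (rule DERIV_divide) (use nz in \<open>auto intro!: derivative_eq_intros dD dQ\<close>)
  also have "((- K * b) * (2 * r\<^sup>2) - (- K * D r) * (4 * r)) / (2 * r\<^sup>2)\<^sup>2 = 2 * \<beta> r * G r"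
    unfolding G_def \<beta>_def using nz by (simp add: divide_simps) algebra
  finally show "(G has_real_derivative 2 * \<beta> r * G r) (at r)" .
  have "(H has_real_derivative ((- K * (2 * a * r + b)) * (4 * r\<^sup>2 * D r) - (- K * Q r) * (8 * r * D r + 4 * r\<^sup>2 * b)) / (4 * r\<^sup>2 * D r)\<^sup>2) (at r)"
    unfolding H_def power2_eq_square[of "4 * r\<^sup>2 * D r"]
    by (rule DERIV_divide) (use nz in \<open>auto intro!: derivative_eq_intros dD dQ\<close>)
  also have "((- K * (2 * a * r + b)) * (4 * r\<^sup>2 * D r) - (- K * Q r) * (8 * r * D r + 4 * r\<^sup>2 * b)) / (4 * r\<^sup>2 * D r)\<^sup>2 = 2 * \<gamma> r * H r"
    unfolding H_def \<gamma>_def using nz by (simp add: divide_simps) algebra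
  finally show "(H has_real_derivative 2 * \<gamma> r * H r) (at r)" .
  have d\<beta>: "(\<beta> has_real_derivative (- b * b / (D r)\<^sup>2 + 2 / r\<^sup>2) / 2) (at r)"
    unfolding \<beta>_def using nz
    by (auto intro!: derivative_eq_intros dD dQ simp: power2_eq_square)
  have d\<gamma>: "(\<gamma> has_real_derivative ((2 * a * Q r - (2 * a * r + b)\<^sup>2) / (Q r)\<^sup>2 + 2 / r\<^sup>2 + b * b / (D r)\<^sup>2) / 2) (at r)"
    unfolding \<gamma>_def using nz
    by (auto intro!: derivative_eq_intros dD dQ simp: power2_eq_square mult_ac)
  have dx: "((\<lambda>r. Q r / D r) has_real_derivative ((2 * a * r + b) * D r - Q r * b) / (D r)\<^sup>2) (at r)"
    using nz by (auto intro!: derivative_eq_intros dD dQ simp: power2_eq_square)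
  have e\<beta>: "(- b * b / (D r)\<^sup>2 + 2 / r\<^sup>2) / 2 = \<alpha> r * \<beta> r - (\<beta> r)\<^sup>2 - A r * F r"
    unfolding defs using nz by (simp add: divide_simps) (simp add: D_def Q_def, algebra)
  show d\<beta>': "(\<beta> has_real_derivative \<alpha> r * \<beta> r - (\<beta> r)\<^sup>2 - A r * F r) (at r)"
    using d\<beta> unfolding e\<beta> .
  have e\<gamma>: "((2 * a * Q r - (2 * a * r + b)\<^sup>2) / (Q r)\<^sup>2 + 2 / r\<^sup>2 + b * b / (D r)\<^sup>2) / 2
      = \<alpha> r * \<gamma> r - (\<gamma> r)\<^sup>2 - (A r + 3 * B r) * F r"
    unfolding defs using nz by (simp add: divide_simps) (simp add: D_def Q_def, algebra)
  show d\<gamma>': "(\<gamma> has_real_derivative \<alpha> r * \<gamma> r - (\<gamma> r)\<^sup>2 - (A r + 3 * B r) * F r) (at r)"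
    using d\<gamma> unfolding e\<gamma> .
  have "(\<mu> has_real_derivative 2 * (2 * a * r + b) * \<beta> r + 2 * Q r * ((- b * b / (D r)\<^sup>2 + 2 / r\<^sup>2) / 2)) (at r)"
    unfolding \<mu>_def by (auto intro!: derivative_eq_intros dQ d\<beta>)
  also have "2 * (2 * a * r + b) * \<beta> r + 2 * Q r * ((- b * b / (D r)\<^sup>2 + 2 / r\<^sup>2) / 2)
      = \<mu> r * (\<beta> r - \<alpha> r) - A r * G r"
    unfolding defs using nz by (simp add: divide_simps) (simp add: D_def Q_def, algebra)
  finally show "(\<mu> has_real_derivative \<mu> r * (\<beta> r - \<alpha> r) - A r * G r) (at r)" .
  have "(\<nu> has_real_derivative
      (((2 * a * Q r - (2 * a * r + b)\<^sup>2) / (Q r)\<^sup>2 + 2 / r\<^sup>2 + b * b / (D r)\<^sup>2) / 2) * (Q r / D r)\<^sup>2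
      + \<gamma> r * (2 * (Q r / D r) * (((2 * a * r + b) * D r - Q r * b) / (D r)\<^sup>2))) (at r)"
    unfolding \<nu>_def by (rule DERIV_cong[OF DERIV_mult[OF d\<gamma> DERIV_power[OF dx, of 2]]]) (simp add: mult_ac)
  also have "(((2 * a * Q r - (2 * a * r + b)\<^sup>2) / (Q r)\<^sup>2 + 2 / r\<^sup>2 + b * b / (D r)\<^sup>2) / 2) * (Q r / D r)\<^sup>2
      + \<gamma> r * (2 * (Q r / D r) * (((2 * a * r + b) * D r - Q r * b) / (D r)\<^sup>2))
      = \<nu> r * (\<gamma> r - \<alpha> r) - (A r + 3 * B r) * H r"
    unfolding defs using nz by (simp add: divide_simps) (simp add: D_def Q_def, algebra)
  finally show "(\<nu> has_real_derivative \<nu> r * (\<gamma> r - \<alpha> r) - (A r + 3 * B r) * H r) (at r)" .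
  have "(h has_real_derivative (b * (2 * a * r + b) * (2 * (D r)\<^sup>2) - b * Q r * (4 * D r * b)) / (2 * (D r)\<^sup>2)\<^sup>2) (at r)"
    unfolding h_def using nz
    by (auto intro!: derivative_eq_intros dD dQ simp: power2_eq_square)
  also have "(b * (2 * a * r + b) * (2 * (D r)\<^sup>2) - b * Q r * (4 * D r * b)) / (2 * (D r)\<^sup>2)\<^sup>2 = 2 * B r * F r * (Q r / D r)"
    unfolding defs using nz by (simp add: divide_simps) (simp add: D_def Q_def, algebra)
  finally show "(h has_real_derivative 2 * B r * F r * (Q r / D r)) (at r)" .
qed

lemma profile_pt:
  assumes "(f has_real_derivative f') (at r)"
  shows "((\<lambda>p::point. f (fst p)) has_derivative (\<lambda>w. f' * fst w)) (at (r, z, t))"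
  using has_derivative_compose[OF has_derivative_fst[OF has_derivative_ident], of f "\<lambda>x. f' * x" "(r, z, t)"] assms
  by (simp add: has_field_derivative_def)

text \<open>\<open>d\<eta> z w u\<close> is the derivative of \<open>\<eta>(u)\<close> in direction \<open>w\<close> for constant \<open>u\<close>, not the exterior
  derivative.\<close>

definition d\<eta> :: "complex \<Rightarrow> complex \<Rightarrow> complex \<Rightarrow> real" where
  "d\<eta> z w u = b * (m z * Im (w * cnj u) - a * (m z)\<^sup>2 * (z \<bullet> w) * Im (z * cnj u))"

lemma m_has_derivative:
  assumes "1 + a / 2 * (z \<bullet> z) > 0"
  shows "(m has_derivative (\<lambda>w. - a * (m z)\<^sup>2 * (z \<bullet> w))) (at z)"
proof -
  have "((\<lambda>z. 1 + a / 2 * (z \<bullet> z)) has_derivative (\<lambda>w. a * (z \<bullet> w))) (at z)"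
    by (rule has_derivative_eq_rhs, (rule derivative_intros)+) (simp add: inner_commute)
  from has_derivative_divide'[OF has_derivative_const[of 1] this] assms
  have "((\<lambda>z. 1 / (1 + a / 2 * (z \<bullet> z))) has_derivative
      (\<lambda>w. - (a * (z \<bullet> w)) / ((1 + a / 2 * (z \<bullet> z)) * (1 + a / 2 * (z \<bullet> z))))) (at z)"
    by simp
  also have "(\<lambda>w. - (a * (z \<bullet> w)) / ((1 + a / 2 * (z \<bullet> z)) * (1 + a / 2 * (z \<bullet> z))))
      = (\<lambda>w. - a * (m z)\<^sup>2 * (z \<bullet> w))"
    by (simp add: m_def power_divide power2_eq_square)
  finally show ?thesis by (simp add: m_def[abs_def])
qed

lemma m_has_derivative_pt:
  assumes "1 + a / 2 * (z \<bullet> z) > 0"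
  shows "((\<lambda>p::point. m (fst (snd p))) has_derivative (\<lambda>w. - a * (m z)\<^sup>2 * (z \<bullet> fst (snd w)))) (at (r, z, t))"
proof -
  have "((\<lambda>p::point. fst (snd p)) has_derivative (\<lambda>w. fst (snd w))) (at (r, z, t))"
    by (intro derivative_intros)
  from has_derivative_compose[OF this, of m] m_has_derivative[OF assms] show ?thesis
    by simp
qed

lemma form_has_derivative:
  assumes "1 + a / 2 * (z \<bullet> z) > 0"
  shows "((\<lambda>p. \<eta> p u) has_derivative (\<lambda>w. d\<eta> z (fst (snd w)) (fst (snd u)))) (at (r, z, t))"
proof -
  obtain r' z' t' where u: "u = (r', z', t')" by (cases u)
  note m' = m_has_derivative_pt[OF assms]
  have "((\<lambda>p::point. - t' / K + b * Im (fst (snd p) * cnj z') * m (fst (snd p))) has_derivative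
      (\<lambda>w. d\<eta> z (fst (snd w)) z')) (at (r, z, t))"
    unfolding d\<eta>_def
    by (auto intro!: derivative_eq_intros m' simp: fun_eq_iff algebra_simps)
  then show ?thesis
    by (simp add: u case_prod_unfold form_eq[of "fst p" "fst (snd p)" "snd (snd p)" for p, unfolded prod.collapse])
qed

text \<open>This is the exterior derivative of the connection form: a constant multiple of the area
  form of \<open>m\<^sup>2 |d\<zeta>|\<^sup>2\<close>. The numerators produced by differentiating
  \<open>m\<close> combine through \<open>m z * (1 + a / 2 * (z \<bullet> z)) = 1\<close>.\<close>

lemma d\<eta>_antisym:
  assumes "1 + a / 2 * (z \<bullet> z) > 0"
  shows "d\<eta> z u v - d\<eta> z v u = - 2 * b * (m z)\<^sup>2 * ((\<i> * u) \<bullet> v)"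
proof -
  have "m z * (1 + a / 2 * (z \<bullet> z)) = 1" using assms by (simp add: m_def)
  moreover have "m z * (m z * (1 + a / 2 * (z \<bullet> z))) * Im (u * cnj v) = m z * Im (u * cnj v)"
    using calculation by simp
  ultimately show ?thesis
    unfolding d\<eta>_def
    by (simp add: inner_complex_def) algebra
qed

lemma d\<eta>_sym: "d\<eta> z u v + d\<eta> z v u = a * b * (m z)\<^sup>2 * Im ((cnj z)\<^sup>2 * u * v)"
  unfolding d\<eta>_def by (simp add: inner_complex_def power2_eq_square algebra_simps)

lemma dmetric_eq:
  assumes "(r, z, t) \<in> M"
  shows "((\<lambda>p. g p u v) has_derivative (\<lambda>w.
      2 * fst w * (\<alpha> r * F r * (fst u * fst v) + \<beta> r * G r * (m z)\<^sup>2 * (fst (snd u) \<bullet> fst (snd v))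
        + \<gamma> r * H r * (\<eta> (r, z, t) u * \<eta> (r, z, t) v))
      - 2 * G r * a * (m z) ^ 3 * (z \<bullet> fst (snd w)) * (fst (snd u) \<bullet> fst (snd v))
      + H r * (d\<eta> z (fst (snd w)) (fst (snd u)) * \<eta> (r, z, t) v
        + \<eta> (r, z, t) u * d\<eta> z (fst (snd w)) (fst (snd v))))) (at (r, z, t))"
proof -
  have ok: "pt_ok r" "1 + a / 2 * (z \<bullet> z) > 0" using assms by (simp_all add: mem_M)
  note m' = m_has_derivative_pt[OF ok(2)]
  have "((\<lambda>p. F (fst p) * (fst u * fst v) + G (fst p) * (m (fst (snd p)))\<^sup>2 * (fst (snd u) \<bullet> fst (snd v))
     + H (fst p) * (\<eta> p u * \<eta> p v)) has_derivative (\<lambda>w.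
      2 * fst w * (\<alpha> r * F r * (fst u * fst v) + \<beta> r * G r * (m z)\<^sup>2 * (fst (snd u) \<bullet> fst (snd v))
        + \<gamma> r * H r * (\<eta> (r, z, t) u * \<eta> (r, z, t) v))
      - 2 * G r * a * (m z) ^ 3 * (z \<bullet> fst (snd w)) * (fst (snd u) \<bullet> fst (snd v))
      + H r * (d\<eta> z (fst (snd w)) (fst (snd u)) * \<eta> (r, z, t) v
        + \<eta> (r, z, t) u * d\<eta> z (fst (snd w)) (fst (snd v))))) (at (r, z, t))"
    by (rule has_derivative_eq_rhs, (rule derivative_intros m' profile_pt[OF profile_derivatives(1)[OF ok(1)]]
         profile_pt[OF profile_derivatives(2)[OF ok(1)]] profile_pt[OF profile_derivatives(3)[OF ok(1)]]
         form_has_derivative[OF ok(2)])+)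
       (simp add: fun_eq_iff algebra_simps power2_eq_square power3_eq_cube)
  then show ?thesis
    by (simp add: metric_eq[of "fst p" "fst (snd p)" "snd (snd p)" for p, unfolded prod.collapse])
qed

subsection \<open>Christoffel symbols\<close>

text \<open>The \<open>\<rho>\<close>-, \<open>\<zeta>\<close>- and \<open>\<eta>\<close>-components of \<open>\<Gamma>\<close>; working with \<open>\<eta>\<close> instead of \<open>dt\<close> diagonalises the
  metric.\<close>

definition \<Gamma>r :: "point \<Rightarrow> point \<Rightarrow> point \<Rightarrow> real" where
  "\<Gamma>r p u v = \<alpha> (fst p) * (fst u * fst v) - \<mu> (fst p) * ((m (fst (snd p)))\<^sup>2 * (fst (snd u) \<bullet> fst (snd v)))
     - \<nu> (fst p) * (\<eta> p u * \<eta> p v)"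

definition \<Gamma>z :: "point \<Rightarrow> point \<Rightarrow> point \<Rightarrow> complex" where
  "\<Gamma>z p u v = \<beta> (fst p) *\<^sub>R (fst u *\<^sub>R fst (snd v) + fst v *\<^sub>R fst (snd u))
     - (a * m (fst (snd p))) *\<^sub>R (cnj (fst (snd p)) * (fst (snd u) * fst (snd v)))
     - h (fst p) *\<^sub>R (\<eta> p v *\<^sub>R (\<i> * fst (snd u)) + \<eta> p u *\<^sub>R (\<i> * fst (snd v)))"

definition \<Gamma>e :: "point \<Rightarrow> point \<Rightarrow> point \<Rightarrow> real" where
  "\<Gamma>e p u v = \<gamma> (fst p) * (fst u * \<eta> p v + fst v * \<eta> p u)
     + a * b / 2 * ((m (fst (snd p)))\<^sup>2 * Im (cnj (fst (snd p)) * cnj (fst (snd p)) * (fst (snd u) * fst (snd v))))"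

text \<open>The t-component is obtained by solving
  \<open>\<eta> p (\<Gamma> p u v) = \<Gamma>e p u v\<close> for it.\<close>

definition \<Gamma> :: "point \<Rightarrow> point \<Rightarrow> point \<Rightarrow> point" where
  "\<Gamma> p u v = (\<Gamma>r p u v, \<Gamma>z p u v, - K * (\<Gamma>e p u v - b * (m (fst (snd p)) * Im (fst (snd p) * cnj (\<Gamma>z p u v)))))"

lemma form_add: "\<eta> p (u + v) = \<eta> p u + \<eta> p v"
  by (cases p; cases u; cases v) (simp add: form_eq algebra_simps add_divide_distrib diff_divide_distrib)

lemma form_scaleR: "\<eta> p (s *\<^sub>R u) = s * \<eta> p u"
  by (cases p; cases u) (simp add: form_eq algebra_simps)

lemma form_minus: "\<eta> p (- u) = - \<eta> p u"
  using form_scaleR[of p "-1" u] by simp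

lemma form_diff: "\<eta> p (u - v) = \<eta> p u - \<eta> p v"
  using form_add[of p u "- v"] by (simp add: form_minus)

lemma tangent_eqI:
  assumes "fst u = fst v" "fst (snd u) = fst (snd v)" "\<eta> p u = \<eta> p v"
  shows "u = v"
  using assms K by (cases p; cases u; cases v) (simp add: form_eq)

lemma form_\<Gamma>: "\<eta> p (\<Gamma> p u v) = \<Gamma>e p u v"
proof -
  have cancel: "- (- K * x) / K = x" for x using K by simp
  show ?thesis
    by (cases p) (simp only: \<Gamma>_def form_eq cancel fst_conv snd_conv, simp only: mult_ac diff_add_cancel)
qed

lemma christoffel_commute: "\<Gamma> p u v = \<Gamma> p v u"
proof -
  have "\<Gamma>r p u v = \<Gamma>r p v u" "\<Gamma>z p u v = \<Gamma>z p v u" "\<Gamma>e p u v = \<Gamma>e p v u"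
    by (simp_all add: \<Gamma>r_def \<Gamma>z_def \<Gamma>e_def inner_commute mult.commute add.commute)
  then show ?thesis by (simp add: \<Gamma>_def)
qed

lemma bilinear_christoffel: "bilinear (\<Gamma> p)"
proof -
  have "linear (\<Gamma> p u)" for u
  proof
    fix v w s
    have "\<Gamma>r p u (v + w) = \<Gamma>r p u v + \<Gamma>r p u w" "\<Gamma>z p u (v + w) = \<Gamma>z p u v + \<Gamma>z p u w"
      "\<Gamma>e p u (v + w) = \<Gamma>e p u v + \<Gamma>e p u w"
      by (simp_all add: \<Gamma>r_def \<Gamma>z_def \<Gamma>e_def form_add inner_add_right algebra_simps)
    then show "\<Gamma> p u (v + w) = \<Gamma> p u v + \<Gamma> p u w"
      by (simp add: \<Gamma>_def algebra_simps)
    have "\<Gamma>r p u (s *\<^sub>R v) = s * \<Gamma>r p u v" "\<Gamma>z p u (s *\<^sub>R v) = s *\<^sub>R \<Gamma>z p u v"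
      "\<Gamma>e p u (s *\<^sub>R v) = s * \<Gamma>e p u v"
      by (simp_all add: \<Gamma>r_def \<Gamma>z_def \<Gamma>e_def form_scaleR algebra_simps)
    then show "\<Gamma> p u (s *\<^sub>R v) = s *\<^sub>R \<Gamma> p u v"
      by (simp add: \<Gamma>_def algebra_simps)
  qed
  then show ?thesis
    using christoffel_commute by (simp add: bilinear_def)
qed

lemma bilinear_metric: "bilinear (g p)"
proof -
  have comm: "g p u v = g p v u" for u v
    by (cases p) (simp add: metric_eq inner_commute mult.commute)
  have "linear (g p u)" for u
    by (cases p, rule linearI)
       (simp_all add: metric_eq form_add form_scaleR inner_add_right algebra_simps)
  then show ?thesis
    using comm by (simp add: bilinear_def)
qed

lemma christoffel_differentiable:
  assumes "p \<in> M"
  shows "(\<lambda>q. \<Gamma> q u v) differentiable (at p)"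
proof -
  obtain r z t where p: "p = (r, z, t)" by (cases p)
  have ok: "pt_ok r" "1 + a / 2 * (z \<bullet> z) > 0" using assms by (simp_all add: mem_M p)
  obtain \<alpha>' where \<alpha>': "(\<alpha> has_real_derivative \<alpha>') (at r)"
    using profile_derivatives(4)[OF ok(1)] by blast
  note d = profile_derivatives[OF ok(1)]
  note rules = m_has_derivative_pt[OF ok(2)] form_has_derivative[OF ok(2)]
    profile_pt[OF \<alpha>'] profile_pt[OF d(5)] profile_pt[OF d(6)] profile_pt[OF d(7)] profile_pt[OF d(8)]
    profile_pt[OF d(9)]
  show ?thesis
    unfolding p \<Gamma>_def \<Gamma>r_def \<Gamma>z_def \<Gamma>e_def differentiable_def
    by (rule exI, (rule derivative_intros rules)+)
qed

text \<open>The metric being diagonal, the three components are checked separately after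
  multiplication by \<open>F\<close>, \<open>G\<close> and \<open>H\<close>. The antisymmetric part
  of \<open>d\<eta>\<close> accounts for the terms of \<open>\<Gamma>z\<close> with
  \<open>h\<close>, the symmetric part for the last term of \<open>\<Gamma>e\<close>.\<close>

lemma \<Gamma>_koszul:
  assumes "p \<in> M"
  shows "2 * g p (\<Gamma> p u v) w = dmetric g p u v w + dmetric g p v u w - dmetric g p w u v"
proof -
  obtain r z t where p: "p = (r, z, t)" by (cases p)
  have ok: "pt_ok r" "1 + a / 2 * (z \<bullet> z) > 0" using assms by (simp_all add: mem_M p)
  have dm: "dmetric g p w u v = 
      2 * fst w * (\<alpha> r * F r * (fst u * fst v) + \<beta> r * G r * (m z)\<^sup>2 * (fst (snd u) \<bullet> fst (snd v))
        + \<gamma> r * H r * (\<eta> p u * \<eta> p v))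
      - 2 * G r * a * (m z) ^ 3 * (z \<bullet> fst (snd w)) * (fst (snd u) \<bullet> fst (snd v))
      + H r * (d\<eta> z (fst (snd w)) (fst (snd u)) * \<eta> p v
        + \<eta> p u * d\<eta> z (fst (snd w)) (fst (snd v)))" for u v w
    using frechet_derivative_eqI[OF dmetric_eq[OF assms[unfolded p], of u v]] by (simp add: dmetric_def p)
  have g_eq: "g p x y = F r * (fst x * fst y) + G r * (m z)\<^sup>2 * (fst (snd x) \<bullet> fst (snd y)) + H r * (\<eta> p x * \<eta> p y)" for x y
    by (simp add: p metric_eq)
  define ur uz ue where u: "ur = fst u" "uz = fst (snd u)" "ue = \<eta> p u"
  define vr vz ve where v: "vr = fst v" "vz = fst (snd v)" "ve = \<eta> p v"
  define wr wz we where w: "wr = fst w" "wz = fst (snd w)" "we = \<eta> p w"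
  note rel = pt_ok_relations(1-3)[OF ok(1)]
  have 1: "F r * \<Gamma>r p u v = \<alpha> r * F r * (ur * vr) - \<beta> r * G r * ((m z)\<^sup>2 * (uz \<bullet> vz)) - \<gamma> r * H r * (ue * ve)"
    unfolding \<Gamma>r_def u v rel[symmetric] by (simp add: p algebra_simps)
  \<comment> \<open>The usual Christoffel symbols of a conformally flat plane metric, condensed into
    one complex product.\<close>
  have conf: "(cnj z * (uz * vz)) \<bullet> wz = (z \<bullet> uz) * (vz \<bullet> wz) + (z \<bullet> vz) * (uz \<bullet> wz) - (z \<bullet> wz) * (uz \<bullet> vz)"
    by (simp add: inner_complex_def algebra_simps)
  have 2: "G r * (\<Gamma>z p u v \<bullet> wz) = \<beta> r * G r * (ur * (vz \<bullet> wz) + vr * (uz \<bullet> wz))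
     - G r * a * m z * ((z \<bullet> uz) * (vz \<bullet> wz) + (z \<bullet> vz) * (uz \<bullet> wz) - (z \<bullet> wz) * (uz \<bullet> vz))
     - b * H r * (ve * ((\<i> * uz) \<bullet> wz) + ue * ((\<i> * vz) \<bullet> wz))"
    unfolding \<Gamma>z_def u v rel(3)[symmetric] conf[unfolded u v, symmetric]
    by (simp add: p inner_diff_left inner_add_left algebra_simps)
  have 3: "2 * \<Gamma>e p u v = 2 * \<gamma> r * (ur * ve + vr * ue) + (d\<eta> z uz vz + d\<eta> z vz uz)"
    unfolding d\<eta>_sym \<Gamma>e_def u v by (simp add: p power2_eq_square algebra_simps)
  have 4: "d\<eta> z uz wz - d\<eta> z wz uz = - 2 * b * (m z)\<^sup>2 * ((\<i> * uz) \<bullet> wz)"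
     "d\<eta> z vz wz - d\<eta> z wz vz = - 2 * b * (m z)\<^sup>2 * ((\<i> * vz) \<bullet> wz)"
    by (rule d\<eta>_antisym[OF ok(2)])+
  have "2 * g p (\<Gamma> p u v) w = 2 * (F r * \<Gamma>r p u v) * wr + 2 * (m z)\<^sup>2 * (G r * (\<Gamma>z p u v \<bullet> wz))
      + H r * (2 * \<Gamma>e p u v) * we"
    unfolding w g_eq form_\<Gamma> by (simp add: \<Gamma>_def algebra_simps)
  also have "\<dots> = dmetric g p u v w + dmetric g p v u w - dmetric g p w u v
      + H r * ve * (- 2 * b * (m z)\<^sup>2 * ((\<i> * uz) \<bullet> wz) - (d\<eta> z uz wz - d\<eta> z wz uz))
      + H r * ue * (- 2 * b * (m z)\<^sup>2 * ((\<i> * vz) \<bullet> wz) - (d\<eta> z vz wz - d\<eta> z wz vz))"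
    unfolding 1 2 3 dm u[symmetric] v[symmetric] w[symmetric]
    by (simp add: algebra_simps power2_eq_square power3_eq_cube inner_commute[of vz uz])
  finally show ?thesis unfolding 4 by simp
qed

sublocale riemannian_chart M g \<Gamma>
proof
  show "open M" by (rule open_M)
  show "bilinear (g p)" for p by (rule bilinear_metric)
  show "g p u v = g p v u" for p u v
    by (cases p) (simp add: metric_eq inner_commute mult.commute)
  show "g p u u > 0" if "p \<in> M" "u \<noteq> 0" for p u
    using that by (cases p) (simp add: abc_manifold_def pos_def_at_def del: split_paired_All)
  show "(\<lambda>q. g q u v) differentiable (at p)" if p: "p \<in> M" for p u v
  proof -
    obtain r z t where "p = (r, z, t)" by (cases p)
    then show ?thesis using differentiableI[OF dmetric_eq, of r z t u v] p by simp
  qed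
  show "bilinear (\<Gamma> p)" for p by (rule bilinear_christoffel)
  show "\<Gamma> p u v = \<Gamma> p v u" for p u v by (rule christoffel_commute)
  show "(\<lambda>q. \<Gamma> q u v) differentiable (at p)" if "p \<in> M" for p u v by (rule christoffel_differentiable[OF that])
  show "2 * g p (\<Gamma> p u v) w = dmetric g p u v w + dmetric g p v u w - dmetric g p w u v"
    if "p \<in> M" for p u v w by (rule \<Gamma>_koszul[OF that])
qed

subsection \<open>Curvature at $\zeta = 0$\<close>

text \<open>Multiplication by \<i> on \<zeta>, and an exchange of the \<rho>- and \<eta>-directions.
  The factors Q/D and D/Q make the exchange isometric since \<open>H = F * (Q/D)\<^sup>2\<close>;
  the t-component is again solved for so that \<open>form_J\<close> holds.\<close>

definition J :: "point \<Rightarrow> point \<Rightarrow> point" where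
  "J p u = (- (Q (fst p) / D (fst p) * \<eta> p u), \<i> * fst (snd u),
     - K * (D (fst p) / Q (fst p) * fst u - b * (m (fst (snd p)) * Im (fst (snd p) * cnj (\<i> * fst (snd u))))))"

lemma form_J: "\<eta> p (J p u) = D (fst p) / Q (fst p) * fst u"
proof -
  have cancel: "- (- K * x) / K = x" for x using K by simp
  show ?thesis
    by (cases p) (simp only: J_def form_eq cancel fst_conv snd_conv, simp only: mult_ac diff_add_cancel)
qed

lemma J_simps: "fst (J p u) = - (Q (fst p) / D (fst p) * \<eta> p u)" "fst (snd (J p u)) = \<i> * fst (snd u)"
  by (simp_all add: J_def)

lemma linear_J: "linear (J p)"
  by (rule linearI; rule tangent_eqI[where p = p])
     (simp_all add: J_simps form_J form_add form_scaleR algebra_simps add_divide_distrib)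

definition model_curvature :: "point \<Rightarrow> point \<Rightarrow> point \<Rightarrow> point \<Rightarrow> point" where
  "model_curvature p u v w = A (fst p) *\<^sub>R (g p v w *\<^sub>R u - g p u w *\<^sub>R v)
      + B (fst p) *\<^sub>R (g p (J p v) w *\<^sub>R J p u - g p (J p u) w *\<^sub>R J p v - (2 * g p (J p u) v) *\<^sub>R J p w)"

text \<open>At \<zeta> = 0 the factor \<open>m\<close> equals 1 and is stationary, and
  \<open>d\<eta>\<close> reduces to its antisymmetric part; this keeps the derivative short enough
  for an explicit formula.\<close>

lemma \<Gamma>_has_derivative_axis:
  assumes ok: "pt_ok r" and \<alpha>': "(\<alpha> has_real_derivative \<alpha>') (at r)"
    and p_def: "p = (r, 0, t)"
  shows "((\<lambda>q. \<Gamma> q v w) has_derivative (\<lambda>u.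
    (fst u * (\<alpha>' * (fst v * fst w) - (\<mu> r * (\<beta> r - \<alpha> r) - A r * G r) * (fst (snd v) \<bullet> fst (snd w))
        - (\<nu> r * (\<gamma> r - \<alpha> r) - (A r + 3 * B r) * H r) * (\<eta> p v * \<eta> p w))
      - \<nu> r * b * (Im (fst (snd u) * cnj (fst (snd v))) * \<eta> p w + \<eta> p v * Im (fst (snd u) * cnj (fst (snd w)))),
     fst u *\<^sub>R ((\<alpha> r * \<beta> r - (\<beta> r)\<^sup>2 - A r * F r) *\<^sub>R (fst v *\<^sub>R fst (snd w) + fst w *\<^sub>R fst (snd v))
         - (2 * B r * F r * (Q r / D r)) *\<^sub>R (\<eta> p w *\<^sub>R (\<i> * fst (snd v)) + \<eta> p v *\<^sub>R (\<i> * fst (snd w))))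
       - a *\<^sub>R (cnj (fst (snd u)) * (fst (snd v) * fst (snd w)))
       - (h r * b) *\<^sub>R (Im (fst (snd u) * cnj (fst (snd w))) *\<^sub>R (\<i> * fst (snd v))
           + Im (fst (snd u) * cnj (fst (snd v))) *\<^sub>R (\<i> * fst (snd w))),
     - K * (fst u * (\<alpha> r * \<gamma> r - (\<gamma> r)\<^sup>2 - (A r + 3 * B r) * F r) * (fst v * \<eta> p w + fst w * \<eta> p v)
       + \<gamma> r * b * (fst v * Im (fst (snd u) * cnj (fst (snd w))) + fst w * Im (fst (snd u) * cnj (fst (snd v))))
       - b * Im (fst (snd u) * cnj (\<Gamma>z p v w)))))) (at p)"
proof -
  have ok2: "1 + a / 2 * ((0::complex) \<bullet> 0) > 0" by simp
  note d = profile_derivatives[OF ok]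
  note rules = m_has_derivative_pt[OF ok2] form_has_derivative[OF ok2]
    profile_pt[OF \<alpha>'] profile_pt[OF d(5)] profile_pt[OF d(6)] profile_pt[OF d(7)] profile_pt[OF d(8)]
    profile_pt[OF d(9)]
  have m0: "m 0 = 1" by (simp add: m_def)
  have d\<eta>0: "d\<eta> 0 u v = b * Im (u * cnj v)" for u v
    by (simp add: d\<eta>_def m0)
  show ?thesis
    unfolding p_def \<Gamma>_def \<Gamma>r_def \<Gamma>z_def \<Gamma>e_def
    by (rule has_derivative_eq_rhs, (rule derivative_intros rules)+)
       (simp add: fun_eq_iff m0 d\<eta>0 scaleR_add_left scaleR_add_right scaleR_diff_left scaleR_diff_right
          left_diff_distrib right_diff_distrib distrib_left distrib_right mult_ac)
qed

lemma riemann_axis: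
  assumes ok: "pt_ok r"
  shows "riemann g (r, 0, t) u v w = model_curvature (r, 0, t) u v w"
proof -
  obtain \<alpha>' where \<alpha>': "(\<alpha> has_real_derivative \<alpha>') (at r)"
    using profile_derivatives(4)[OF ok] by blast
  define p where "p = (r, 0::complex, t)"
  have p: "p \<in> M" using ok by (simp add: p_def mem_M)
  note d\<Gamma>_eq = frechet_derivative_eqI[OF \<Gamma>_has_derivative_axis[OF ok \<alpha>' p_def]]
  have m0: "m 0 = 1" by (simp add: m_def)
  have \<eta>p: "\<eta> p (y, z, - K * s) = s" for y z s
    using K by (simp add: p_def form_eq)
  \<comment> \<open>The scaling by \<open>- K\<close> makes the fourth coordinate equal to the value
    of \<eta> at \<zeta> = 0.\<close>
  have ex: "\<exists>u1 u2 u3 u4. u = (u1, Complex u2 u3, - K * u4)" for u :: point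
  proof -
    have "u = (fst u, Complex (Re (fst (snd u))) (Im (fst (snd u))), - K * (- (snd (snd u) / K)))"
      using K by (simp add: prod_eq_iff)
    then show ?thesis by metis
  qed
  obtain u1 u2 u3 u4 where u: "u = (u1, Complex u2 u3, - K * u4)" using ex by metis
  obtain v1 v2 v3 v4 where v: "v = (v1, Complex v2 v3, - K * v4)" using ex by metis
  obtain w1 w2 w3 w4 where w: "w = (w1, Complex w2 w3, - K * w4)" using ex by metis
  \<comment> \<open>The two quotients become independent variables tied by \<open>x * y = 1\<close>,
    which leaves polynomial identities.\<close>
  define x where "x = Q r / D r"
  define y where "y = D r / Q r"
  have xy: "x * y = 1" using pt_okD[OF ok] by (simp add: x_def y_def)
  note rel = pt_ok_relations(4-10)[OF ok, folded x_def y_def]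
  have \<Gamma>p: "\<Gamma> p (u1, Complex u2 u3, - K * u4) (v1, Complex v2 v3, - K * v4)
     = (\<alpha> r * (u1 * v1) - \<mu> r * (u2 * v2 + u3 * v3) - \<nu> r * (u4 * v4),
        Complex (\<beta> r * (u1 * v2 + v1 * u2) + h r * (v4 * u3 + u4 * v3))
          (\<beta> r * (u1 * v3 + v1 * u3) - h r * (v4 * u2 + u4 * v2)),
        - K * (\<gamma> r * (u1 * v4 + v1 * u4)))" for u1 u2 u3 u4 v1 v2 v3 v4
    unfolding \<Gamma>_def \<Gamma>r_def \<Gamma>z_def \<Gamma>e_def \<eta>p
    by (simp add: p_def m0 complex_eq_iff inner_complex_def) (simp add: algebra_simps)?
  have \<Gamma>zp: "\<Gamma>z p (u1, Complex u2 u3, - K * u4) (v1, Complex v2 v3, - K * v4)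
     = Complex (\<beta> r * (u1 * v2 + v1 * u2) + h r * (v4 * u3 + u4 * v3))
          (\<beta> r * (u1 * v3 + v1 * u3) - h r * (v4 * u2 + u4 * v2))" for u1 u2 u3 u4 v1 v2 v3 v4
    using \<Gamma>p[of u1 u2 u3 u4 v1 v2 v3 v4] by (simp add: \<Gamma>_def)
  have gp: "g p (u1, Complex u2 u3, - K * u4) (v1, Complex v2 v3, - K * v4)
     = F r * (u1 * v1) + G r * (u2 * v2 + u3 * v3) + F r * x\<^sup>2 * (u4 * v4)" for u1 u2 u3 u4 v1 v2 v3 v4
    using \<eta>p unfolding p_def metric_eq rel(7) by (simp add: m0 inner_complex_def)
  have Jp: "J p (u1, Complex u2 u3, - K * u4) = (- x * u4, Complex (- u3) u2, - K * (y * u1))" for u1 u2 u3 u4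
    unfolding J_def \<eta>p by (simp add: p_def x_def y_def complex_eq_iff)
  have Om: "g p (J p (u1, Complex u2 u3, - K * u4)) (v1, Complex v2 v3, - K * v4)
     = F r * x * (u1 * v4 - u4 * v1) + G r * (u2 * v3 - u3 * v2)" for u1 u2 u3 u4 v1 v2 v3 v4
  proof -
    have "F r * x\<^sup>2 * (y * u1 * v4) = F r * x * (x * y) * (u1 * v4)"
      by (simp add: power2_eq_square)
    then show ?thesis unfolding Jp gp by (simp add: xy algebra_simps)
  qed
  have fst_p: "fst p = r" by (simp add: p_def)
  have "riemann g p u v w = model_curvature p u v w"
  proof (rule tangent_eqI[where p = p])
    \<comment> \<open>The relation enters the \<rho>-component with exactly this cofactor; the
      product is supplied ready-made so that no search for it remains. The \<eta>-component below is
      treated likewise.\<close>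
    have "(\<nu> r * b - \<mu> r * h r - B r * G r * x) *
       (2 * (u2 * v3 - u3 * v2) * w4 + v4 * (u2 * w3 - u3 * w2) - u4 * (v2 * w3 - v3 * w2)) = 0"
      by (simp add: rel)
    then show "fst (riemann g p u v w) = fst (model_curvature p u v w)"
      unfolding riemann_eq[OF p] model_curvature_def u v w Om rel(7) fst_p
      unfolding d\<Gamma>_eq \<Gamma>p \<Gamma>zp gp Jp \<eta>p rel(7)
      by (simp add: inner_complex_def) algebra
  next
    have "(b * (\<gamma> r - \<beta> r) - B r * G r * y) *
       (v1 * (u2 * w3 - u3 * w2) - u1 * (v2 * w3 - v3 * w2) + 2 * w1 * (u2 * v3 - u3 * v2)) = 0"
      "(b * h r - \<gamma> r * \<mu> r - A r * G r) * (u4 * (v2 * w2 + v3 * w3) - v4 * (u2 * w2 + u3 * w3)) = 0"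
      "(x * y - 1) * B r * F r * (v1 * w4 - v4 * w1) * u1 = 0"
      "(x * y - 1) * B r * F r * (u1 * w4 - u4 * w1) * v1 = 0"
      "(x * y - 1) * B r * F r * (u1 * v4 - u4 * v1) * w1 = 0"
      by (simp_all add: rel xy)
    then show "\<eta> p (riemann g p u v w) = \<eta> p (model_curvature p u v w)"
      unfolding riemann_eq[OF p] model_curvature_def u v w Om fst_p form_add form_diff form_scaleR
      unfolding d\<Gamma>_eq \<Gamma>p \<Gamma>zp gp Jp \<eta>p
      by simp algebra
  next
    have fold: "Re z = Re z' \<Longrightarrow> Im z = Im z' \<Longrightarrow> z = z'" for z z' by (simp add: complex_eq_iff)
    show "fst (snd (riemann g p u v w)) = fst (snd (model_curvature p u v w))"
    proof (rule fold)
      show "Re (fst (snd (riemann g p u v w))) = Re (fst (snd (model_curvature p u v w)))"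
        using rel(4-6)
        unfolding riemann_eq[OF p] model_curvature_def u v w Om fst_p rel(7)
        unfolding d\<Gamma>_eq \<Gamma>p \<Gamma>zp gp Jp \<eta>p rel(7)
        by (simp add: x_def[symmetric]) algebra
      show "Im (fst (snd (riemann g p u v w))) = Im (fst (snd (model_curvature p u v w)))"
        using rel(4-6)
        unfolding riemann_eq[OF p] model_curvature_def u v w Om fst_p rel(7)
        unfolding d\<Gamma>_eq \<Gamma>p \<Gamma>zp gp Jp \<eta>p rel(7)
        by (simp add: x_def[symmetric]) algebra
    qed
  qed
  then show ?thesis by (simp add: p_def)
qed

subsection \<open>Isometries preserving the level sets of $\rho$\<close>

definition den :: "complex \<Rightarrow> complex \<Rightarrow> complex \<Rightarrow> complex" where
  "den p q z = cnj p - of_real (a / 2) * cnj q * z"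

text \<open>The Moebius transformation of the matrix with rows (p, q) and (-a/2 cnj q, cnj p), whose
  determinant is \<open>mob_det\<close>. With determinant 1 these form a copy of SU(2) for a > 0 and
  of SU(1,1) for a < 0. No normalisation is imposed, as real multiples of (p, q) give the same
  map.\<close>

definition mob :: "complex \<Rightarrow> complex \<Rightarrow> complex \<Rightarrow> complex" where
  "mob p q z = (p * z + q) / den p q z"

definition mob_det :: "complex \<Rightarrow> complex \<Rightarrow> real" where
  "mob_det p q = (cmod p)\<^sup>2 + a / 2 * (cmod q)\<^sup>2"

text \<open>The shift of \<open>t\<close> that makes \<open>mob\<close> preserve \<open>\<eta>\<close>. For \<open>a = 0\<close> it is only used with \<open>p = 1\<close>.\<close>

definition shift :: "complex \<Rightarrow> complex \<Rightarrow> complex \<Rightarrow> real" where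
  "shift p q z = (if a = 0 then K * b * Im (q * cnj z) else 2 * K * b / a * Im (Ln (den p q z)))"

definition screw :: "complex \<Rightarrow> complex \<Rightarrow> real \<Rightarrow> point \<Rightarrow> point" where
  "screw p q s x = (fst x, mob p q (fst (snd x)), snd (snd x) + shift p q (fst (snd x)) + s)"

text \<open>A positive real part keeps \<open>den\<close> off the branch cut of Ln. The condition is
  stable under inversion, because \<open>den\<close> of the inverse at the image point is a positive
  multiple of 1/den.\<close>

definition screw_dom :: "complex \<Rightarrow> complex \<Rightarrow> point set" where
  "screw_dom p q = {x \<in> M. Re (den p q (fst (snd x))) > 0}"

lemma Im_of_real_mult: "Im (of_real s * z) = s * Im z"
  by simp

lemma mult_cnj_cmod: "z * cnj z = of_real ((cmod z)\<^sup>2)"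
  by (metis complex_norm_square)

lemma mob_mult_den: "den p q z \<noteq> 0 \<Longrightarrow> mob p q z * den p q z = p * z + q"
  by (simp add: mob_def)

lemma mob_det_eq: "complex_of_real (mob_det p q) = p * cnj p + of_real (a / 2) * q * cnj q"
  by (simp add: mob_det_def mult_cnj_cmod mult.assoc flip: of_real_power)

lemma mob_det_inverse: "mob_det (cnj p) (- q) = mob_det p q"
  by (simp add: mob_det_def)

lemma conformal_eq: "complex_of_real (1 + a / 2 * (z \<bullet> z)) = 1 + of_real (a / 2) * z * cnj z"
  by (simp add: mult_cnj_cmod dot_square_norm mult.assoc)

text \<open>The matrix of (cnj p, -q) is the adjugate of that of (p, q); the product is the scalar
  \<open>mob_det\<close>, and denominators multiply along compositions.\<close>

lemma den_mob:
  assumes "den p q z \<noteq> 0"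
  shows "den (cnj p) (- q) (mob p q z) = of_real (mob_det p q) / den p q z"
proof -
  have "den (cnj p) (- q) (mob p q z) = (p * den p q z + of_real (a / 2) * cnj q * (p * z + q)) / den p q z"
    using assms by (simp add: den_def[of "cnj p"] eq_divide_eq distrib_right mob_mult_den[symmetric] mult.assoc)
  also have "p * den p q z + of_real (a / 2) * cnj q * (p * z + q) = of_real (mob_det p q)"
    unfolding mob_det_eq den_def by (simp add: algebra_simps)
  finally show ?thesis .
qed

lemma mob_inverse:
  assumes "den p q z \<noteq> 0" "mob_det p q \<noteq> 0"
  shows "mob (cnj p) (- q) (mob p q z) = z"
proof -
  have "cnj p * mob p q z - q = (cnj p * (p * z + q) - q * den p q z) / den p q z"
    using assms(1) by (simp add: mob_def diff_divide_distrib)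
  also have "cnj p * (p * z + q) - q * den p q z = of_real (mob_det p q) * z"
    unfolding mob_det_eq den_def by (simp add: algebra_simps)
  finally show ?thesis
    using assms by (simp add: mob_def[of "cnj p"] den_mob)
qed

text \<open>The matrix scales the Hermitian form |w|^2 + a/2 |z|^2 by \<open>mob_det\<close>; this
  is that fact in the affine coordinate.\<close>

lemma mob_conformal:
  assumes "den p q z \<noteq> 0"
  shows "1 + a / 2 * (mob p q z \<bullet> mob p q z) = mob_det p q * (1 + a / 2 * (z \<bullet> z)) / (cmod (den p q z))\<^sup>2"
proof -
  have "complex_of_real (1 + a / 2 * (mob p q z \<bullet> mob p q z))
     = (den p q z * cnj (den p q z) + of_real (a / 2) * (p * z + q) * cnj (p * z + q)) / (den p q z * cnj (den p q z))"
    using assms unfolding conformal_eq mob_mult_den[OF assms, symmetric]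
    by (simp add: field_simps)
  also have "den p q z * cnj (den p q z) + of_real (a / 2) * (p * z + q) * cnj (p * z + q)
     = of_real (mob_det p q) * of_real (1 + a / 2 * (z \<bullet> z))"
    unfolding mob_det_eq conformal_eq den_def by (simp add: algebra_simps)
  also have "\<dots> / (den p q z * cnj (den p q z)) = of_real (mob_det p q * (1 + a / 2 * (z \<bullet> z)) / (cmod (den p q z))\<^sup>2)"
    by (simp add: mult_cnj_cmod)
  finally show ?thesis by (simp only: of_real_eq_iff)
qed

text \<open>By \<open>den_mob\<close> the denominators of a map and its inverse have opposite
  arguments. The logarithm is additive here because one factor is a positive real and
  \<open>den\<close> avoids the cut.\<close>

lemma shift_inverse:
  assumes "Re (den p q z) > 0" "mob_det p q > 0" "a = 0 \<Longrightarrow> p = 1"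
  shows "shift (cnj p) (- q) (mob p q z) = - shift p q z"
proof (cases "a = 0")
  case True
  then have "mob p q z = z + q"
    unfolding mob_def den_def using assms(3) by simp
  then show ?thesis
    unfolding shift_def using True by (simp add: algebra_simps)
next
  case False
  have nz: "den p q z \<noteq> 0" "den p q z \<notin> \<real>\<^sub>\<le>\<^sub>0"
    using assms(1) by (auto simp: complex_nonpos_Reals_iff)
  have "Ln (of_real (mob_det p q) / den p q z) = of_real (ln (mob_det p q)) + Ln (inverse (den p q z))"
    unfolding divide_inverse by (simp add: Ln_times_of_real Ln_of_real assms(2) nz)
  also have "\<dots> = of_real (ln (mob_det p q)) - Ln (den p q z)"
    by (simp add: Ln_inverse[OF nz(2)])
  finally have "Im (Ln (of_real (mob_det p q) / den p q z)) = - Im (Ln (den p q z))"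
    by simp
  then show ?thesis
    using False nz(1) by (simp add: shift_def den_mob)
qed

text \<open>\<open>den\<close> is affine in \<zeta> with slope -a/2 cnj q, so the factor 2/a in
  front of the logarithm cancels. The resulting formula is uniform in \<open>a\<close> and agrees
  with the linear shift used for a = 0.\<close>

lemma shift_has_derivative:
  assumes "Re (den p q z) > 0" "a = 0 \<Longrightarrow> p = 1"
  shows "(shift p q has_derivative (\<lambda>v. - K * b * Im (cnj q * v / den p q z))) (at z)"
proof (cases "a = 0")
  case True
  then have "den p q z = 1" unfolding den_def using assms(2) by simp
  moreover have "((\<lambda>z. K * b * Im (q * cnj z)) has_derivative (\<lambda>v. - K * b * Im (cnj q * v))) (at z)"
    by (rule has_derivative_eq_rhs, (rule derivative_intros)+) (simp add: fun_eq_iff algebra_simps)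
  ultimately show ?thesis
    unfolding shift_def[abs_def] using True by simp
next
  case False
  have nz: "den p q z \<noteq> 0" "den p q z \<notin> \<real>\<^sub>\<le>\<^sub>0"
    using assms(1) by (auto simp: complex_nonpos_Reals_iff)
  have "(den p q has_derivative (\<lambda>v. - of_real (a / 2) * cnj q * v)) (at z)"
    unfolding den_def by (rule has_derivative_eq_rhs, (rule derivative_intros)+) (simp add: fun_eq_iff)
  from has_derivative_compose[OF this, of Ln "\<lambda>v. inverse (den p q z) * v"] has_field_derivative_Ln[OF nz(2)]
  have "((\<lambda>z. Ln (den p q z)) has_derivative (\<lambda>v. inverse (den p q z) * (- of_real (a / 2) * cnj q * v))) (at z)"
    by (simp add: has_field_derivative_def)
  then have "((\<lambda>z. 2 * K * b / a * Im (Ln (den p q z))) has_derivative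
     (\<lambda>v. 2 * K * b / a * Im (inverse (den p q z) * (- of_real (a / 2) * cnj q * v)))) (at z)"
    by (intro has_derivative_mult_right has_derivative_Im)
  moreover have "inverse (den p q z) * (- of_real (a / 2) * cnj q * v) = of_real (- (a / 2)) * (cnj q * v / den p q z)" for v
    by (simp add: field_simps)
  then have "2 * K * b / a * Im (inverse (den p q z) * (- of_real (a / 2) * cnj q * v)) = - K * b * Im (cnj q * v / den p q z)" for v
    using False by (simp only: Im_of_real_mult) simp
  ultimately show ?thesis
    using False by (simp add: shift_def[abs_def])
qed

lemma mob_has_derivative:
  assumes "den p q z \<noteq> 0"
  shows "(mob p q has_derivative (\<lambda>v. of_real (mob_det p q) / (den p q z)\<^sup>2 * v)) (at z)"
proof -
  have "(den p q has_field_derivative - of_real (a / 2) * cnj q) (at z)"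
    unfolding den_def by (auto intro!: derivative_eq_intros)
  moreover have "((\<lambda>z. p * z + q) has_field_derivative p) (at z)"
    by (auto intro!: derivative_eq_intros)
  ultimately have "(mob p q has_field_derivative
      (p * den p q z - (p * z + q) * (- of_real (a / 2) * cnj q)) / (den p q z * den p q z)) (at z)"
    unfolding mob_def using assms by (intro DERIV_divide)
  also have "p * den p q z - (p * z + q) * (- of_real (a / 2) * cnj q) = of_real (mob_det p q)"
    unfolding mob_det_eq den_def by (simp add: algebra_simps)
  finally show ?thesis
    unfolding has_field_derivative_def power2_eq_square .
qed

section \<open>Screws as local isometries\<close>

lemma screw_dom_open: "open (screw_dom p q)"
proof -
  have "screw_dom p q = M \<inter> {x. Re (den p q (fst (snd x))) > 0}"
    by (auto simp: screw_dom_def)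
  moreover have "open {x::point. Re (den p q (fst (snd x))) > 0}"
    unfolding den_def by (intro open_Collect_less continuous_intros)
  ultimately show ?thesis using open_M by auto
qed

lemma screw_dom_den: "x \<in> screw_dom p q \<Longrightarrow> den p q (fst (snd x)) \<noteq> 0"
  by (auto simp: screw_dom_def)

lemma screw_mem:
  assumes "x \<in> screw_dom p q" "mob_det p q > 0"
  shows "screw p q s x \<in> screw_dom (cnj p) (- q)"
proof -
  obtain r z t where x: "x = (r, z, t)" by (cases x)
  have *: "pt_ok r" "1 + a / 2 * (z \<bullet> z) > 0" "Re (den p q z) > 0"
    using assms(1) by (auto simp: screw_dom_def mem_M x)
  then have nz: "den p q z \<noteq> 0" by auto
  have "1 + a / 2 * (mob p q z \<bullet> mob p q z) > 0"
    unfolding mob_conformal[OF nz] using * assms(2) nz by (intro divide_pos_pos mult_pos_pos) auto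
  moreover have "Re (of_real (mob_det p q) / den p q z) > 0"
    using *(3) assms(2) nz by (simp add: Re_divide zero_less_divide_iff sum_power2_gt_zero_iff complex_eq_iff)
  ultimately show ?thesis
    using *(1) by (simp add: screw_dom_def screw_def x mem_M den_mob[OF nz])
qed

lemma screw_inverse:
  assumes "x \<in> screw_dom p q" "mob_det p q > 0" "a = 0 \<Longrightarrow> p = 1"
  shows "screw (cnj p) (- q) (- s) (screw p q s x) = x"
proof -
  have "Re (den p q (fst (snd x))) > 0" using assms(1) by (simp add: screw_dom_def)
  then show ?thesis
    using assms(2,3) screw_dom_den[OF assms(1)]
    by (simp add: screw_def mob_inverse shift_inverse)
qed

lemma screw_smooth:
  assumes "a = 0 \<Longrightarrow> p = 1"
  shows "smooth_on (screw_dom p q) (screw p q s)"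
proof -
  let ?U = "screw_dom p q"
  note U = screw_dom_open[of p q]
  note id = smooth_on_ident[OF U]
  have r: "smooth_on ?U (\<lambda>x. fst x)" and z: "smooth_on ?U (\<lambda>x. fst (snd x))"
    and t: "smooth_on ?U (\<lambda>x. snd (snd x))"
    by (rule smooth_on_bounded_linear[OF _ U id]; simp add: bounded_linear_fst bounded_linear_snd
        bounded_linear_fst_comp bounded_linear_snd_comp)+
  have cmul: "smooth_on ?U (\<lambda>x. k * fst (snd x))" for k
    by (rule smooth_on_mult[OF U smooth_on_const[OF U] z])
  have den: "smooth_on ?U (\<lambda>x. den p q (fst (snd x)))"
    using smooth_on_add[OF U smooth_on_const[OF U] cmul, of "cnj p" "- (of_real (a / 2) * cnj q)"]
    by (simp add: den_def)
  have mob: "smooth_on ?U (\<lambda>x. mob p q (fst (snd x)))"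
    unfolding mob_def divide_inverse
    by (intro smooth_on_mult smooth_on_add smooth_on_inverse U cmul smooth_on_const den screw_dom_den)
  have shift: "smooth_on ?U (\<lambda>x. shift p q (fst (snd x)))"
  proof (cases "a = 0")
    case True
    have "bounded_linear (\<lambda>z. K * b * Im (q * cnj z))"
      unfolding linear_conv_bounded_linear[symmetric] by (rule linearI) (simp_all add: algebra_simps)
    from smooth_on_bounded_linear[OF this U z] True show ?thesis
      unfolding shift_def by simp
  next
    case False
    have Ln: "smooth_on ?U (\<lambda>x. Ln (den p q (fst (snd x))))"
      by (rule smooth_on_Ln[OF U den]) (auto simp: screw_dom_def complex_nonpos_Reals_iff)
    have "bounded_linear (\<lambda>z. 2 * K * b / a * Im z)"
      unfolding linear_conv_bounded_linear[symmetric] by (rule linearI) (simp_all add: algebra_simps add_divide_distrib)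
    from smooth_on_bounded_linear[OF this U Ln] False show ?thesis
      unfolding shift_def by simp
  qed
  show ?thesis
    unfolding screw_def
    by (intro smooth_on_Pair smooth_on_add U r mob t shift smooth_on_const)
qed

lemma screw_has_derivative:
  assumes "x \<in> screw_dom p q" "a = 0 \<Longrightarrow> p = 1"
  defines "d \<equiv> den p q (fst (snd x))"
  shows "(screw p q s has_derivative (\<lambda>v. (fst v, of_real (mob_det p q) / d\<^sup>2 * fst (snd v),
     snd (snd v) - K * b * Im (cnj q * fst (snd v) / d)))) (at x)"
proof -
  have d: "Re (den p q (fst (snd x))) > 0" using assms(1) by (simp add: screw_dom_def)
  have z: "((\<lambda>x::point. fst (snd x)) has_derivative (\<lambda>v. fst (snd v))) (at x)"
    by (intro derivative_intros)
  note mob = has_derivative_compose[OF z mob_has_derivative[OF screw_dom_den[OF assms(1)]]]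
  note shift = has_derivative_compose[OF z shift_has_derivative[OF d]]
  show ?thesis
    unfolding screw_def d_def
    by (rule has_derivative_eq_rhs[OF has_derivative_Pair[OF has_derivative_fst[OF has_derivative_ident]
          has_derivative_Pair[OF mob has_derivative_add[OF has_derivative_add[OF
            has_derivative_snd[OF has_derivative_snd[OF has_derivative_ident]] shift] has_derivative_const]]]])
       (rule assms(2), assumption, rule ext, simp)
qed

text \<open>Gauge invariance of the connection form: pulling back its \<zeta>-part by
  \<open>mob\<close> changes it by an exact form, which the derivative of the shift cancels.\<close>

lemma screw_form:
  assumes x: "x \<in> screw_dom p q" and det: "mob_det p q > 0"
  defines "d \<equiv> den p q (fst (snd x))"
  shows "\<eta> (screw p q s x) (fst v, of_real (mob_det p q) / d\<^sup>2 * fst (snd v),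
     snd (snd v) - K * b * Im (cnj q * fst (snd v) / d)) = \<eta> x v"
proof -
  obtain r z t where x': "x = (r, z, t)" by (cases x)
  obtain r' v' t' where v: "v = (r', v', t')" by (cases v)
  have d: "d = den p q z" by (simp add: d_def x')
  have nz: "den p q z \<noteq> 0" using screw_dom_den[OF x] by (simp add: x')
  have pos: "1 + a / 2 * (z \<bullet> z) > 0" using x by (auto simp: screw_dom_def mem_M x')
  have mm: "m (mob p q z) = m z * (cmod d)\<^sup>2 / mob_det p q"
    unfolding m_def mob_conformal[OF nz] d by simp
  have m1: "of_real (m z) * (1 + of_real (a / 2) * z * cnj z) = (1::complex)"
    using pos unfolding conformal_eq[symmetric] m_def of_real_mult[symmetric] by simp
  \<comment> \<open>The whole claim reduces to this identity, obtained by writing the last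
    \<open>q\<close> as q times 1 = m (1 + a/2 |z|^2).\<close>
  have "of_real (m z) * (p * z + q) - q
      = of_real (m z) * (p * z + q) - q * (of_real (m z) * (1 + of_real (a / 2) * z * cnj z))"
    unfolding m1 by simp
  also have "\<dots> = of_real (m z) * z * cnj d"
    by (simp add: d den_def algebra_simps)
  finally have key: "of_real (m z) * (p * z + q) - q = of_real (m z) * z * cnj d" .
  have dd: "of_real ((cmod d)\<^sup>2) = d * cnj d" by (simp add: mult_cnj_cmod)
  have "of_real (m (mob p q z)) * (mob p q z * cnj (of_real (mob_det p q) / d\<^sup>2 * v'))
      = of_real (m z) * (p * z + q) * cnj v' / cnj d"
    using nz det unfolding mm of_real_divide of_real_mult dd unfolding mob_def
    by (simp add: d[symmetric] field_simps power2_eq_square)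
  then have "of_real (m (mob p q z)) * (mob p q z * cnj (of_real (mob_det p q) / d\<^sup>2 * v')) - cnj (cnj q * v' / d)
      = (of_real (m z) * (p * z + q) - q) * cnj v' / cnj d"
    by (simp add: left_diff_distrib diff_divide_distrib)
  also have "\<dots> = of_real (m z) * (z * cnj v')"
    unfolding key using nz by (simp add: d)
  finally have "Im (of_real (m (mob p q z)) * (mob p q z * cnj (of_real (mob_det p q) / d\<^sup>2 * v')) - cnj (cnj q * v' / d))
      = Im (of_real (m z) * (z * cnj v'))"
    by simp
  then have main: "m (mob p q z) * Im (mob p q z * cnj (of_real (mob_det p q) / d\<^sup>2 * v')) + Im (cnj q * v' / d)
      = m z * Im (z * cnj v')"
    by (simp only: minus_complex.sel Im_of_real_mult complex_cnj diff_minus_eq_add cnj.sel)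
  have "\<eta> (screw p q s x) (fst v, of_real (mob_det p q) / d\<^sup>2 * fst (snd v),
     snd (snd v) - K * b * Im (cnj q * fst (snd v) / d))
     = - t' / K + b * (m (mob p q z) * Im (mob p q z * cnj (of_real (mob_det p q) / d\<^sup>2 * v')) + Im (cnj q * v' / d))"
    using K by (simp only: screw_def x' v fst_conv snd_conv form_eq) (simp add: diff_divide_distrib distrib_left mult_ac)
  then show ?thesis
    unfolding main by (simp add: x' v form_eq mult_ac)
qed

lemma screw_isometric:
  assumes x: "x \<in> screw_dom p q" and det: "mob_det p q > 0"
  defines "d \<equiv> den p q (fst (snd x))"
  defines "E \<equiv> \<lambda>v::point. (fst v, of_real (mob_det p q) / d\<^sup>2 * fst (snd v),
     snd (snd v) - K * b * Im (cnj q * fst (snd v) / d))"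
  shows "g (screw p q s x) (E u) (E v) = g x u v"
proof -
  obtain r z t where x': "x = (r, z, t)" by (cases x)
  have d: "d = den p q z" by (simp add: d_def x')
  have nz: "den p q z \<noteq> 0" using screw_dom_den[OF x] by (simp add: x')
  have mm: "m (mob p q z) = m z * (cmod d)\<^sup>2 / mob_det p q"
    unfolding m_def mob_conformal[OF nz] d by simp
  have form: "\<eta> (screw p q s x) (E v) = \<eta> x v" for v
    using screw_form[OF x det] by (simp add: E_def d_def)
  have inner: "(k * u) \<bullet> (k * v) = (cmod k)\<^sup>2 * (u \<bullet> v)" for k u v :: complex
    unfolding cmod_power2 by (simp add: inner_complex_def power2_eq_square algebra_simps)
  have "(m (mob p q z))\<^sup>2 * (cmod (of_real (mob_det p q) / d\<^sup>2))\<^sup>2 = (m z)\<^sup>2"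
    using nz det unfolding mm d by (simp add: norm_divide norm_power norm_mult field_simps power2_eq_square)
  then have "(m (mob p q z))\<^sup>2 * (fst (snd (E u)) \<bullet> fst (snd (E v))) = (m z)\<^sup>2 * (fst (snd u) \<bullet> fst (snd v))"
    unfolding E_def fst_conv snd_conv inner by (simp flip: mult.assoc)
  moreover have "fst (E w) = fst w" for w by (simp add: E_def)
  moreover have "g (screw p q s x) y y' = F r * (fst y * fst y') + G r * ((m (mob p q z))\<^sup>2 * (fst (snd y) \<bullet> fst (snd y')))
     + H r * (\<eta> (screw p q s x) y * \<eta> (screw p q s x) y')" for y y'
    by (simp add: screw_def x' metric_eq mult.assoc)
  ultimately show ?thesis
    using form by (simp add: x' metric_eq mult.assoc)
qed

lemma screw_local_isometry:
  assumes det: "mob_det p q > 0" and p: "a = 0 \<Longrightarrow> p = 1"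
  shows "local_isometry M g (screw_dom p q) (screw p q s)"
proof -
  let ?U = "screw_dom p q" and ?V = "screw_dom (cnj p) (- q)"
  let ?\<phi> = "screw p q s" and ?\<psi> = "screw (cnj p) (- q) (- s)"
  have det': "mob_det (cnj p) (- q) > 0" using det by (simp add: mob_det_inverse)
  have p': "a = 0 \<Longrightarrow> cnj p = 1" using p by simp
  have \<psi>\<phi>: "?\<psi> (?\<phi> x) = x" if "x \<in> ?U" for x
    by (rule screw_inverse[OF that det p])
  have \<phi>\<psi>: "?\<phi> (?\<psi> y) = y" if "y \<in> ?V" for y
    using screw_inverse[OF that det' p', of "- s"] by simp
  have \<phi>V: "?\<phi> x \<in> ?V" if "x \<in> ?U" for x
    by (rule screw_mem[OF that det])
  have \<psi>U: "?\<psi> y \<in> ?U" if "y \<in> ?V" for y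
    using screw_mem[OF that det', of "- s"] by simp
  have im: "?\<phi> ` ?U = ?V"
    using \<phi>V \<psi>U \<phi>\<psi> by (metis image_subsetI imageI subsetI subset_antisym)
  have inj: "inj_on ?\<phi> ?U"
    using \<psi>\<phi> by (rule inj_on_inverseI)
  have inv: "the_inv_into ?U ?\<phi> y = ?\<psi> y" if "y \<in> ?V" for y
    by (rule the_inv_into_f_eq[OF inj \<phi>\<psi>[OF that] \<psi>U[OF that]])
  have "smooth_on ?V (the_inv_into ?U ?\<phi>)"
    using screw_smooth[of "cnj p" "- q" "- s"] p' smooth_on_cong[of ?V "the_inv_into ?U ?\<phi>" ?\<psi>]
      screw_dom_open inv by blast
  moreover have "frechet_derivative ?\<phi> (at x) v = (fst v, of_real (mob_det p q) / (den p q (fst (snd x)))\<^sup>2 * fst (snd v),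
     snd (snd v) - K * b * Im (cnj q * fst (snd v) / den p q (fst (snd x))))" if "x \<in> ?U" for x v
    using frechet_derivative_eqI[OF screw_has_derivative[OF that p]] by simp
  ultimately show ?thesis
    unfolding local_isometry_def im
    using screw_dom_open inj screw_smooth[OF p] screw_isometric[OF _ det]
    by (auto simp: screw_dom_def)
qed

text \<open>The differential commutes with \<open>J\<close> because a screw preserves \<rho> and
  \<eta> and is complex linear on d\<zeta>.\<close>

lemma level_transitive:
  assumes x: "x \<in> M" and y: "y \<in> M" and r: "fst x = fst y"
  obtains U \<phi> where "local_isometry M g U \<phi>" "x \<in> U" "\<phi> x = y"
    "\<And>u. fst (frechet_derivative \<phi> (at x) u) = fst u"
    "\<And>u. frechet_derivative \<phi> (at x) (J x u) = J y (frechet_derivative \<phi> (at x) u)"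
proof -
  obtain r z0 t0 where x': "x = (r, z0, t0)" by (cases x)
  obtain z1 t1 where y': "y = (r, z1, t1)" using r x' by (cases y) simp
  \<comment> \<open>\<open>p\<close> and \<open>q\<close> are the top row of the matrix product for
    the map sending \<open>z0\<close> to 0 followed by the map sending 0 to \<open>z1\<close>.
    Consequently \<open>mob_det\<close> is the product of the two conformal factors, and
    \<open>den\<close> at \<open>z0\<close> is real and positive, away from the branch cut.\<close>
  define p where "p = 1 + of_real (a / 2) * z1 * cnj z0"
  define q where "q = z1 - z0"
  have "complex_of_real (mob_det p q) = of_real ((1 + a / 2 * (z0 \<bullet> z0)) * (1 + a / 2 * (z1 \<bullet> z1)))"
    unfolding mob_det_eq of_real_mult conformal_eq p_def q_def by (simp add: algebra_simps del: of_real_divide)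
  then have "mob_det p q = (1 + a / 2 * (z0 \<bullet> z0)) * (1 + a / 2 * (z1 \<bullet> z1))"
    by (simp only: of_real_eq_iff)
  then have det: "mob_det p q > 0"
    using x y by (simp add: x' y' mem_M)
  have p: "a = 0 \<Longrightarrow> p = 1" by (simp add: p_def)
  have den: "den p q z0 = of_real (1 + a / 2 * (z0 \<bullet> z0))"
    unfolding conformal_eq den_def p_def q_def by (simp add: algebra_simps del: of_real_divide)
  have pos: "1 + a / 2 * (z0 \<bullet> z0) > 0" using x by (simp add: x' mem_M)
  have xU: "x \<in> screw_dom p q"
    using x pos by (simp add: screw_dom_def x' den)
  have "p * z0 + q = z1 * den p q z0"
    unfolding den conformal_eq unfolding p_def q_def by (simp add: algebra_simps del: of_real_divide)
  then have mob: "mob p q z0 = z1"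
    using pos unfolding mob_def by (simp add: den del: of_real_add of_real_mult)
  define s where "s = t1 - t0 - shift p q z0"
  have \<phi>x: "screw p q s x = y"
    by (simp add: screw_def x' y' mob s_def)
  let ?d = "den p q (fst (snd x))"
  have D: "frechet_derivative (screw p q s) (at x) v = (fst v, of_real (mob_det p q) / ?d\<^sup>2 * fst (snd v),
     snd (snd v) - K * b * Im (cnj q * fst (snd v) / ?d))" for v
    using frechet_derivative_eqI[OF screw_has_derivative[OF xU p]] by simp
  have form: "\<eta> y (frechet_derivative (screw p q s) (at x) v) = \<eta> x v" for v
    using screw_form[OF xU det, of s v] by (simp add: D \<phi>x)
  have "frechet_derivative (screw p q s) (at x) (J x u) = J y (frechet_derivative (screw p q s) (at x) u)" for u
  proof (rule tangent_eqI[where p = y])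
    show "fst (frechet_derivative (screw p q s) (at x) (J x u)) = fst (J y (frechet_derivative (screw p q s) (at x) u))"
      unfolding J_simps form by (simp add: D J_simps r)
    show "fst (snd (frechet_derivative (screw p q s) (at x) (J x u))) = fst (snd (J y (frechet_derivative (screw p q s) (at x) u)))"
      unfolding J_simps by (simp add: D J_simps)
    show "\<eta> y (frechet_derivative (screw p q s) (at x) (J x u)) = \<eta> y (J y (frechet_derivative (screw p q s) (at x) u))"
      unfolding form form_J by (simp add: D r)
  qed
  moreover have "fst (frechet_derivative (screw p q s) (at x) u) = fst u" for u
    by (simp add: D)
  ultimately show ?thesis
    using that screw_local_isometry[OF det p] xU \<phi>x by blast
qed

text \<open>An isometry moves the point to \<zeta> = 0 along its level set. \<open>A\<close> and
  \<open>B\<close> depend on \<rho> only, and the differential respects the metric and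
  \<open>J\<close>, so the formula on the axis pulls back unchanged.\<close>

lemma riemann_formula:
  assumes x: "x \<in> M"
  shows "riemann g x u v w = model_curvature x u v w"
proof -
  obtain r z t where x': "x = (r, z, t)" by (cases x)
  have ok: "pt_ok r" using x by (simp add: x' mem_M)
  then have y: "(r, 0, t) \<in> M" by (simp add: mem_M)
  obtain U \<phi> where iso: "local_isometry M g U \<phi>" and xU: "x \<in> U" and \<phi>x: "\<phi> x = (r, 0, t)"
    and J: "\<And>u. frechet_derivative \<phi> (at x) (J x u) = J (r, 0, t) (frechet_derivative \<phi> (at x) u)"
    by (rule level_transitive[OF x y]) (auto simp: x')
  let ?D = "frechet_derivative \<phi> (at x)"
  note lin = linear_D\<phi>[OF iso xU]
  have iso': "g (r, 0, t) (?D u) (?D v) = g x u v" for u v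
    using isometric[OF iso xU] by (simp add: \<phi>x)
  have "?D (riemann g x u v w) = model_curvature (r, 0, t) (?D u) (?D v) (?D w)"
    using riemann_natural[OF iso xU, of u v w] by (simp add: \<phi>x riemann_axis[OF ok])
  also have "\<dots> = ?D (model_curvature x u v w)"
    unfolding model_curvature_def linear_add[OF lin] linear_diff[OF lin] linear_scale[OF lin] J[symmetric] iso'
    by (simp add: x')
  finally have "?D (riemann g x u v w - model_curvature x u v w) = 0"
    by (simp add: linear_diff[OF lin])
  from D\<phi>_eq_0[OF iso xU this] show ?thesis by simp
qed

subsection \<open>Local symmetry and cohomogeneity\<close>

lemma J_has_derivative:
  assumes "(r, z, t) \<in> M"
  shows "((\<lambda>q. J q u) has_derivative (\<lambda>w.
     (- (Q r / D r * (\<gamma> r - \<alpha> r) * fst w * \<eta> (r, z, t) u + Q r / D r * d\<eta> z (fst (snd w)) (fst (snd u))), 0,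
      - K * (D r / Q r * (\<alpha> r - \<gamma> r) * fst w * fst u - d\<eta> z (fst (snd w)) (\<i> * fst (snd u)))))) (at (r, z, t))"
proof -
  have ok: "pt_ok r" "1 + a / 2 * (z \<bullet> z) > 0" using assms by (simp_all add: mem_M)
  note p = pt_okD[OF ok(1)]
  note nz = p(1)[THEN less_imp_neq, symmetric] p(2)[THEN less_imp_neq, symmetric] p(4)
  have dD: "(D has_real_derivative b) (at r)"
    unfolding D_def by (auto intro!: derivative_eq_intros)
  have dQ: "(Q has_real_derivative 2 * a * r + b) (at r)"
    unfolding Q_def by (auto intro!: derivative_eq_intros)
  have "((\<lambda>r. Q r / D r) has_real_derivative ((2 * a * r + b) * D r - Q r * b) / (D r * D r)) (at r)"
    by (rule DERIV_divide[OF dQ dD nz(3)])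
  also have "((2 * a * r + b) * D r - Q r * b) / (D r * D r) = Q r / D r * (\<gamma> r - \<alpha> r)"
    unfolding \<gamma>_def \<alpha>_def using nz by (simp add: divide_simps) algebra
  finally have x: "((\<lambda>r. Q r / D r) has_real_derivative Q r / D r * (\<gamma> r - \<alpha> r)) (at r)" .
  have "((\<lambda>r. D r / Q r) has_real_derivative (b * Q r - D r * (2 * a * r + b)) / (Q r * Q r)) (at r)"
    by (rule DERIV_divide[OF dD dQ nz(2)])
  also have "(b * Q r - D r * (2 * a * r + b)) / (Q r * Q r) = D r / Q r * (\<alpha> r - \<gamma> r)"
    unfolding \<gamma>_def \<alpha>_def using nz by (simp add: divide_simps) algebra
  finally have y: "((\<lambda>r. D r / Q r) has_real_derivative D r / Q r * (\<alpha> r - \<gamma> r)) (at r)" .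
  have conn: "((\<lambda>p::point. b * (m (fst (snd p)) * Im (fst (snd p) * cnj v))) has_derivative
      (\<lambda>w. d\<eta> z (fst (snd w)) v)) (at (r, z, t))" for v
    by (rule has_derivative_eq_rhs, (rule derivative_intros m_has_derivative_pt[OF ok(2)])+)
       (simp add: fun_eq_iff d\<eta>_def algebra_simps)
  show ?thesis
    unfolding J_def
    by (rule has_derivative_eq_rhs, (rule derivative_intros profile_pt[OF x] profile_pt[OF y] conn
          form_has_derivative[OF ok(2)])+)
       (simp add: fun_eq_iff algebra_simps)
qed

lemma \<Gamma>_simps: "fst (\<Gamma> p u v) = \<Gamma>r p u v" "fst (snd (\<Gamma> p u v)) = \<Gamma>z p u v"
  by (simp_all add: \<Gamma>_def)

text \<open>For c = 0 the function \<open>D\<close> is b\<rho>, hence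
  \<open>\<beta> = - h * D/Q\<close> and \<open>\<mu> = - b * Q/D\<close>. These equations and
  \<open>\<nu> = \<gamma> * (Q/D)\<^sup>2\<close> cancel the covariant derivative of
  \<open>J\<close> in all three components, so the metric is Kaehler.\<close>

lemma J_parallel:
  assumes c: "c = 0" and p: "p \<in> M"
  shows "((\<lambda>q. J q u) has_derivative (\<lambda>w. J p (\<Gamma> p w u) - \<Gamma> p w (J p u))) (at p)"
proof -
  obtain r z t where p': "p = (r, z, t)" by (cases p)
  have ok: "pt_ok r" "1 + a / 2 * (z \<bullet> z) > 0" using p by (simp_all add: mem_M p')
  define x where "x = Q r / D r"
  define y where "y = D r / Q r"
  note P = pt_okD[OF ok(1)]
  have xy: "x * y = 1" using P by (simp add: x_def y_def)
  have D: "D r = b * r" unfolding D_def using c by simp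
  then have b: "b \<noteq> 0" using P by auto
  have \<beta>: "\<beta> r = - 1 / (2 * r)"
    using P b by (simp add: \<beta>_def D field_simps)
  have h: "h r = x / (2 * r)"
    using P b by (simp add: h_def x_def D field_simps power2_eq_square)
  have \<mu>: "\<mu> r = - b * x"
    using P b by (simp add: \<mu>_def \<beta> x_def D field_simps)
  have \<nu>: "\<nu> r = \<gamma> r * x\<^sup>2"
    by (simp add: \<nu>_def x_def)
  have \<beta>h: "\<beta> r = - h r * y" "h r = - \<beta> r * x"
    unfolding h \<beta> using xy by simp_all
  have d\<eta>: "d\<eta> z w v = a * b / 2 * ((m z)\<^sup>2 * Im (cnj z * cnj z * (w * v))) - b * (m z)\<^sup>2 * ((\<i> * w) \<bullet> v)" for w v
    using d\<eta>_antisym[OF ok(2), of w v] d\<eta>_sym[of z w v] by (simp add: power2_eq_square mult.assoc)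
  have p_simps: "fst p = r" "fst (snd p) = z" by (simp_all add: p')
  have "(- (Q r / D r * (\<gamma> r - \<alpha> r) * fst w * \<eta> (r, z, t) u + Q r / D r * d\<eta> z (fst (snd w)) (fst (snd u))), 0,
      - K * (D r / Q r * (\<alpha> r - \<gamma> r) * fst w * fst u - d\<eta> z (fst (snd w)) (\<i> * fst (snd u))))
      = J p (\<Gamma> p w u) - \<Gamma> p w (J p u)" (is "?L = ?R") for w
  proof (rule tangent_eqI[where p = p])
    have x\<nu>: "y * \<nu> r = x * \<gamma> r"
      using xy unfolding \<nu> power2_eq_square by (metis mult.assoc mult.commute mult.left_neutral)
    have "fst ?R = - (x * \<Gamma>e p w u) - \<Gamma>r p w (J p u)"
      by (simp add: J_simps form_\<Gamma> \<Gamma>_simps p_simps x_def)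
    also have "\<dots> = fst ?L"
      unfolding \<Gamma>e_def \<Gamma>r_def p_simps J_simps form_J x_def[symmetric] y_def[symmetric] \<mu> d\<eta> fst_conv
      using x\<nu> by (simp add: p'[symmetric] inner_complex_def) algebra
    finally show "fst ?L = fst ?R" by simp
    have "fst (snd ?R) = \<i> * \<Gamma>z p w u - \<Gamma>z p w (J p u)"
      by (simp add: J_simps \<Gamma>_simps)
    also have "\<dots> = (\<beta> r + h r * y) *\<^sub>R (fst u *\<^sub>R (\<i> * fst (snd w))) + (h r + \<beta> r * x) *\<^sub>R (\<eta> p u *\<^sub>R fst (snd w))"
      unfolding \<Gamma>z_def p_simps J_simps form_J x_def[symmetric] y_def[symmetric]
      by (simp add: complex_eq_iff algebra_simps)
    also have "\<dots> = fst (snd ?L)"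
      using \<beta>h by simp
    finally show "fst (snd ?L) = fst (snd ?R)" by simp
    have cancel: "- (- K * s) / K = s" for s using K by simp
    have "\<eta> p ?R = y * \<Gamma>r p w u - \<Gamma>e p w (J p u)"
      by (simp add: form_diff form_J form_\<Gamma> \<Gamma>_simps p_simps y_def)
    also have "\<dots> = y * (\<alpha> r - \<gamma> r) * fst w * fst u - d\<eta> z (fst (snd w)) (\<i> * fst (snd u))"
      unfolding \<Gamma>e_def \<Gamma>r_def p_simps J_simps form_J x_def[symmetric] y_def[symmetric] \<mu> d\<eta>
      using x\<nu> xy by (simp add: inner_complex_def) algebra
    also have "\<dots> = \<eta> p ?L"
      by (simp only: p' form_eq cancel y_def) simp
    finally show "\<eta> p ?L = \<eta> p ?R" by simp
  qed
  with J_has_derivative[OF p[unfolded p'], of u] show ?thesis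
    by (simp add: p')
qed

lemma locally_symmetric_degenerate:
  assumes "b * c * (b\<^sup>2 - 4 * a * c) = 0"
  shows "locally_symmetric M g"
proof (cases "c = 0")
  case False
  then have B: "B r = 0" for r using assms by (simp add: B_def)
  show ?thesis
    unfolding locally_symmetric_def
  proof (intro ballI allI)
    fix p x u v w assume p: "p \<in> M"
    \<comment> \<open>Constant curvature 2/K: the coefficient of the \<open>J\<close>-terms is 0, so
      the zero map may stand in for \<open>J\<close> and is trivially parallel.\<close>
    show "nabla_riemann g p x u v w = 0"
      by (rule nabla_riemann_eq_0[where A = "2 / K" and B = 0 and J = "\<lambda>_ _. 0"])
         (auto simp: riemann_formula model_curvature_def A_def B p linear_zero bilinear_rzero[OF bilinear_christoffel])
  qed
next
  case True
  show ?thesis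
    unfolding locally_symmetric_def
  proof (intro ballI allI)
    fix p x u v w assume p: "p \<in> M"
    \<comment> \<open>Then \<open>A = B = 1/K\<close>, the curvature tensor of constant holomorphic
      sectional curvature 4/K.\<close>
    have B: "B (fst q) = 1 / K" if "q \<in> M" for q
    proof -
      have "pt_ok (fst q)" using that by (cases q) (simp add: mem_M)
      note P = pt_okD[OF this]
      have D: "D (fst q) = b * fst q" unfolding D_def using True by simp
      have "fst q \<noteq> 0" "b \<noteq> 0" using P(1,4) unfolding D by auto
      then show ?thesis
        unfolding B_def D using True K by (simp add: field_simps power2_eq_square power3_eq_cube)
    qed
    show "nabla_riemann g p x u v w = 0"
      by (rule nabla_riemann_eq_0[where A = "1 / K" and B = "1 / K" and J = J])
         (auto simp: riemann_formula model_curvature_def A_def B p linear_J intro: J_parallel[OF True])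
  qed
qed

section \<open>Recovering \<rho> from sectional curvatures\<close>

lemma cauchy_schwarz_g:
  assumes "p \<in> M"
  shows "(g p u v)\<^sup>2 \<le> g p u u * g p v v"
proof (cases "v = 0")
  case True
  then show ?thesis by (simp add: bilinear_rzero[OF bilinear_metric])
next
  case False
  define s where "s = g p u v / g p v v"
  have pos: "g p v v > 0" by (rule g_pos[OF assms False])
  have "0 \<le> g p (u - s *\<^sub>R v) (u - s *\<^sub>R v)"
    using g_pos[OF assms, of "u - s *\<^sub>R v"] bilinear_rzero[OF bilinear_metric] by (metis less_eq_real_def)
  also have "\<dots> = g p u u - 2 * s * g p u v + s\<^sup>2 * g p v v"
    using g_commute[of p v u]
    by (simp add: bilinear_lsub[OF bilinear_metric] bilinear_rsub[OF bilinear_metric] bilinear_lmul[OF bilinear_metric]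
        bilinear_rmul[OF bilinear_metric] power2_eq_square algebra_simps)
  also have "\<dots> = g p u u - (g p u v)\<^sup>2 / g p v v"
    using pos by (simp add: s_def power2_eq_square)
  finally show ?thesis using pos by (simp add: field_simps)
qed

lemma kaehler_form:
  assumes "p \<in> M"
  shows "g p (J p u) v = - g p (J p v) u" and "g p (J p u) (J p v) = g p u v"
proof -
  obtain r z t where p: "p = (r, z, t)" by (cases p)
  have ok: "pt_ok r" using assms by (simp add: mem_M p)
  note P = pt_okD[OF ok]
  have H: "H r = F r * (Q r / D r)\<^sup>2" by (rule pt_ok_relations(10)[OF ok])
  have g_eq: "g p x y = F r * (fst x * fst y) + G r * (m z)\<^sup>2 * (fst (snd x) \<bullet> fst (snd y))
     + F r * (Q r / D r)\<^sup>2 * (\<eta> p x * \<eta> p y)" for x y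
    by (simp add: p metric_eq H)
  define x where "x = Q r / D r"
  define y where "y = D r / Q r"
  have xy: "x * y = 1" using P by (simp add: x_def y_def)
  have fp: "fst p = r" by (simp add: p)
  show "g p (J p u) v = - g p (J p v) u"
    unfolding g_eq J_simps form_J fp x_def[symmetric] y_def[symmetric] inner_complex_def
    using xy by simp algebra
  show "g p (J p u) (J p v) = g p u v"
    unfolding g_eq J_simps form_J fp x_def[symmetric] y_def[symmetric] inner_complex_def
    using xy by simp algebra
qed

text \<open>A \<open>J\<close>-invariant plane at \<open>p\<close> has sectional curvature 2/K + 2
  B(p). Its image is a plane with some Kaehler angle, of curvature 2/K + B(q) (3 cos^2 - 1), and the
  bracket has absolute value at most 2. The map \<open>E\<close> is an arbitrary one preserving
  metric and curvature, so the lemma also applies to the inverse of a differential.\<close>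

lemma B_le:
  assumes p: "p \<in> M" and q: "q \<in> M"
    and E: "\<And>u v. g q (E u) (E v) = g p u v"
    and R: "\<And>u v w. E (riemann g p u v w) = riemann g q (E u) (E v) (E w)"
  shows "\<bar>B (fst p)\<bar> \<le> \<bar>B (fst q)\<bar>"
proof -
  have sec: "g x (riemann g x u v v) u = A (fst x) * (g x u u * g x v v - (g x u v)\<^sup>2)
      + 3 * B (fst x) * (g x (J x u) v)\<^sup>2" if "x \<in> M" for x u v
  proof -
    have "g x (J x v) v = 0" using kaehler_form(1)[OF that, of v v] by simp
    then show ?thesis
      unfolding riemann_formula[OF that] model_curvature_def
      using kaehler_form(1)[OF that, of v u] g_commute[of x v u]
      by (simp add: bilinear_ladd[OF bilinear_metric] bilinear_lsub[OF bilinear_metric] bilinear_lmul[OF bilinear_metric]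
          power2_eq_square algebra_simps)
  qed
  define u :: point where "u = (1, 0, 0)"
  define v where "v = J p u"
  define N where "N = g p u u"
  have N: "N > 0" unfolding N_def by (rule g_pos[OF p]) (simp add: u_def zero_prod_def)
  have uv: "g p v v = N" "g p (J p u) v = N" "g p u v = 0"
    using kaehler_form[OF p, of u u] g_commute[of p u v] by (simp_all add: v_def N_def)
  \<comment> \<open>\<open>\<theta> / N\<^sup>2\<close> is the squared cosine of the Kaehler angle
    of the image plane; Cauchy-Schwarz places it between 0 and 1.\<close>
  define \<theta> where "\<theta> = (g q (J q (E u)) (E v))\<^sup>2"
  have "\<theta> \<le> N * N"
    unfolding \<theta>_def using cauchy_schwarz_g[OF q, of "J q (E u)" "E v"]
    by (simp add: kaehler_form(2)[OF q] E uv N_def)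
  moreover have "\<theta> \<ge> 0" by (simp add: \<theta>_def)
  ultimately have \<theta>: "\<bar>3 * \<theta> - N * N\<bar> \<le> 2 * (N * N)" using N by (simp add: abs_le_iff)
  have "A (fst p) * (N * N) + 3 * B (fst p) * (N * N) = g p (riemann g p u v v) u"
    unfolding sec[OF p] uv by (simp add: N_def power2_eq_square)
  also have "\<dots> = g q (riemann g q (E u) (E v) (E v)) (E u)"
    by (simp add: E flip: R)
  also have "\<dots> = A (fst q) * (N * N) + 3 * B (fst q) * \<theta>"
    unfolding sec[OF q] E uv \<theta>_def by (simp add: N_def)
  finally have "2 * B (fst p) * (N * N) = B (fst q) * (3 * \<theta> - N * N)"
    by (simp add: A_def algebra_simps)
  then have "2 * \<bar>B (fst p)\<bar> * (N * N) = \<bar>B (fst q)\<bar> * \<bar>3 * \<theta> - N * N\<bar>"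
    by (metis abs_mult abs_numeral abs_mult_self_eq)
  also have "\<dots> \<le> \<bar>B (fst q)\<bar> * (2 * (N * N))"
    using \<theta> by (intro mult_left_mono) auto
  finally show ?thesis using N by simp
qed

text \<open>Up to a nonzero constant |B| is the cube of \<rho>/|K D|. As \<open>K * D\<close> is
  negative at both points, equality gives \<open>r * D r' = r' * D r\<close>; \<open>D\<close> being
  affine, the terms with \<open>b\<close> cancel and a multiple of \<open>c * (r - r')\<close>
  remains.\<close>

lemma B_injective:
  assumes nz: "b * c * (b\<^sup>2 - 4 * a * c) \<noteq> 0" and ok: "pt_ok r" "pt_ok r'" and eq: "\<bar>B r\<bar> = \<bar>B r'\<bar>"
  shows "r = r'"
proof -
  note P = pt_okD[OF ok(1)] and P' = pt_okD[OF ok(2)]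
  define e where "e = b * (b\<^sup>2 - 4 * a * c)"
  have e: "e \<noteq> 0" using nz by (auto simp: e_def)
  \<comment> \<open>The factor \<open>\<bar>K\<bar>\<^sup>2\<close> completes the cube, so that only
    \<open>K * D r\<close>, whose sign is known, appears inside.\<close>
  have abs: "\<bar>B r\<bar> = \<bar>e\<bar> * \<bar>K\<bar>\<^sup>2 * (r / \<bar>K * D r\<bar>) ^ 3" if "pt_ok r" for r
  proof -
    have "B r = e * r ^ 3 / (K * D r ^ 3)" by (simp add: B_def e_def)
    then have "\<bar>B r\<bar> = \<bar>e\<bar> * r ^ 3 / (\<bar>K\<bar> * \<bar>D r\<bar> ^ 3)"
      using pt_okD(1)[OF that] by (simp add: abs_mult power_abs)
    moreover have "x * r ^ 3 / (k * d ^ 3) = x * k\<^sup>2 * (r / (k * d)) ^ 3" if "k \<noteq> 0" "d \<noteq> 0" for x k d :: real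
      using that by (simp add: power_divide power_mult_distrib power2_eq_square power3_eq_cube mult_ac)
    from this[of "\<bar>K\<bar>" "\<bar>D r\<bar>"]
    have "x * r ^ 3 / (\<bar>K\<bar> * \<bar>D r\<bar> ^ 3) = x * \<bar>K\<bar>\<^sup>2 * (r / (\<bar>K\<bar> * \<bar>D r\<bar>)) ^ 3" for x
      using pt_okD(4)[OF that] K by simp
    ultimately show ?thesis by (simp only: abs_mult)
  qed
  have "(r / \<bar>K * D r\<bar>) ^ 3 = (r' / \<bar>K * D r'\<bar>) ^ 3"
    using eq K e unfolding abs[OF ok(1)] abs[OF ok(2)] by simp
  then have "r / \<bar>K * D r\<bar> = r' / \<bar>K * D r'\<bar>"
    by (rule power_eq_imp_eq_base) (use P(1) P'(1) in \<open>auto intro!: divide_nonneg_nonneg\<close>)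
  then have "r * (K * D r') = r' * (K * D r)"
    using P(3,4) P'(3,4) frac_eq_eq[of "K * D r" "K * D r'" r r'] K by (simp only: abs_of_neg) simp
  then have "K * c * (r - r') = 0"
    by (simp add: D_def algebra_simps)
  then show ?thesis using K nz by simp
qed

lemma orbit_eq:
  assumes nz: "b * c * (b\<^sup>2 - 4 * a * c) \<noteq> 0" and p: "p \<in> M"
  shows "isometry_orbit M g p = {q \<in> M. fst q = fst p}"
proof (intro equalityI subsetI)
  fix q assume "q \<in> isometry_orbit M g p"
  then obtain U \<phi> where iso: "local_isometry M g U \<phi>" and pU: "p \<in> U" and q: "q = \<phi> p"
    by (auto simp: isometry_orbit_def)
  have qM: "q \<in> M" using domain(3)[OF iso pU] by (simp add: q)
  let ?E = "frechet_derivative \<phi> (at p)"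
  have inj: "inj ?E"
    using linear_injective_0[OF linear_D\<phi>[OF iso pU]] D\<phi>_eq_0[OF iso pU] by blast
  have surj: "surj ?E"
    by (rule linear_injective_imp_surjective[OF linear_D\<phi>[OF iso pU] inj]) simp
  have E: "g q (?E u) (?E v) = g p u v" for u v
    using isometric[OF iso pU] by (simp add: q)
  have R: "?E (riemann g p u v w) = riemann g q (?E u) (?E v) (?E w)" for u v w
    using riemann_natural[OF iso pU] by (simp add: q)
  have "\<bar>B (fst p)\<bar> \<le> \<bar>B (fst q)\<bar>"
    by (rule B_le[OF p qM E R])
  \<comment> \<open>The linear inverse of the differential is enough here; the inverse local
    isometry never has to be considered.\<close>
  moreover have "\<bar>B (fst q)\<bar> \<le> \<bar>B (fst p)\<bar>"
  proof (rule B_le[OF qM p])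
    have inv: "?E (inv ?E y) = y" for y
      by (rule surj_f_inv_f[OF surj])
    show "g p (inv ?E u) (inv ?E v) = g q u v" for u v
      using E[of "inv ?E u" "inv ?E v"] unfolding inv by simp
    fix u v w
    have "riemann g q u v w = ?E (riemann g p (inv ?E u) (inv ?E v) (inv ?E w))"
      using R[of "inv ?E u" "inv ?E v" "inv ?E w"] unfolding inv by simp
    then show "inv ?E (riemann g q u v w) = riemann g p (inv ?E u) (inv ?E v) (inv ?E w)"
      by (simp only: inv_f_f[OF inj])
  qed
  ultimately have "\<bar>B (fst p)\<bar> = \<bar>B (fst q)\<bar>" by simp
  moreover have "pt_ok (fst p)" "pt_ok (fst q)"
    using p qM by (cases p; cases q; simp add: mem_M)+
  ultimately show "q \<in> {q \<in> M. fst q = fst p}"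
    using B_injective[OF nz] qM by auto
next
  fix q assume "q \<in> {q \<in> M. fst q = fst p}"
  then have q: "q \<in> M" "fst p = fst q" by simp_all
  obtain U \<phi> where "local_isometry M g U \<phi>" "p \<in> U" "\<phi> p = q"
    by (rule level_transitive[OF p q])
  then show "q \<in> isometry_orbit M g p"
    by (auto simp: isometry_orbit_def)
qed

lemma cohomogeneity_one_generic:
  assumes nz: "b * c * (b\<^sup>2 - 4 * a * c) \<noteq> 0"
  shows "cohomogeneity_one M g"
  unfolding cohomogeneity_one_def smooth_hypersurface_def
proof (intro ballI)
  fix p q assume p: "p \<in> M" and q: "q \<in> isometry_orbit M g p"
  let ?h = "\<lambda>x::point. fst x + - fst p"
  have "frechet_derivative ?h (at x) = fst" for x
    by (rule frechet_derivative_eqI) (auto intro!: derivative_eq_intros)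
  moreover have "(fst :: point \<Rightarrow> real) \<noteq> (\<lambda>_. 0)"
    by (metis fst_conv zero_neq_one)
  moreover have "smooth_on M ?h"
    by (intro smooth_on_add open_M smooth_on_const smooth_on_bounded_linear[OF bounded_linear_fst]
        smooth_on_ident)
  ultimately show "\<exists>N h. open N \<and> q \<in> N \<and> smooth_on N h \<and>
        (\<forall>x\<in>N. frechet_derivative h (at x) \<noteq> (\<lambda>_. 0)) \<and>
        isometry_orbit M g p \<inter> N = {x \<in> N. h x = (0::real)}"
    using q open_M unfolding orbit_eq[OF nz p]
    by (intro exI[of _ M] exI[of _ ?h]) auto
qed

end

subsection \<open>Killing fields\<close>

lemma commutator_2:
  fixes A B :: "'k::comm_ring_1^2^2"
  shows "commutator A B $ 1 $ 1 = A $ 1 $ 2 * B $ 2 $ 1 - B $ 1 $ 2 * A $ 2 $ 1"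
    and "commutator A B $ 1 $ 2 = (A $ 1 $ 1 - A $ 2 $ 2) * B $ 1 $ 2 - (B $ 1 $ 1 - B $ 2 $ 2) * A $ 1 $ 2"
    and "commutator A B $ 2 $ 1 = (A $ 2 $ 2 - A $ 1 $ 1) * B $ 2 $ 1 - (B $ 2 $ 2 - B $ 1 $ 1) * A $ 2 $ 1"
    and "commutator A B $ 2 $ 2 = A $ 2 $ 1 * B $ 1 $ 2 - B $ 2 $ 1 * A $ 1 $ 2"
  by (simp_all add: commutator_def matrix_matrix_mult_def sum_2 algebra_simps)

lemma mem_u2: "A \<in> u2 \<longleftrightarrow> Re (A $ 1 $ 1) = 0 \<and> Re (A $ 2 $ 2) = 0 \<and> A $ 2 $ 1 = - cnj (A $ 1 $ 2)"
  by (auto simp: u2_def conj_transpose_def vec_eq_iff forall_2 complex_eq_iff)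

lemma mem_u11: "A \<in> u11 \<longleftrightarrow> Re (A $ 1 $ 1) = 0 \<and> Re (A $ 2 $ 2) = 0 \<and> A $ 2 $ 1 = cnj (A $ 1 $ 2)"
  by (auto simp: u11_def J11_def conj_transpose_def matrix_matrix_mult_def sum_2 vec_eq_iff forall_2 complex_eq_iff)

lemma mem_o2: "A \<in> o2 \<longleftrightarrow> A $ 1 $ 1 = 0 \<and> A $ 2 $ 2 = 0 \<and> A $ 1 $ 2 = - A $ 2 $ 1"
  by (auto simp: o2_def transpose_def vec_eq_iff forall_2)

context abc
begin

text \<open>For a \<noteq> 0 this is the velocity at e = 0 of the screws with p = 1 + \<i> e th/2
  and parameter e q, the constant part of the shift being absorbed into \<open>s\<close>. For a = 0
  the same formula combines translations with the rotations generated by \<open>th\<close>, which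
  are not among the screws used above.\<close>

definition killing :: "complex \<Rightarrow> real \<Rightarrow> real \<Rightarrow> point \<Rightarrow> point" where
  "killing q th s x = (0, q + th *\<^sub>R (\<i> * fst (snd x)) + (a / 2) *\<^sub>R (cnj q * (fst (snd x) * fst (snd x))),
     K * b * Im (q * cnj (fst (snd x))) + s)"

lemma killing_has_derivative:
  "(killing q th s has_derivative (\<lambda>w. (0, th *\<^sub>R (\<i> * fst (snd w)) + a *\<^sub>R (cnj q * (fst (snd x) * fst (snd w))),
     K * b * Im (q * cnj (fst (snd w)))))) (at x)"
  unfolding killing_def[abs_def]
  by (rule has_derivative_eq_rhs, (rule derivative_intros)+)
     (simp add: fun_eq_iff complex_eq_iff algebra_simps)

lemma killing_smooth: "smooth_on M (killing q th s)"
proof -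
  note U = open_M
  have z: "smooth_on M (\<lambda>x. fst (snd x))"
    by (rule smooth_on_bounded_linear[OF _ U smooth_on_ident[OF U]])
       (simp add: bounded_linear_fst_comp bounded_linear_snd)
  have lin: "bounded_linear (\<lambda>z. K * b * Im (q * cnj z))"
    unfolding linear_conv_bounded_linear[symmetric] by (rule linearI) (simp_all add: algebra_simps)
  have "smooth_on M (\<lambda>x. (0::real, (q + (of_real th * \<i>) * fst (snd x)) + (of_real (a / 2) * cnj q) * (fst (snd x) * fst (snd x)),
     K * b * Im (q * cnj (fst (snd x))) + s))"
    by (intro smooth_on_Pair smooth_on_add smooth_on_mult smooth_on_const z U smooth_on_bounded_linear[OF lin U z])
  then show ?thesis
    by (simp add: killing_def[abs_def] scaleR_conv_of_real mult.assoc)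
qed

text \<open>The flow preserves \<rho>, \<eta> and \<open>m\<^sup>2 |d\<zeta>|\<^sup>2\<close>
  separately; \<open>form\<close> is the invariance of \<eta>, while \<open>conf\<close> and
  \<open>mY\<close> give that of the surface metric.\<close>

lemma killing_field_killing: "killing_field M g (killing q th s)"
  unfolding killing_field_def
proof (intro conjI ballI allI killing_smooth)
  fix p u v assume p: "p \<in> M"
  obtain r z t where p': "p = (r, z, t)" by (cases p)
  have pos: "1 + a / 2 * (z \<bullet> z) > 0" using p by (simp add: mem_M p')
  let ?X = "killing q th s"
  define Y where "Y = fst (snd (?X p))"
  define k where "k = th *\<^sub>R \<i> + a *\<^sub>R (cnj q * z)"
  have DX: "frechet_derivative ?X (at p) w = (0, k * fst (snd w), K * b * Im (q * cnj (fst (snd w))))" for w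
    using frechet_derivative_eqI[OF killing_has_derivative[of q th s p]]
    by (simp add: k_def p' algebra_simps)
  have m1: "m z * (1 + a / 2 * (z \<bullet> z)) = 1" using pos by (simp add: m_def)
  have "z \<bullet> Y = (1 + a / 2 * (z \<bullet> z)) * (z \<bullet> q)"
    by (simp add: Y_def killing_def p' inner_complex_def algebra_simps add_divide_distrib)
  then have mY: "m z * (z \<bullet> Y) = z \<bullet> q"
    using m1 by (simp flip: mult.assoc)
  \<comment> \<open>The field is holomorphic in \<zeta>, hence conformal, with this rate of
    expansion; \<open>mY\<close> shows that the derivative of \<open>m\<close> along it compensates
    exactly.\<close>
  have conf: "(k * x) \<bullet> y + x \<bullet> (k * y) = 2 * a * (z \<bullet> q) * (x \<bullet> y)" for x y
    by (simp add: k_def inner_complex_def algebra_simps)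
  have form: "d\<eta> z Y (fst (snd w)) + \<eta> p (frechet_derivative ?X (at p) w) = 0" for w
  proof -
    define x where "x = fst (snd w)"
    have "Im (Y * cnj x) - a * (z \<bullet> q) * Im (z * cnj x) + Im (z * cnj (k * x)) = (1 + a / 2 * (z \<bullet> z)) * Im (q * cnj x)"
      by (simp add: Y_def killing_def p' k_def inner_complex_def algebra_simps add_divide_distrib diff_divide_distrib)
    then have *: "m z * (Im (Y * cnj x) - a * (z \<bullet> q) * Im (z * cnj x) + Im (z * cnj (k * x))) = Im (q * cnj x)"
      using m1 by (simp flip: mult.assoc)
    have "d\<eta> z Y x = b * (m z * (Im (Y * cnj x) - a * (z \<bullet> q) * Im (z * cnj x)))"
      unfolding d\<eta>_def mY[symmetric] by (simp add: power2_eq_square algebra_simps)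
    moreover have "\<eta> p (frechet_derivative ?X (at p) w) = - b * Im (q * cnj x) + b * (m z * Im (z * cnj (k * x)))"
      using K unfolding DX unfolding p' form_eq x_def[symmetric] by (simp add: mult_ac)
    ultimately have "d\<eta> z Y x + \<eta> p (frechet_derivative ?X (at p) w)
        = b * (m z * (Im (Y * cnj x) - a * (z \<bullet> q) * Im (z * cnj x) + Im (z * cnj (k * x)))) - b * Im (q * cnj x)"
      by (simp only: distrib_left)
    then show ?thesis unfolding * by (simp add: x_def)
  qed
  have dm: "dmetric g p (?X p) u v = - 2 * G r * a * (m z) ^ 3 * (z \<bullet> Y) * (fst (snd u) \<bullet> fst (snd v))
      + H r * (d\<eta> z Y (fst (snd u)) * \<eta> p v + \<eta> p u * d\<eta> z Y (fst (snd v)))"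
    using frechet_derivative_eqI[OF dmetric_eq[OF p[unfolded p'], of u v]]
    by (simp add: dmetric_def p' Y_def killing_def)
  have g_eq: "g p x y = F r * (fst x * fst y) + G r * (m z)\<^sup>2 * (fst (snd x) \<bullet> fst (snd y)) + H r * (\<eta> p x * \<eta> p y)" for x y
    by (simp add: p' metric_eq)
  define uz where "uz = fst (snd u)"
  define vz where "vz = fst (snd v)"
  define eu where "eu = \<eta> p (frechet_derivative ?X (at p) u)"
  define ev where "ev = \<eta> p (frechet_derivative ?X (at p) v)"
  have fu: "d\<eta> z Y uz = - eu" and fv: "d\<eta> z Y vz = - ev"
    using form[of u] form[of v] by (simp_all add: uz_def vz_def eu_def ev_def)
  have "dmetric g p (?X p) u v + g p (frechet_derivative ?X (at p) u) v + g p u (frechet_derivative ?X (at p) v)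
     = G r * (m z)\<^sup>2 * (((k * uz) \<bullet> vz + uz \<bullet> (k * vz)) - 2 * a * (m z * (z \<bullet> Y)) * (uz \<bullet> vz))"
    unfolding dm g_eq eu_def[symmetric] ev_def[symmetric] uz_def[symmetric] vz_def[symmetric] fu fv
    by (simp add: DX uz_def[symmetric] vz_def[symmetric] power2_eq_square power3_eq_cube algebra_simps)
  also have "\<dots> = 0"
    unfolding conf mY by simp
  finally show "dmetric g p (?X p) u v + g p (frechet_derivative ?X (at p) u) v + g p u (frechet_derivative ?X (at p) v) = 0" .
qed

text \<open>A polynomial identity. For linear vector fields this bracket is minus the matrix
  commutator, which fixes the signs in the isomorphisms below.\<close>

lemma killing_bracket:
  "lie_bracket_vf (killing q1 th1 s1) (killing q2 th2 s2) p =
     killing (th2 *\<^sub>R (\<i> * q1) - th1 *\<^sub>R (\<i> * q2)) (2 * a * Im (q1 * cnj q2)) (- 2 * K * b * Im (q1 * cnj q2)) p"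
proof -
  note D = frechet_derivative_eqI[OF killing_has_derivative]
  show ?thesis
    unfolding lie_bracket_vf_def D
    by (simp add: killing_def complex_eq_iff algebra_simps)
qed

text \<open>The rotation \<open>th\<close> is chosen to turn the quadratic term a/2 cnj q z^2 into
  a/2 |z|^2 q; then q / m is the \<zeta>-component, and \<open>s\<close> adjusts t.\<close>

lemma killing_tangent:
  assumes "p \<in> M" "fst v = 0"
  shows "\<exists>q th s. killing q th s p = v"
proof -
  obtain r z t where p: "p = (r, z, t)" by (cases p)
  obtain v' t' where v: "v = (0, v', t')" using assms(2) by (cases v) auto
  have "1 + a / 2 * (z \<bullet> z) > 0" using assms(1) by (simp add: mem_M p)
  then have m1: "m z * (1 + a / 2 * (z \<bullet> z)) = 1" by (simp add: m_def)
  define q where "q = m z *\<^sub>R v'"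
  define th where "th = a * m z * Im (v' * cnj z)"
  have "q + th *\<^sub>R (\<i> * z) + (a / 2) *\<^sub>R (cnj q * (z * z)) = (m z * (1 + a / 2 * (z \<bullet> z))) *\<^sub>R v'"
    by (simp add: q_def th_def complex_eq_iff inner_complex_def algebra_simps)
  then have "q + th *\<^sub>R (\<i> * z) + (a / 2) *\<^sub>R (cnj q * (z * z)) = v'"
    unfolding m1 by simp
  then have "killing q th (t' - K * b * Im (q * cnj z)) p = v"
    unfolding killing_def p v by simp
  then show ?thesis by blast
qed

text \<open>The value at \<zeta> = 0 detects \<open>q\<close> and \<open>s\<close>; a rotation
  vanishes there and needs a second point with \<zeta> \<noteq> 0.\<close>

lemma killing_eq_0:
  assumes "M \<noteq> {}" "\<And>p. p \<in> M \<Longrightarrow> killing q th s p = 0"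
  shows "q = 0 \<and> th = 0 \<and> s = 0"
proof -
  obtain r z t where "(r, z, t) \<in> M" using assms(1) by auto
  then have ok: "pt_ok r" by (simp add: mem_M)
  have "killing q th s (r, 0, 0) = 0"
    by (rule assms(2)) (simp add: mem_M ok)
  then have qs: "q = 0" "s = 0" by (simp_all add: killing_def zero_prod_def)
  \<comment> \<open>Small enough for |a| e^2 \<le> 1, so the point lies in the domain also for
    negative \<open>a\<close>.\<close>
  define e where "e = 1 / (\<bar>a\<bar> + 1)"
  have e: "0 < e" "\<bar>a\<bar> * e \<le> 1" "e \<le> 1" by (simp_all add: e_def field_simps)
  then have "\<bar>a\<bar> * (e * e) \<le> 1 * 1"
    unfolding mult.assoc[symmetric] by (intro mult_mono) auto
  then have "\<bar>a * (e * e)\<bar> \<le> 1"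
    using e(1) by (simp add: abs_mult)
  then have "1 + a / 2 * (of_real e \<bullet> (of_real e :: complex)) > 0"
    by (simp add: inner_complex_def)
  then have "killing q th s (r, of_real e, 0) = 0"
    by (intro assms(2)) (simp add: mem_M ok)
  then have "th = 0"
    using e(1) by (simp add: killing_def qs zero_prod_def)
  then show ?thesis using qs by simp
qed

text \<open>The triple (qq, th, s) is a linear parametrisation of \<open>L\<close> by the parameters
  of \<open>killing\<close>. Once it is bijective on \<open>L\<close> and matches
  \<open>killing_bracket\<close>, faithfulness comes from \<open>killing_eq_0\<close> and
  transitivity from \<open>killing_tangent\<close>.\<close>

lemma transitive_action:
  fixes L :: "'l::real_vector set"
  assumes M: "M \<noteq> {}"
    and add: "\<And>x y. qq (x + y) = qq x + qq y" "\<And>x y. th (x + y) = th x + th y" "\<And>x y. s (x + y) = s x + s y"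
    and scale: "\<And>c x. qq (c *\<^sub>R x) = c *\<^sub>R qq x" "\<And>c x. th (c *\<^sub>R x) = c * th x" "\<And>c x. s (c *\<^sub>R x) = c * s x"
    and br: "\<And>x y. x \<in> L \<Longrightarrow> y \<in> L \<Longrightarrow> qq (br x y) = th y *\<^sub>R (\<i> * qq x) - th x *\<^sub>R (\<i> * qq y)"
      "\<And>x y. x \<in> L \<Longrightarrow> y \<in> L \<Longrightarrow> th (br x y) = 2 * a * Im (qq x * cnj (qq y))"
      "\<And>x y. x \<in> L \<Longrightarrow> y \<in> L \<Longrightarrow> s (br x y) = - 2 * K * b * Im (qq x * cnj (qq y))"
    and inj: "\<And>x. x \<in> L \<Longrightarrow> qq x = 0 \<Longrightarrow> th x = 0 \<Longrightarrow> s x = 0 \<Longrightarrow> x = 0"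
    and surj: "\<And>q' th' s'. \<exists>x\<in>L. qq x = q' \<and> th x = th' \<and> s x = s'"
  shows "transitive_action_on_levels M g fst L br"
proof -
  define \<Phi> where "\<Phi> x = killing (qq x) (th x) (s x)" for x
  have "isometric_lie_action M g L br \<Phi>"
    unfolding isometric_lie_action_def
  proof (intro conjI ballI allI impI)
    show "killing_field M g (\<Phi> x)" for x by (simp add: \<Phi>_def killing_field_killing)
    show "\<Phi> (x + y) p = \<Phi> x p + \<Phi> y p" for x y p
      by (simp add: \<Phi>_def add killing_def algebra_simps)
    show "\<Phi> (c *\<^sub>R x) p = c *\<^sub>R \<Phi> x p" for c x p
      by (simp add: \<Phi>_def scale killing_def algebra_simps)
    show "\<Phi> (br x y) p = lie_bracket_vf (\<Phi> x) (\<Phi> y) p" if "x \<in> L" "y \<in> L" for x y p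
      by (simp add: \<Phi>_def killing_bracket br that)
    show "x = 0" if "x \<in> L" "\<forall>p\<in>M. \<Phi> x p = 0" for x
      using killing_eq_0[OF M, of "qq x" "th x" "s x"] that inj by (auto simp: \<Phi>_def)
  qed
  moreover have "span {\<Phi> x p |x. x \<in> L} = {v. frechet_derivative fst (at p) v = 0}" if p: "p \<in> M" for p
  proof -
    have "frechet_derivative fst (at p) = fst"
      by (rule frechet_derivative_eqI) (auto intro!: derivative_eq_intros)
    moreover have "{\<Phi> x p |x. x \<in> L} = {v. fst v = 0}"
    proof (intro equalityI subsetI)
      fix v assume "v \<in> {v::point. fst v = 0}"
      then obtain q' th' s' where "killing q' th' s' p = v"
        using killing_tangent[OF p, of v] by auto
      moreover obtain x where "x \<in> L" "qq x = q'" "th x = th'" "s x = s'"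
        using surj by metis
      ultimately show "v \<in> {\<Phi> x p |x. x \<in> L}"
        by (auto simp: \<Phi>_def)
    qed (auto simp: \<Phi>_def killing_def)
    moreover have "subspace {v::point. fst v = 0}"
      by (simp add: subspace_def)
    ultimately show ?thesis
      by (simp add: span_eq_iff)
  qed
  ultimately show ?thesis
    unfolding transitive_action_on_levels_def by blast
qed

section \<open>Identification of the Killing algebra with the three named Lie algebras\<close>

lemma Im_scaleR_mult_cnj: "Im ((k *\<^sub>R z) * cnj (k *\<^sub>R z')) = k * k * Im (z * cnj z')"
  by (simp add: algebra_simps)

text \<open>The minus sign in \<open>th\<close> turns the reversed bracket of rotation fields into
  the matrix action. The factor \<open>2 * K * b\<close> arises because Im(q cnj q') is minus the
  standard area form; it is nonzero, so the centre acts effectively.\<close>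

lemma action_o2_heis:
  assumes M: "M \<noteq> {}" and b: "b \<noteq> 0" and a: "a = 0"
  shows "transitive_action_on_levels M g fst o2_heis o2_heis_bracket"
proof (rule transitive_action[where qq = "\<lambda>x. Complex (fst (snd x) $ 1) (fst (snd x) $ 2)"
      and th = "\<lambda>x. - (fst x $ 2 $ 1)" and s = "\<lambda>x. 2 * K * b * snd (snd x)", OF M])
  show "\<exists>x\<in>o2_heis. Complex (fst (snd x) $ 1) (fst (snd x) $ 2) = q' \<and> - (fst x $ 2 $ 1) = th' \<and> 2 * K * b * snd (snd x) = s'"
    for q' th' s'
    by (rule bexI[of _ "(vector [vector [0, th'], vector [- th', 0]], (vector [Re q', Im q'], s' / (2 * K * b)))"])
       (use K b in \<open>simp_all add: o2_heis_def mem_o2\<close>)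
next
  fix x :: "(real^2^2) \<times> ((real^2) \<times> real)"
  assume "x \<in> o2_heis" "Complex (fst (snd x) $ 1) (fst (snd x) $ 2) = 0" "- (fst x $ 2 $ 1) = 0" "2 * K * b * snd (snd x) = 0"
  then show "x = 0"
    using K b by (simp add: o2_heis_def mem_Times_iff mem_o2 prod_eq_iff vec_eq_iff forall_2 complex_eq_iff)
next
  fix x y :: "(real^2^2) \<times> ((real^2) \<times> real)"
  assume *: "x \<in> o2_heis" "y \<in> o2_heis"
  show "Complex (fst (snd (o2_heis_bracket x y)) $ 1) (fst (snd (o2_heis_bracket x y)) $ 2)
      = - (fst y $ 2 $ 1) *\<^sub>R (\<i> * Complex (fst (snd x) $ 1) (fst (snd x) $ 2))
        - - (fst x $ 2 $ 1) *\<^sub>R (\<i> * Complex (fst (snd y) $ 1) (fst (snd y) $ 2))"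
    using * by (simp add: o2_heis_def mem_Times_iff mem_o2 o2_heis_bracket_def o2_deriv_def heis_bracket_def
        matrix_vector_mult_def sum_2 complex_eq_iff)
  show "- (fst (o2_heis_bracket x y) $ 2 $ 1)
      = 2 * a * Im (Complex (fst (snd x) $ 1) (fst (snd x) $ 2) * cnj (Complex (fst (snd y) $ 1) (fst (snd y) $ 2)))"
    using * unfolding a by (simp add: o2_heis_def mem_Times_iff mem_o2 o2_heis_bracket_def commutator_2)
  show "2 * K * b * snd (snd (o2_heis_bracket x y))
      = - 2 * K * b * Im (Complex (fst (snd x) $ 1) (fst (snd x) $ 2) * cnj (Complex (fst (snd y) $ 1) (fst (snd y) $ 2)))"
    by (simp add: o2_heis_bracket_def o2_deriv_def heis_bracket_def algebra_simps)
qed (simp_all add: complex_eq_iff algebra_simps)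

text \<open>The factor sqrt(2/a) rescales the unit sphere coordinate to 1 + a/2 |\<zeta>|^2. The
  combination s + (K b/a) th equals K b/a times the imaginary part of the trace, which vanishes on
  commutators; this fixes the choice of \<open>s\<close>.\<close>

lemma action_u2:
  assumes M: "M \<noteq> {}" and b: "b \<noteq> 0" and a: "a > 0"
  shows "transitive_action_on_levels M g fst u2 commutator"
proof (rule transitive_action[where qq = "\<lambda>x. sqrt (2 / a) *\<^sub>R (x $ 1 $ 2)"
      and th = "\<lambda>x. Im (x $ 2 $ 2) - Im (x $ 1 $ 1)" and s = "\<lambda>x. 2 * K * b / a * Im (x $ 1 $ 1)", OF M])
  have a_nz: "a \<noteq> 0" "sqrt (2 / a) \<noteq> 0" using a by simp_all
  have sq: "sqrt (2 / a) * sqrt (2 / a) = 2 / a" using a by simp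
  show "\<exists>x\<in>u2. sqrt (2 / a) *\<^sub>R (x $ 1 $ 2) = q' \<and> Im (x $ 2 $ 2) - Im (x $ 1 $ 1) = th' \<and> 2 * K * b / a * Im (x $ 1 $ 1) = s'"
    for q' th' s'
  proof -
    define P where "P = s' * a / (2 * K * b)"
    define w where "w = (1 / sqrt (2 / a)) *\<^sub>R q'"
    have "2 * K * b / a * P = s'" using K b a_nz(1) by (simp add: P_def)
    moreover have "sqrt (2 / a) *\<^sub>R w = q'" using a_nz(2) by (simp only: w_def scaleR_scaleR) simp
    ultimately show ?thesis
      by (intro bexI[of _ "vector [vector [Complex 0 P, w], vector [- cnj w, Complex 0 (th' + P)]]"])
         (simp_all add: mem_u2)
  qed
  fix x y :: "complex^2^2"
  show "x = 0" if "x \<in> u2" "sqrt (2 / a) *\<^sub>R (x $ 1 $ 2) = 0" "Im (x $ 2 $ 2) - Im (x $ 1 $ 1) = 0"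
    "2 * K * b / a * Im (x $ 1 $ 1) = 0"
    using that K b a_nz(1) by (auto simp: mem_u2 vec_eq_iff forall_2 complex_eq_iff)
  assume *: "x \<in> u2" "y \<in> u2"
  have n: "Im (sqrt (2 / a) *\<^sub>R z * cnj (sqrt (2 / a) *\<^sub>R z')) = 2 / a * Im (z * cnj z')" for z z'
    unfolding Im_scaleR_mult_cnj sq ..
  show "sqrt (2 / a) *\<^sub>R (commutator x y $ 1 $ 2)
     = (Im (y $ 2 $ 2) - Im (y $ 1 $ 1)) *\<^sub>R (\<i> * sqrt (2 / a) *\<^sub>R (x $ 1 $ 2))
     - (Im (x $ 2 $ 2) - Im (x $ 1 $ 1)) *\<^sub>R (\<i> * sqrt (2 / a) *\<^sub>R (y $ 1 $ 2))"
    using * unfolding commutator_2 by (simp add: mem_u2 complex_eq_iff algebra_simps del: real_sqrt_divide)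
  show "Im (commutator x y $ 2 $ 2) - Im (commutator x y $ 1 $ 1)
     = 2 * a * Im (sqrt (2 / a) *\<^sub>R (x $ 1 $ 2) * cnj (sqrt (2 / a) *\<^sub>R (y $ 1 $ 2)))"
    unfolding n commutator_2 using * a_nz(1) by (simp add: mem_u2)
  show "2 * K * b / a * Im (commutator x y $ 1 $ 1)
     = - 2 * K * b * Im (sqrt (2 / a) *\<^sub>R (x $ 1 $ 2) * cnj (sqrt (2 / a) *\<^sub>R (y $ 1 $ 2)))"
    unfolding n commutator_2 using * a_nz(1) by (simp add: mem_u2 field_simps)
qed (simp_all add: algebra_simps add_divide_distrib del: real_sqrt_divide)

text \<open>In \<open>u11\<close> the lower left entry is plus the conjugate of the upper right one,
  which reverses the sign of the diagonal of a commutator of off-diagonal matrices. The rescaling by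
  -2/a, positive now, has product -4 with \<open>2 * a\<close> and matches this.\<close>

lemma action_u11:
  assumes M: "M \<noteq> {}" and b: "b \<noteq> 0" and a: "a < 0"
  shows "transitive_action_on_levels M g fst u11 commutator"
proof (rule transitive_action[where qq = "\<lambda>x. sqrt (- 2 / a) *\<^sub>R (x $ 1 $ 2)"
      and th = "\<lambda>x. Im (x $ 2 $ 2) - Im (x $ 1 $ 1)" and s = "\<lambda>x. 2 * K * b / a * Im (x $ 1 $ 1)", OF M])
  have a_nz: "a \<noteq> 0" "sqrt (- 2 / a) \<noteq> 0" using a by simp_all
  have sq: "sqrt (- 2 / a) * sqrt (- 2 / a) = - 2 / a" using a by simp
  show "\<exists>x\<in>u11. sqrt (- 2 / a) *\<^sub>R (x $ 1 $ 2) = q' \<and> Im (x $ 2 $ 2) - Im (x $ 1 $ 1) = th' \<and> 2 * K * b / a * Im (x $ 1 $ 1) = s'"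
    for q' th' s'
  proof -
    define P where "P = s' * a / (2 * K * b)"
    define w where "w = (1 / sqrt (- 2 / a)) *\<^sub>R q'"
    have "2 * K * b / a * P = s'" using K b a_nz(1) by (simp add: P_def)
    moreover have "sqrt (- 2 / a) *\<^sub>R w = q'" using a_nz(2) by (simp only: w_def scaleR_scaleR) simp
    ultimately show ?thesis
      by (intro bexI[of _ "vector [vector [Complex 0 P, w], vector [cnj w, Complex 0 (th' + P)]]"])
         (simp_all add: mem_u11)
  qed
  fix x y :: "complex^2^2"
  show "x = 0" if "x \<in> u11" "sqrt (- 2 / a) *\<^sub>R (x $ 1 $ 2) = 0" "Im (x $ 2 $ 2) - Im (x $ 1 $ 1) = 0"
    "2 * K * b / a * Im (x $ 1 $ 1) = 0"
    using that K b a_nz(1) by (auto simp: mem_u11 vec_eq_iff forall_2 complex_eq_iff)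
  assume *: "x \<in> u11" "y \<in> u11"
  have n: "Im (sqrt (- 2 / a) *\<^sub>R z * cnj (sqrt (- 2 / a) *\<^sub>R z')) = - 2 / a * Im (z * cnj z')" for z z'
    unfolding Im_scaleR_mult_cnj sq ..
  show "sqrt (- 2 / a) *\<^sub>R (commutator x y $ 1 $ 2)
     = (Im (y $ 2 $ 2) - Im (y $ 1 $ 1)) *\<^sub>R (\<i> * sqrt (- 2 / a) *\<^sub>R (x $ 1 $ 2))
     - (Im (x $ 2 $ 2) - Im (x $ 1 $ 1)) *\<^sub>R (\<i> * sqrt (- 2 / a) *\<^sub>R (y $ 1 $ 2))"
    using * unfolding commutator_2 by (simp add: mem_u11 complex_eq_iff algebra_simps del: real_sqrt_divide)
  show "Im (commutator x y $ 2 $ 2) - Im (commutator x y $ 1 $ 1)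
     = 2 * a * Im (sqrt (- 2 / a) *\<^sub>R (x $ 1 $ 2) * cnj (sqrt (- 2 / a) *\<^sub>R (y $ 1 $ 2)))"
    unfolding n commutator_2 using * a_nz(1) by (simp add: mem_u11)
  show "2 * K * b / a * Im (commutator x y $ 1 $ 1)
     = - 2 * K * b * Im (sqrt (- 2 / a) *\<^sub>R (x $ 1 $ 2) * cnj (sqrt (- 2 / a) *\<^sub>R (y $ 1 $ 2)))"
    unfolding n commutator_2 using * a_nz(1) by (simp add: mem_u11)
qed (simp_all add: algebra_simps add_divide_distrib del: real_sqrt_divide)

end

text \<open>Nonemptiness of the manifold makes the actions faithful: on the empty set all vector
  fields are identified with zero. The cohomogeneity one case gives b \<noteq> 0, so the central
  Killing field is reached by each of the three algebras.\<close>

theorem proposition6p3: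
  fixes a b c K :: real
  assumes "K \<noteq> 0"
    and "abc_manifold a b c K \<noteq> {}"
  shows "(b * c * (b\<^sup>2 - 4 * a * c) = 0 \<longrightarrow>
            locally_symmetric (abc_manifold a b c K) (abc_metric a b c K)) \<and>
         (b * c * (b\<^sup>2 - 4 * a * c) \<noteq> 0 \<longrightarrow>
            cohomogeneity_one (abc_manifold a b c K) (abc_metric a b c K) \<and>
            (a = 0 \<longrightarrow> transitive_action_on_levels (abc_manifold a b c K) (abc_metric a b c K)
                         fst o2_heis o2_heis_bracket) \<and>
            (a > 0 \<longrightarrow> transitive_action_on_levels (abc_manifold a b c K) (abc_metric a b c K)
                         fst u2 commutator) \<and>
            (a < 0 \<longrightarrow> transitive_action_on_levels (abc_manifold a b c K) (abc_metric a b c K)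
                         fst u11 commutator))"
proof -
  interpret abc a b c K by unfold_locales (rule assms(1))
  have "b \<noteq> 0" if "b * c * (b\<^sup>2 - 4 * a * c) \<noteq> 0" using that by auto
  then show ?thesis
    using locally_symmetric_degenerate cohomogeneity_one_generic
      action_o2_heis[OF assms(2)] action_u2[OF assms(2)] action_u11[OF assms(2)]
    by blast
qed

end
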